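(* Let $(M,\mathcal{F},g)$ be a compact connected Riemannian manifold carrying a codimension one foliation $\mathcal{F}$ transverse to the boundary $\partial M\neq\emptyset$. Let $S$ be a transverse connected component of $\partial M$ with $\partial S=\emptyset$, and assume that $\mathcal{F}|_S$ is defined by a closed non-singular $1$-form $\omega$ on $S$. Let $\mathcal{F}_S$ be the foliation of $M$ obtained from $\mathcal{F}$ by spinning along $S$. Let $\pi:M\to\mathrm{HLS}(\mathcal{F})$ be the natural projection and let $(X,d_X)$ be the metric space obtained from $\mathrm{HLS}(\mathcal{F})$ by identifying the points of $\pi(S)$ to a single point, with the quotient metric. Then $\mathrm{HLS}(\mathcal{F}_S)$ is isometric to $(X,d_X)$.
   Context: Hausdorff leaf space: for a compact connected foliated Riemannian manifold $(M,\mathcal{F},g)$ with Riemannian distance $d$ and set of leaves $\mathcal{L}$, put $\mathrm{dist}(L,L')=\inf\{d(x,y):x\in L,\,y\in L'\}$ and $$\rho(L,L')=\inf\Big\{\sum_{i=1}^{n-1}\mathrm{dist}(L_i,L_{i+1})\Big\},$$ the infimum being over all finite sequences of leaves $L_1,\dots,L_n$ with $L_1=L$, $L_n=L'$. Put $L\sim L'$ iff $\rho(L,L')=0$, $\tilde{\mathcal{L}}=\mathcal{L}/_\sim$ and $\tilde\rho([L],[L'])=\rho(L,L')$. The metric space $(\tilde{\mathcal{L}},\tilde\rho)$ is the Hausdorff leaf space $\mathrm{HLS}(\mathcal{F})$; the natural projection $M\to\mathrm{HLS}(\mathcal{F})$ sends $x$ to the class of the leaf through $x$. Both $\mathrm{HLS}(\mathcal{F})$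 and $\mathrm{HLS}(\mathcal{F}_S)$ are taken with respect to the same metric $g$. Spinning: let $N(S)=S\times[0,1)$ be a foliated collar of $S=S\times\{0\}$, i.e. the leaves of $\mathcal{F}|_{N(S)}$ are of the form $L\times[0,1)$ with $L$ a leaf of $\mathcal{F}|_S$. Extend $\omega$ to a closed non-singular form $\omega_{N(S)}$ on $N(S)$ by $\omega_{N(S)}(a v+b\,\partial_t)=a\,\omega(v)$ for $v$ a vector field on $S$ and $a,b\in C^\infty(N(S))$. Let $h:[0,1)\to[0,1]$ be $C^\infty$ with $h(0)=1$, $h(t)=0$ for $t\in[\frac12,1)$, $h$ strictly decreasing on $[0,\frac12]$, and all derivatives of $h$ vanishing at $t=0$. The form $\theta=(1-h(t))\,\omega_{N(S)}+h(t)\,dt$ is integrable, agrees with $\omega_{N(S)}$ on $S\times[\frac12,1)$ and with $dt$ on $S\times\{0\}$; it defines a foliation of $N(S)$ which coincides with $\mathcal{F}$ outside $S\times[0,\frac12)$ and has $S$ as a leaf. $\mathcal{F}_S$ is this foliation on $N(S)$, extended by $\mathcal{F}$ to the rest of $M$. Quotient metric: for a metric space $(Y,d)$ with an equivalence relation $R$, put $d_R(x,y)=\inf\sum_{i=1}^k d(p_i,q_i)$ over all $k$ and all $p_1,q_1,\dots,p_k,q_k\in Y$ with $p_1=x$, $q_k=y$ and $(p_{i+1},q_i)\in R$ for $1\le i<k$; points at $d_R$-distance $0$ are identified. *)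

theory Defs
  imports "HOL-Analysis.Analysis"
begin

section \<open>Smooth maps on subsets of Euclidean spaces\<close>

text \<open>\<open>C_k k f U\<close> is meant for open \<open>U\<close>.  In finite dimension it suffices to iterate
  directional derivatives, since a function with continuous directional derivatives is
  continuously differentiable.\<close>

primrec C_k :: "nat \<Rightarrow> ('a::euclidean_space \<Rightarrow> 'b::real_normed_vector) \<Rightarrow> 'a set \<Rightarrow> bool" where
  "C_k 0 f U \<longleftrightarrow> continuous_on U f"
| "C_k (Suc k) f U \<longleftrightarrow>
     (\<exists>f'. (\<forall>x\<in>U. (f has_derivative f' x) (at x)) \<and> (\<forall>v. C_k k (\<lambda>x. f' x v) U))"

text \<open>On a set that need not be open (such as a relatively open part of a half space),
  smooth means: locally the restriction of a smooth map defined on an open set.\<close>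

definition smooth_on :: "'a::euclidean_space set \<Rightarrow> ('a \<Rightarrow> 'b::real_normed_vector) \<Rightarrow> bool" where
  "smooth_on B f \<longleftrightarrow>
     (\<forall>x\<in>B. \<exists>U g. open U \<and> x \<in> U \<and> (\<forall>k. C_k k g U) \<and> (\<forall>y\<in>U \<inter> B. g y = f y))"

section \<open>Smooth manifolds with boundary\<close>

text \<open>A chart is a pair of a domain and a coordinate map; the values of the coordinate map
  outside the domain are irrelevant.\<close>

type_synonym ('m, 'e) chart = "'m set \<times> ('m \<Rightarrow> 'e)"

abbreviation dom_of :: "('m, 'e) chart \<Rightarrow> 'm set" where
  "dom_of \<equiv> fst"

abbreviation coord :: "('m, 'e) chart \<Rightarrow> 'm \<Rightarrow> 'e" where
  "coord \<equiv> snd"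

abbreviation param :: "('m, 'e) chart \<Rightarrow> 'e \<Rightarrow> 'm" where
  "param c \<equiv> inv_into (dom_of c) (coord c)"

text \<open>Manifolds are modelled on a set \<open>H\<close>: \<open>half_space\<close> for manifolds with boundary, \<open>UNIV\<close>
  for manifolds without boundary.\<close>

definition half_space :: "('e::euclidean_space \<times> real) set" where
  "half_space = {z. 0 \<le> snd z}"

definition is_chart :: "'m topology \<Rightarrow> 'e::euclidean_space set \<Rightarrow> ('m, 'e) chart \<Rightarrow> bool" where
  "is_chart X H c \<longleftrightarrow>
     openin X (dom_of c) \<and>
     openin (top_of_set H) (coord c ` dom_of c) \<and>
     homeomorphic_map (subtopology X (dom_of c)) (top_of_set (coord c ` dom_of c)) (coord c)"

definition compatible ::
  "('m, 'e::euclidean_space) chart \<Rightarrow> ('m, 'e) chart \<Rightarrow> bool" where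
  "compatible c c' \<longleftrightarrow>
     smooth_on (coord c ` (dom_of c \<inter> dom_of c')) (coord c' \<circ> param c) \<and>
     smooth_on (coord c' ` (dom_of c \<inter> dom_of c')) (coord c \<circ> param c')"

text \<open>\<open>A\<close> is the maximal smooth atlas.\<close>

definition smooth_manifold ::
  "'m topology \<Rightarrow> 'e::euclidean_space set \<Rightarrow> ('m, 'e) chart set \<Rightarrow> bool" where
  "smooth_manifold X H A \<longleftrightarrow>
     Hausdorff_space X \<and> second_countable X \<and>
     (\<forall>c\<in>A. is_chart X H c) \<and>
     topspace X = (\<Union>c\<in>A. dom_of c) \<and>
     (\<forall>c\<in>A. \<forall>c'\<in>A. compatible c c') \<and>
     (\<forall>c. is_chart X H c \<and> (\<forall>c'\<in>A. compatible c c') \<longrightarrow> c \<in> A)"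

definition manifold_boundary :: "('m, 'e::euclidean_space \<times> real) chart set \<Rightarrow> 'm set" where
  "manifold_boundary A = {p. \<exists>c\<in>A. p \<in> dom_of c \<and> snd (coord c p) = 0}"

text \<open>The smooth structure induced on an open and closed part \<open>S\<close> of the boundary: the charts
  of \<open>S\<close> that are compatible with all restrictions of charts of \<open>A\<close> to the boundary.\<close>

definition boundary_atlas ::
  "'m topology \<Rightarrow> ('m, 'e::euclidean_space \<times> real) chart set \<Rightarrow> 'm set \<Rightarrow> ('m, 'e) chart set" where
  "boundary_atlas X A S =
     {c. is_chart (subtopology X S) UNIV c \<and>
         (\<forall>c'\<in>A. compatible c (dom_of c' \<inter> S, fst \<circ> coord c'))}"

text \<open>\<open>D\<close> is the differential at \<open>p\<close> of the map \<open>f\<close>, expressed in the charts \<open>c\<close> (at \<open>p\<close>) and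
  \<open>c'\<close> (at \<open>f p\<close>).  With \<open>f = id\<close> this is the change of coordinates on tangent vectors.\<close>

definition differential ::
  "('m \<Rightarrow> 'n) \<Rightarrow> ('m, 'a::euclidean_space) chart \<Rightarrow> ('n, 'b::euclidean_space) chart
     \<Rightarrow> 'm \<Rightarrow> ('a \<Rightarrow> 'b) \<Rightarrow> bool" where
  "differential f c c' p D \<longleftrightarrow>
     ((coord c' \<circ> f \<circ> param c) has_derivative D) (at (coord c p) within coord c ` dom_of c)"

section \<open>Riemannian metrics and 1-forms\<close>

text \<open>Tensor fields are given by their components in each chart, subject to the
  transformation law.  Values on charts outside the atlas or at points outside the domain
  of the chart are irrelevant.\<close>

definition riemannian_metric ::
  "('m, 'e::euclidean_space) chart set \<Rightarrow> (('m, 'e) chart \<Rightarrow> 'm \<Rightarrow> 'e \<Rightarrow> 'e \<Rightarrow> real) \<Rightarrow> bool" where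
  "riemannian_metric A g \<longleftrightarrow>
     (\<forall>c\<in>A. \<forall>p\<in>dom_of c.
        bilinear (g c p) \<and>
        (\<forall>v w. g c p v w = g c p w v) \<and>
        (\<forall>v. v \<noteq> 0 \<longrightarrow> g c p v v > 0)) \<and>
     (\<forall>c\<in>A. \<forall>v w. smooth_on (coord c ` dom_of c) (\<lambda>x. g c (param c x) v w)) \<and>
     (\<forall>c\<in>A. \<forall>c'\<in>A. \<forall>p\<in>dom_of c \<inter> dom_of c'. \<forall>D. differential id c c' p D \<longrightarrow>
        (\<forall>v w. g c p v w = g c' p (D v) (D w)))"

definition one_form ::
  "('m, 'e::euclidean_space) chart set \<Rightarrow> (('m, 'e) chart \<Rightarrow> 'm \<Rightarrow> 'e \<Rightarrow> real) \<Rightarrow> bool" where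
  "one_form A \<omega> \<longleftrightarrow>
     (\<forall>c\<in>A. \<forall>p\<in>dom_of c. linear (\<omega> c p)) \<and>
     (\<forall>c\<in>A. \<forall>v. smooth_on (coord c ` dom_of c) (\<lambda>x. \<omega> c (param c x) v)) \<and>
     (\<forall>c\<in>A. \<forall>c'\<in>A. \<forall>p\<in>dom_of c \<inter> dom_of c'. \<forall>D. differential id c c' p D \<longrightarrow>
        (\<forall>v. \<omega> c p v = \<omega> c' p (D v)))"

text \<open>\<open>d\<omega> = 0\<close>, evaluated on pairs of constant coordinate fields; used on manifolds without
  boundary only, where coordinate domains are open.\<close>

definition closed_form ::
  "('m, 'e::euclidean_space) chart set \<Rightarrow> (('m, 'e) chart \<Rightarrow> 'm \<Rightarrow> 'e \<Rightarrow> real) \<Rightarrow> bool" where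
  "closed_form A \<omega> \<longleftrightarrow>
     (\<forall>c\<in>A. \<forall>p\<in>dom_of c. \<forall>v w.
        frechet_derivative (\<lambda>x. \<omega> c (param c x) w) (at (coord c p)) v =
        frechet_derivative (\<lambda>x. \<omega> c (param c x) v) (at (coord c p)) w)"

definition nonsingular_form ::
  "('m, 'e::euclidean_space) chart set \<Rightarrow> (('m, 'e) chart \<Rightarrow> 'm \<Rightarrow> 'e \<Rightarrow> real) \<Rightarrow> bool" where
  "nonsingular_form A \<omega> \<longleftrightarrow> (\<forall>c\<in>A. \<forall>p\<in>dom_of c. \<exists>v. \<omega> c p v \<noteq> 0)"

section \<open>Riemannian distance\<close>

definition C1_arc ::
  "'m topology \<Rightarrow> ('m, 'e::euclidean_space) chart set \<Rightarrow> (real \<Rightarrow> 'm) \<Rightarrow> real \<Rightarrow> real \<Rightarrow> bool" where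
  "C1_arc X A \<gamma> a b \<longleftrightarrow>
     continuous_map (top_of_set {a..b}) X \<gamma> \<and>
     (\<forall>c\<in>A. \<exists>\<gamma>'. continuous_on {s\<in>{a..b}. \<gamma> s \<in> dom_of c} \<gamma>' \<and>
        (\<forall>s\<in>{a..b}. \<gamma> s \<in> dom_of c \<longrightarrow>
           ((coord c \<circ> \<gamma>) has_vector_derivative \<gamma>' s) (at s within {a..b})))"

definition piecewise_C1_curve ::
  "'m topology \<Rightarrow> ('m, 'e::euclidean_space) chart set \<Rightarrow> (real \<Rightarrow> 'm) \<Rightarrow> bool" where
  "piecewise_C1_curve X A \<gamma> \<longleftrightarrow>
     (\<exists>(t::nat \<Rightarrow> real) n. t 0 = 0 \<and> t n = 1 \<and>
        (\<forall>i<n. t i < t (Suc i) \<and> C1_arc X A \<gamma> (t i) (t (Suc i))))"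

text \<open>The speed is unspecified at the finitely many break points of the curve, which does not
  affect the length.\<close>

definition speed ::
  "('m, 'e::euclidean_space) chart set \<Rightarrow> (('m, 'e) chart \<Rightarrow> 'm \<Rightarrow> 'e \<Rightarrow> 'e \<Rightarrow> real)
     \<Rightarrow> (real \<Rightarrow> 'm) \<Rightarrow> real \<Rightarrow> real" where
  "speed A g \<gamma> s =
     (THE r. \<exists>c\<in>A. \<exists>w. \<gamma> s \<in> dom_of c \<and>
        ((coord c \<circ> \<gamma>) has_vector_derivative w) (at s within {0..1}) \<and>
        r = sqrt (g c (\<gamma> s) w w))"

definition curve_length ::
  "('m, 'e::euclidean_space) chart set \<Rightarrow> (('m, 'e) chart \<Rightarrow> 'm \<Rightarrow> 'e \<Rightarrow> 'e \<Rightarrow> real)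
     \<Rightarrow> (real \<Rightarrow> 'm) \<Rightarrow> real" where
  "curve_length A g \<gamma> = integral {0..1} (speed A g \<gamma>)"

definition riemannian_dist ::
  "'m topology \<Rightarrow> ('m, 'e::euclidean_space) chart set
     \<Rightarrow> (('m, 'e) chart \<Rightarrow> 'm \<Rightarrow> 'e \<Rightarrow> 'e \<Rightarrow> real) \<Rightarrow> 'm \<Rightarrow> 'm \<Rightarrow> real" where
  "riemannian_dist X A g x y =
     Inf {curve_length A g \<gamma> |\<gamma>. piecewise_C1_curve X A \<gamma> \<and> \<gamma> 0 = x \<and> \<gamma> 1 = y}"

section \<open>Codimension one foliations\<close>

text \<open>A foliation is represented by its tangent plane field: \<open>F c p\<close> is the set of the
  coordinate expressions, in the chart \<open>c\<close>, of the vectors at \<open>p\<close> tangent to \<open>F\<close>.\<close>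

type_synonym ('m, 'e) plane_field = "('m, 'e) chart \<Rightarrow> 'm \<Rightarrow> 'e set"

definition plane_field ::
  "('m, 'e::euclidean_space) chart set \<Rightarrow> ('m, 'e) plane_field \<Rightarrow> bool" where
  "plane_field A F \<longleftrightarrow>
     (\<forall>c\<in>A. \<forall>c'\<in>A. \<forall>p\<in>dom_of c \<inter> dom_of c'. \<forall>D. differential id c c' p D \<longrightarrow>
        F c' p = D ` F c p)"

text \<open>In a foliated chart the foliation is the one by the levels of the coordinate in the
  direction \<open>u\<close>.  At boundary points of a manifold modelled on the half space, \<open>u = (0, 1)\<close> is the
  model of a foliation tangent to the boundary and \<open>u = (b, 0)\<close> of a transverse one.\<close>

definition foliated_chart ::
  "('m, 'e::euclidean_space) chart set \<Rightarrow> ('m, 'e) plane_field \<Rightarrow> ('m, 'e) chart \<Rightarrow> 'e \<Rightarrow> bool" where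
  "foliated_chart A F c u \<longleftrightarrow>
     c \<in> A \<and> u \<in> Basis \<and> (\<forall>q\<in>dom_of c. F c q = {v. v \<bullet> u = 0})"

definition foliation ::
  "'m topology \<Rightarrow> ('m, 'e::euclidean_space) chart set \<Rightarrow> ('m, 'e) plane_field \<Rightarrow> bool" where
  "foliation X A F \<longleftrightarrow>
     plane_field A F \<and> (\<forall>p\<in>topspace X. \<exists>c u. p \<in> dom_of c \<and> foliated_chart A F c u)"

definition plaque ::
  "'m topology \<Rightarrow> ('m, 'e::euclidean_space) chart set \<Rightarrow> ('m, 'e) plane_field \<Rightarrow> 'm set \<Rightarrow> bool" where
  "plaque X A F P \<longleftrightarrow>
     (\<exists>c u k. foliated_chart A F c u \<and>
        P \<in> connected_components_of (subtopology X {q\<in>dom_of c. coord c q \<bullet> u = k}))"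

text \<open>Two points lie on the same leaf iff they are joined by a finite chain of plaques.\<close>

definition leaf ::
  "'m topology \<Rightarrow> ('m, 'e::euclidean_space) chart set \<Rightarrow> ('m, 'e) plane_field \<Rightarrow> 'm \<Rightarrow> 'm set" where
  "leaf X A F p = {q. (\<lambda>x y. \<exists>P. plaque X A F P \<and> x \<in> P \<and> y \<in> P)\<^sup>*\<^sup>* p q}"

definition leaves ::
  "'m topology \<Rightarrow> ('m, 'e::euclidean_space) chart set \<Rightarrow> ('m, 'e) plane_field \<Rightarrow> 'm set set" where
  "leaves X A F = leaf X A F ` topspace X"

definition transverse_to_boundary_at ::
  "('m, 'e::euclidean_space \<times> real) chart set \<Rightarrow> ('m, 'e \<times> real) plane_field \<Rightarrow> 'm \<Rightarrow> bool" where
  "transverse_to_boundary_at A F p \<longleftrightarrow>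
     (\<forall>c\<in>A. p \<in> dom_of c \<longrightarrow> {a + (v, 0) |a v. a \<in> F c p} = UNIV)"

text \<open>The plane field induced on a submanifold: the vectors that the differential of the
  inclusion sends to vectors tangent to \<open>F\<close>.\<close>

definition induced_plane_field ::
  "('m, 'e::euclidean_space) chart set \<Rightarrow> ('m, 'e) plane_field
     \<Rightarrow> ('m, 'a::euclidean_space) plane_field" where
  "induced_plane_field A F c p =
     {v. \<exists>c'\<in>A. \<exists>D. p \<in> dom_of c' \<and> differential id c c' p D \<and> D v \<in> F c' p}"

definition defined_by_form ::
  "('m, 'e::euclidean_space) chart set \<Rightarrow> ('m, 'e) plane_field
     \<Rightarrow> (('m, 'e) chart \<Rightarrow> 'm \<Rightarrow> 'e \<Rightarrow> real) \<Rightarrow> bool" where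
  "defined_by_form A F \<omega> \<longleftrightarrow> (\<forall>c\<in>A. \<forall>p\<in>dom_of c. F c p = {v. \<omega> c p v = 0})"

section \<open>Spinning along a boundary component\<close>

text \<open>A collar of \<open>S\<close> is an injection \<open>\<kappa>\<close> of \<open>S \<times> [0,1)\<close>; the product chart of \<open>S \<times> [0,1)\<close> over a
  chart of \<open>S\<close> becomes, via \<open>\<kappa>\<close>, the following chart of the ambient manifold.\<close>

definition collar_chart ::
  "('m \<times> real \<Rightarrow> 'm) \<Rightarrow> ('m, 'e::euclidean_space) chart \<Rightarrow> ('m, 'e \<times> real) chart" where
  "collar_chart \<kappa> c =
     (\<kappa> ` (dom_of c \<times> {0..<1}),
      map_prod (coord c) id \<circ> inv_into (dom_of c \<times> {0..<1}) \<kappa>)"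

text \<open>That all product charts belong to the maximal atlas \<open>A\<close> says that \<open>\<kappa>\<close> is a diffeomorphism
  from \<open>S \<times> [0,1)\<close> onto an open subset of the manifold.\<close>

definition foliated_collar ::
  "'m topology \<Rightarrow> ('m, 'e::euclidean_space \<times> real) chart set \<Rightarrow> ('m, 'e \<times> real) plane_field
     \<Rightarrow> 'm set \<Rightarrow> ('m \<times> real \<Rightarrow> 'm) \<Rightarrow> bool" where
  "foliated_collar X A F S \<kappa> \<longleftrightarrow>
     inj_on \<kappa> (S \<times> {0..<1}) \<and>
     (\<forall>x\<in>S. \<kappa> (x, 0) = x) \<and>
     (\<forall>c\<in>boundary_atlas X A S. collar_chart \<kappa> c \<in> A) \<and>
     (let N = \<kappa> ` (S \<times> {0..<1}) in
        leaves (subtopology X N) {c\<in>A. dom_of c \<subseteq> N} F =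
        {\<kappa> ` (L \<times> {0..<1}) |L.
           L \<in> leaves (subtopology X S) (boundary_atlas X A S) (induced_plane_field A F)})"

text \<open>\<open>h\<close> is smooth on \<open>[0,1)\<close> with one-sided derivatives at \<open>0\<close>; \<open>D k\<close> is its \<open>k\<close>-th derivative.\<close>

definition spin_function :: "(real \<Rightarrow> real) \<Rightarrow> bool" where
  "spin_function h \<longleftrightarrow>
     h ` {0..<1} \<subseteq> {0..1} \<and>
     h 0 = 1 \<and>
     (\<forall>t\<in>{1/2..<1}. h t = 0) \<and>
     (\<forall>s\<in>{0..1/2}. \<forall>t\<in>{0..1/2}. s < t \<longrightarrow> h t < h s) \<and>
     (\<exists>D::nat \<Rightarrow> real \<Rightarrow> real.
        (\<forall>t\<in>{0..<1}. D 0 t = h t) \<and>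
        (\<forall>k. \<forall>t\<in>{0..<1}. (D k has_real_derivative D (Suc k) t) (at t within {0..<1})) \<and>
        (\<forall>k\<ge>1. D k 0 = 0))"

text \<open>The extension of \<open>\<omega>\<close> to the collar and the form \<open>(1 - h(t)) \<omega> + h(t) dt\<close>, at the
  point \<open>(x, t)\<close> and in the product chart over \<open>c\<close>.\<close>

definition collar_form ::
  "(('m, 'e::euclidean_space) chart \<Rightarrow> 'm \<Rightarrow> 'e \<Rightarrow> real)
     \<Rightarrow> ('m, 'e) chart \<Rightarrow> 'm \<times> real \<Rightarrow> 'e \<times> real \<Rightarrow> real" where
  "collar_form \<omega> c = (\<lambda>(x, t) (v, \<tau>). \<omega> c x v)"

definition spin_form ::
  "(('m, 'e::euclidean_space) chart \<Rightarrow> 'm \<Rightarrow> 'e \<Rightarrow> real) \<Rightarrow> (real \<Rightarrow> real)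
     \<Rightarrow> ('m, 'e) chart \<Rightarrow> 'm \<times> real \<Rightarrow> 'e \<times> real \<Rightarrow> real" where
  "spin_form \<omega> h c = (\<lambda>(x, t) w. (1 - h t) * collar_form \<omega> c (x, t) w + h t * snd w)"

text \<open>\<open>F\<^sub>S\<close> is obtained from \<open>F\<close> by spinning along \<open>S\<close>, for some choice of the foliated collar
  and of the function \<open>h\<close>.\<close>

definition spinning ::
  "'m topology \<Rightarrow> ('m, 'e::euclidean_space \<times> real) chart set \<Rightarrow> ('m, 'e \<times> real) plane_field
     \<Rightarrow> 'm set \<Rightarrow> (('m, 'e) chart \<Rightarrow> 'm \<Rightarrow> 'e \<Rightarrow> real) \<Rightarrow> ('m, 'e \<times> real) plane_field \<Rightarrow> bool" where
  "spinning X A F S \<omega> F\<^sub>S \<longleftrightarrow>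
     foliation X A F\<^sub>S \<and>
     (\<exists>\<kappa> h. foliated_collar X A F S \<kappa> \<and> spin_function h \<and>
        (\<forall>c\<in>boundary_atlas X A S. \<forall>x\<in>dom_of c. \<forall>t\<in>{0..<1}.
           F\<^sub>S (collar_chart \<kappa> c) (\<kappa> (x, t)) = {w. spin_form \<omega> h c (x, t) w = 0}) \<and>
        (\<forall>c\<in>A. \<forall>p\<in>dom_of c - \<kappa> ` (S \<times> {0..<1}). F\<^sub>S c p = F c p))"

section \<open>Quotients of metric spaces\<close>

definition zero_dist_rel :: "'a set \<Rightarrow> ('a \<Rightarrow> 'a \<Rightarrow> real) \<Rightarrow> ('a \<times> 'a) set" where
  "zero_dist_rel Y \<delta> = {(x, y). x \<in> Y \<and> y \<in> Y \<and> \<delta> x y = 0}"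

text \<open>The metric induced by a pseudometric \<open>\<delta>\<close> on \<open>Y\<close> on the quotient \<open>Y // zero_dist_rel Y \<delta>\<close>,
  set to \<open>0\<close> outside this quotient, as \<^locale>\<open>Metric_space\<close> requires a distance function to be
  nonnegative and symmetric everywhere.\<close>

definition class_dist :: "'a set \<Rightarrow> ('a \<Rightarrow> 'a \<Rightarrow> real) \<Rightarrow> 'a set \<Rightarrow> 'a set \<Rightarrow> real" where
  "class_dist Y \<delta> a b =
     (if a \<in> Y // zero_dist_rel Y \<delta> \<and> b \<in> Y // zero_dist_rel Y \<delta>
      then \<delta> (SOME x. x \<in> a) (SOME y. y \<in> b) else 0)"

definition quotient_dist ::
  "'a set \<Rightarrow> ('a \<Rightarrow> 'a \<Rightarrow> real) \<Rightarrow> ('a \<times> 'a) set \<Rightarrow> 'a \<Rightarrow> 'a \<Rightarrow> real" where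
  "quotient_dist Y d R x y =
     Inf {\<Sum>i=1..k. d (p i) (q i) |(k::nat) p q.
            1 \<le> k \<and> (\<forall>i\<in>{1..k}. p i \<in> Y \<and> q i \<in> Y) \<and> p 1 = x \<and> q k = y \<and>
            (\<forall>i\<in>{1..<k}. (p (Suc i), q i) \<in> R)}"

definition collapse_rel :: "'a set \<Rightarrow> 'a set \<Rightarrow> ('a \<times> 'a) set" where
  "collapse_rel Y B = {(x, y). x \<in> Y \<and> y \<in> Y \<and> (x = y \<or> (x \<in> B \<and> y \<in> B))}"

definition isometric ::
  "'a set \<Rightarrow> ('a \<Rightarrow> 'a \<Rightarrow> real) \<Rightarrow> 'b set \<Rightarrow> ('b \<Rightarrow> 'b \<Rightarrow> real) \<Rightarrow> bool" where
  "isometric M d M' d' \<longleftrightarrow>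
     Metric_space M d \<and> Metric_space M' d' \<and>
     (\<exists>f. bij_betw f M M' \<and> (\<forall>x\<in>M. \<forall>y\<in>M. d' (f x) (f y) = d x y))"

section \<open>The Hausdorff leaf space\<close>

definition leaf_dist :: "('m \<Rightarrow> 'm \<Rightarrow> real) \<Rightarrow> 'm set \<Rightarrow> 'm set \<Rightarrow> real" where
  "leaf_dist d L L' = Inf {d x y |x y. x \<in> L \<and> y \<in> L'}"

definition leaf_rho ::
  "('m \<Rightarrow> 'm \<Rightarrow> real) \<Rightarrow> 'm set set \<Rightarrow> 'm set \<Rightarrow> 'm set \<Rightarrow> real" where
  "leaf_rho d \<L> L L' =
     Inf {\<Sum>i=1..<n. leaf_dist d (l i) (l (Suc i)) |(n::nat) l.
            1 \<le> n \<and> (\<forall>i\<in>{1..n}. l i \<in> \<L>) \<and> l 1 = L \<and> l n = L'}"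

definition HLS ::
  "'m topology \<Rightarrow> ('m, 'e::euclidean_space) chart set
     \<Rightarrow> (('m, 'e) chart \<Rightarrow> 'm \<Rightarrow> 'e \<Rightarrow> 'e \<Rightarrow> real) \<Rightarrow> ('m, 'e) plane_field \<Rightarrow> 'm set set set" where
  "HLS X A g F =
     leaves X A F // zero_dist_rel (leaves X A F) (leaf_rho (riemannian_dist X A g) (leaves X A F))"

definition HLS_dist ::
  "'m topology \<Rightarrow> ('m, 'e::euclidean_space) chart set
     \<Rightarrow> (('m, 'e) chart \<Rightarrow> 'm \<Rightarrow> 'e \<Rightarrow> 'e \<Rightarrow> real) \<Rightarrow> ('m, 'e) plane_field
     \<Rightarrow> 'm set set \<Rightarrow> 'm set set \<Rightarrow> real" where
  "HLS_dist X A g F =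
     class_dist (leaves X A F) (leaf_rho (riemannian_dist X A g) (leaves X A F))"

definition HLS_proj ::
  "'m topology \<Rightarrow> ('m, 'e::euclidean_space) chart set
     \<Rightarrow> (('m, 'e) chart \<Rightarrow> 'm \<Rightarrow> 'e \<Rightarrow> 'e \<Rightarrow> real) \<Rightarrow> ('m, 'e) plane_field \<Rightarrow> 'm \<Rightarrow> 'm set set" where
  "HLS_proj X A g F x =
     zero_dist_rel (leaves X A F) (leaf_rho (riemannian_dist X A g) (leaves X A F)) `` {leaf X A F x}"

text \<open>The metric space obtained from the metric space \<open>(Y, d)\<close> by identifying the points of
  \<open>B\<close> to a single point.\<close>

definition collapse :: "'a set \<Rightarrow> ('a \<Rightarrow> 'a \<Rightarrow> real) \<Rightarrow> 'a set \<Rightarrow> 'a set set" where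
  "collapse Y d B = Y // zero_dist_rel Y (quotient_dist Y d (collapse_rel Y B))"

definition collapse_dist ::
  "'a set \<Rightarrow> ('a \<Rightarrow> 'a \<Rightarrow> real) \<Rightarrow> 'a set \<Rightarrow> 'a set \<Rightarrow> 'a set \<Rightarrow> real" where
  "collapse_dist Y d B = class_dist Y (quotient_dist Y d (collapse_rel Y B))"

end

theory Submission
  imports Defs
begin

text \<open>Both spaces are metric quotients of the manifold \<open>M\<close> itself.  Pull their metrics back to
  pseudometrics on \<open>M\<close>:
  \<open>\<sigma>\<^sub>S x y\<close> is the distance of the \<open>F\<^sub>S\<close>-leaves through \<open>x\<close> and \<open>y\<close>, and \<open>\<sigma> x y\<close> is the distance of the
  images of \<open>x\<close> and \<open>y\<close> in the collapsed Hausdorff leaf space of \<open>F\<close>.  A metric defined as an infimum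
  over chains has a universal property: \<open>\<sigma>\<^sub>S\<close> is the largest pseudometric below the Riemannian distance
  that vanishes along the leaves of \<open>F\<^sub>S\<close>, and \<open>\<sigma>\<close> is the largest one that vanishes along the leaves of
  \<open>F\<close> and on \<open>S\<close> (\<open>le_leaf_rho\<close>, \<open>le_quotient_dist\<close>).  So \<open>\<sigma> = \<sigma>\<^sub>S\<close> as soon as \<open>\<sigma>\<close> vanishes along
  the leaves of \<open>F\<^sub>S\<close>, and \<open>\<sigma>\<^sub>S\<close> vanishes on \<open>S\<close> and along the leaves of \<open>F\<close>; equal pullbacks give
  isometric quotients (\<open>isometric_class_dist\<close>).

  Both pseudometrics vanish on the whole collar \<open>N\<close> of \<open>S\<close>.  For \<open>\<sigma>\<close> this holds because every leaf of
  \<open>F\<close> that meets the foliated collar meets \<open>S\<close> (\<open>collar_leaf_meets_S\<close>).  For \<open>\<sigma>\<^sub>S\<close> it holds because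
  \<open>S\<close> is contained in one leaf of \<open>F\<^sub>S\<close> and every other leaf that enters the collar spirals towards
  \<open>S\<close> (\<open>leaf_approaches_S\<close>).  The spiralling is seen locally: near a point at
  height \<open>t\<^sub>0 > 0\<close> the transverse coordinate of a foliated chart of \<open>F\<^sub>S\<close> has a nonzero derivative in some
  direction of \<open>S\<close>, as \<open>(1 - h(t\<^sub>0)) \<omega> \<noteq> 0\<close>; by the intermediate value theorem its levels reach below
  \<open>t\<^sub>0\<close> (\<open>leaf_descends_locally\<close>), uniformly so over the compact \<open>S\<close>.  Hence no positive height can be
  the infimum of the heights of a leaf.

  Off the collar the two foliations have the same tangent planes, and this transports vanishing
  from the leaves of one to the leaves of the other (\<open>pseudometric_zero_on_leaves\<close>).  Such a
  transport argument is made plaque by plaque: a short segment in a plaque of one foliation either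
  avoids \<open>N\<close>, and then lies in a single leaf of the other foliation, or both of its end points are
  joined to the closure of \<open>N\<close> by pieces with this property, and are at distance \<open>0\<close> from \<open>N\<close>.\<close>

section \<open>Pseudometrics and their metric quotients\<close>

definition pseudometric_on :: "'a set \<Rightarrow> ('a \<Rightarrow> 'a \<Rightarrow> real) \<Rightarrow> bool" where
  "pseudometric_on Y \<delta> \<longleftrightarrow>
     (\<forall>x\<in>Y. \<delta> x x = 0) \<and>
     (\<forall>x\<in>Y. \<forall>y\<in>Y. 0 \<le> \<delta> x y \<and> \<delta> x y = \<delta> y x) \<and>
     (\<forall>x\<in>Y. \<forall>y\<in>Y. \<forall>z\<in>Y. \<delta> x z \<le> \<delta> x y + \<delta> y z)"

lemma pseudometric_onD:
  assumes "pseudometric_on Y \<delta>"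
  shows "x \<in> Y \<Longrightarrow> \<delta> x x = 0"
    and "\<lbrakk>x \<in> Y; y \<in> Y\<rbrakk> \<Longrightarrow> 0 \<le> \<delta> x y"
    and "\<lbrakk>x \<in> Y; y \<in> Y\<rbrakk> \<Longrightarrow> \<delta> x y = \<delta> y x"
    and "\<lbrakk>x \<in> Y; y \<in> Y; z \<in> Y\<rbrakk> \<Longrightarrow> \<delta> x z \<le> \<delta> x y + \<delta> y z"
  using assms unfolding pseudometric_on_def by blast+

lemma pseudometric_on_zero_trans:
  assumes "pseudometric_on Y \<delta>" "x \<in> Y" "y \<in> Y" "z \<in> Y" "\<delta> x y = 0" "\<delta> y z = 0"
  shows "\<delta> x z = 0"
  using pseudometric_onD(2)[OF assms(1), of x z] pseudometric_onD(4)[OF assms(1), of x y z] assms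
  by auto

lemma equiv_zero_dist_rel:
  assumes "pseudometric_on Y \<delta>"
  shows "equiv Y (zero_dist_rel Y \<delta>)"
proof (rule equivI)
  show "zero_dist_rel Y \<delta> \<subseteq> Y \<times> Y"
    by (auto simp: zero_dist_rel_def)
  show "refl_on Y (zero_dist_rel Y \<delta>)"
    using pseudometric_onD(1)[OF assms] by (auto simp: refl_on_def zero_dist_rel_def)
  show "sym (zero_dist_rel Y \<delta>)"
    using pseudometric_onD(3)[OF assms] by (auto simp: sym_def zero_dist_rel_def)
  show "trans (zero_dist_rel Y \<delta>)"
    using pseudometric_on_zero_trans[OF assms] by (auto simp: trans_def zero_dist_rel_def)
qed

lemma class_dist_classes:
  assumes \<delta>: "pseudometric_on Y \<delta>" and x: "x \<in> Y" and y: "y \<in> Y"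
  shows "class_dist Y \<delta> (zero_dist_rel Y \<delta> `` {x}) (zero_dist_rel Y \<delta> `` {y}) = \<delta> x y"
proof -
  let ?R = "zero_dist_rel Y \<delta>"
  define x' y' where "x' = (SOME a. a \<in> ?R `` {x})" and "y' = (SOME b. b \<in> ?R `` {y})"
  have "x \<in> ?R `` {x}" "y \<in> ?R `` {y}"
    using x y pseudometric_onD(1)[OF \<delta>] by (auto simp: zero_dist_rel_def)
  then have "x' \<in> ?R `` {x}" "y' \<in> ?R `` {y}"
    unfolding x'_def y'_def by (metis someI)+
  then have *: "x' \<in> Y" "y' \<in> Y" "\<delta> x x' = 0" "\<delta> y y' = 0"
    by (auto simp: zero_dist_rel_def)
  have "\<delta> x' y' \<le> \<delta> x y"
    using pseudometric_onD(4)[OF \<delta>, of x' x y'] pseudometric_onD(4)[OF \<delta>, of x y y']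
      pseudometric_onD(3)[OF \<delta>, of x x'] * x y by auto
  moreover have "\<delta> x y \<le> \<delta> x' y'"
    using pseudometric_onD(4)[OF \<delta>, of x x' y] pseudometric_onD(4)[OF \<delta>, of x' y' y]
      pseudometric_onD(3)[OF \<delta>, of y y'] * x y by auto
  moreover have "?R `` {x} \<in> Y // ?R" "?R `` {y} \<in> Y // ?R"
    using x y by (auto simp: quotientI)
  ultimately show ?thesis
    unfolding class_dist_def x'_def y'_def by auto
qed

lemma Metric_space_class_dist:
  assumes \<delta>: "pseudometric_on Y \<delta>"
  shows "Metric_space (Y // zero_dist_rel Y \<delta>) (class_dist Y \<delta>)"
proof -
  let ?R = "zero_dist_rel Y \<delta>" and ?d = "class_dist Y \<delta>"
  have rep: "\<exists>x\<in>Y. a = ?R `` {x}" if "a \<in> Y // ?R" for a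
    using that by (auto elim: quotientE)
  have nn: "0 \<le> ?d a b \<and> ?d a b = ?d b a" for a b
  proof (cases "a \<in> Y // ?R \<and> b \<in> Y // ?R")
    case True
    then show ?thesis
      using rep[of a] rep[of b] pseudometric_onD(2,3)[OF \<delta>] class_dist_classes[OF \<delta>] by auto
  qed (auto simp: class_dist_def)
  show ?thesis
  proof
    fix a b c
    show "0 \<le> ?d a b" "?d a b = ?d b a"
      using nn by auto
    assume a: "a \<in> Y // ?R" and b: "b \<in> Y // ?R"
    then obtain x y where xy: "x \<in> Y" "y \<in> Y" "a = ?R `` {x}" "b = ?R `` {y}"
      using rep by metis
    have "?R `` {x} = ?R `` {y} \<longleftrightarrow> (x, y) \<in> ?R"
      using xy eq_equiv_class_iff[OF equiv_zero_dist_rel[OF \<delta>], of x y] by auto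
    then show "?d a b = 0 \<longleftrightarrow> a = b"
      using xy class_dist_classes[OF \<delta>] by (auto simp: zero_dist_rel_def)
    assume "c \<in> Y // ?R"
    then obtain z where "z \<in> Y" "c = ?R `` {z}"
      using rep by metis
    then show "?d a c \<le> ?d a b + ?d b c"
      using xy class_dist_classes[OF \<delta>] pseudometric_onD(4)[OF \<delta>] by auto
  qed
qed

text \<open>Maps of \<open>P\<close> onto two pseudometric spaces that pull the pseudometrics back to the same function on
  \<open>P\<close> identify the metric quotients.  In this form the two quotients never have to be compared
  directly.\<close>

lemma isometric_class_dist:
  assumes \<delta>: "pseudometric_on Y \<delta>" and \<delta>': "pseudometric_on Y' \<delta>'"
    and a: "a ` P = Y" and b: "b ` P = Y'"
    and eq: "\<And>x y. \<lbrakk>x \<in> P; y \<in> P\<rbrakk> \<Longrightarrow> \<delta>' (b x) (b y) = \<delta> (a x) (a y)"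
  shows "isometric (Y // zero_dist_rel Y \<delta>) (class_dist Y \<delta>)
           (Y' // zero_dist_rel Y' \<delta>') (class_dist Y' \<delta>')"
proof -
  define A where "A x = zero_dist_rel Y \<delta> `` {a x}" for x
  define B where "B x = zero_dist_rel Y' \<delta>' `` {b x}" for x
  have A: "A ` P = Y // zero_dist_rel Y \<delta>"
    using a unfolding A_def quotient_def by auto
  have B: "B ` P = Y' // zero_dist_rel Y' \<delta>'"
    using b unfolding B_def quotient_def by auto
  have dA: "class_dist Y \<delta> (A x) (A y) = \<delta> (a x) (a y)" if "x \<in> P" "y \<in> P" for x y
    unfolding A_def using that a by (intro class_dist_classes[OF \<delta>]) auto
  have dB: "class_dist Y' \<delta>' (B x) (B y) = \<delta>' (b x) (b y)" if "x \<in> P" "y \<in> P" for x y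
    unfolding B_def using that b by (intro class_dist_classes[OF \<delta>']) auto
  interpret MA: Metric_space "Y // zero_dist_rel Y \<delta>" "class_dist Y \<delta>"
    by (rule Metric_space_class_dist[OF \<delta>])
  interpret MB: Metric_space "Y' // zero_dist_rel Y' \<delta>'" "class_dist Y' \<delta>'"
    by (rule Metric_space_class_dist[OF \<delta>'])
  have AB: "A x = A y \<longleftrightarrow> B x = B y" if xy: "x \<in> P" "y \<in> P" for x y
  proof -
    have "A x = A y \<longleftrightarrow> \<delta> (a x) (a y) = 0"
      using MA.zero[of "A x" "A y"] dA[OF xy] A xy by auto
    moreover have "B x = B y \<longleftrightarrow> \<delta>' (b x) (b y) = 0"
      using MB.zero[of "B x" "B y"] dB[OF xy] B xy by auto
    ultimately show ?thesis
      using eq[OF xy] by simp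
  qed
  define f where "f \<alpha> = B (inv_into P A \<alpha>)" for \<alpha>
  have f: "f (A x) = B x" if x: "x \<in> P" for x
    unfolding f_def using AB[of "inv_into P A (A x)" x] x
    by (simp add: f_inv_into_f inv_into_into)
  have "inj_on f (A ` P)"
    using f AB by (auto simp: inj_on_def)
  moreover have "f ` (A ` P) = B ` P"
    using f by (auto simp: image_image)
  moreover have "\<forall>\<alpha>\<in>A ` P. \<forall>\<beta>\<in>A ` P. class_dist Y' \<delta>' (f \<alpha>) (f \<beta>) = class_dist Y \<delta> \<alpha> \<beta>"
    using f dA dB eq by auto
  ultimately show ?thesis
    unfolding isometric_def bij_betw_def A[symmetric] B[symmetric]
    using MA.Metric_space_axioms MB.Metric_space_axioms unfolding A B by blast
qed

section \<open>Metrics defined by chains\<close>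

definition chain_costs ::
  "'a set \<Rightarrow> ('a \<Rightarrow> 'a \<Rightarrow> real) \<Rightarrow> ('a \<times> 'a) set \<Rightarrow> 'a \<Rightarrow> 'a \<Rightarrow> real set" where
  "chain_costs Y d R x y = {\<Sum>i=1..k. d (p i) (q i) |(k::nat) p q.
            1 \<le> k \<and> (\<forall>i\<in>{1..k}. p i \<in> Y \<and> q i \<in> Y) \<and> p 1 = x \<and> q k = y \<and>
            (\<forall>i\<in>{1..<k}. (p (Suc i), q i) \<in> R)}"

lemma quotient_dist_eq_Inf: "quotient_dist Y d R x y = Inf (chain_costs Y d R x y)"
  unfolding quotient_dist_def chain_costs_def ..

lemma chain_costsI:
  assumes "r = (\<Sum>i=1..k. d (p i) (q i))" "1 \<le> k" "\<And>i. i \<in> {1..k} \<Longrightarrow> p i \<in> Y"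
    "\<And>i. i \<in> {1..k} \<Longrightarrow> q i \<in> Y" "p 1 = x" "q k = y"
    "\<And>i. i \<in> {1..<k} \<Longrightarrow> (p (Suc i), q i) \<in> R"
  shows "r \<in> chain_costs Y d R x y"
  unfolding chain_costs_def using assms by blast

lemma chain_costsE:
  assumes "r \<in> chain_costs Y d R x y"
  obtains k p q where "r = (\<Sum>i=1..k. d (p i) (q i))" "1 \<le> k"
    "\<And>i. i \<in> {1..k} \<Longrightarrow> p i \<in> Y \<and> q i \<in> Y" "p 1 = x" "q k = y"
    "\<And>i. i \<in> {1..<k} \<Longrightarrow> (p (Suc i), q i) \<in> R"
  using assms unfolding chain_costs_def by blast

lemma chain_costs_nonneg:
  assumes "\<And>x y. \<lbrakk>x \<in> Y; y \<in> Y\<rbrakk> \<Longrightarrow> 0 \<le> d x y" and "r \<in> chain_costs Y d R x y"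
  shows "0 \<le> r"
  using assms(2)
proof (rule chain_costsE)
  fix k p q
  assume r: "r = (\<Sum>i=1..k. d (p i) (q i))" and mem: "\<And>i. i \<in> {1..k} \<Longrightarrow> p i \<in> Y \<and> q i \<in> Y"
  show "0 \<le> r"
    unfolding r by (rule sum_nonneg, rule assms(1)) (use mem in blast)+
qed

lemma quotient_dist_lower:
  assumes "\<And>x y. \<lbrakk>x \<in> Y; y \<in> Y\<rbrakk> \<Longrightarrow> 0 \<le> d x y" and "r \<in> chain_costs Y d R x y"
  shows "quotient_dist Y d R x y \<le> r"
  unfolding quotient_dist_eq_Inf
proof (rule cInf_lower[OF assms(2)])
  show "bdd_below (chain_costs Y d R x y)"
    using chain_costs_nonneg[where Y = Y and d = d] assms(1) by (intro bdd_belowI[of _ 0]) metis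
qed

lemma chain_costs_single:
  "\<lbrakk>x \<in> Y; y \<in> Y\<rbrakk> \<Longrightarrow> d x y \<in> chain_costs Y d R x y"
  by (rule chain_costsI[where k = 1 and p = "\<lambda>i. x" and q = "\<lambda>i. y"]) auto

lemma quotient_dist_le:
  assumes "\<And>x y. \<lbrakk>x \<in> Y; y \<in> Y\<rbrakk> \<Longrightarrow> 0 \<le> d x y" and "x \<in> Y" "y \<in> Y"
  shows "quotient_dist Y d R x y \<le> d x y"
  using assms(1) chain_costs_single[OF assms(2,3)] by (rule quotient_dist_lower)

lemma quotient_dist_nonneg:
  assumes "\<And>x y. \<lbrakk>x \<in> Y; y \<in> Y\<rbrakk> \<Longrightarrow> 0 \<le> d x y" and "x \<in> Y" "y \<in> Y"
  shows "0 \<le> quotient_dist Y d R x y"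
  unfolding quotient_dist_eq_Inf
proof (rule cInf_greatest)
  show "chain_costs Y d R x y \<noteq> {}"
    using chain_costs_single[OF assms(2,3), of d R] by blast
  fix r assume "r \<in> chain_costs Y d R x y"
  with assms(1) show "0 \<le> r"
    by (rule chain_costs_nonneg)
qed

lemma chain_costs_append:
  assumes r: "r \<in> chain_costs Y d R x y" and s: "s \<in> chain_costs Y d R y' z" and R: "(y', y) \<in> R"
  shows "r + s \<in> chain_costs Y d R x z"
proof -
  obtain k p q where chain1: "r = (\<Sum>i=1..k. d (p i) (q i))" "1 \<le> k"
    "\<And>i. i \<in> {1..k} \<Longrightarrow> p i \<in> Y \<and> q i \<in> Y" "p 1 = x" "q k = y"
    "\<And>i. i \<in> {1..<k} \<Longrightarrow> (p (Suc i), q i) \<in> R"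
    using r by (elim chain_costsE) blast
  obtain l p' q' where chain2: "s = (\<Sum>i=1..l. d (p' i) (q' i))" "1 \<le> l"
    "\<And>i. i \<in> {1..l} \<Longrightarrow> p' i \<in> Y \<and> q' i \<in> Y" "p' 1 = y'" "q' l = z"
    "\<And>i. i \<in> {1..<l} \<Longrightarrow> (p' (Suc i), q' i) \<in> R"
    using s by (elim chain_costsE) blast
  define P where "P i = (if i \<le> k then p i else p' (i - k))" for i
  define Q where "Q i = (if i \<le> k then q i else q' (i - k))" for i
  have "(\<Sum>i=1..k+l. d (P i) (Q i)) = (\<Sum>i=1..k. d (P i) (Q i)) + (\<Sum>i=k+1..k+l. d (P i) (Q i))"
    using sum.ub_add_nat[of 1 k "\<lambda>i. d (P i) (Q i)" l] by simp
  also have "(\<Sum>i=k+1..k+l. d (P i) (Q i)) = (\<Sum>i=1..l. d (P (i + k)) (Q (i + k)))"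
    using sum.shift_bounds_cl_nat_ivl[of "\<lambda>i. d (P i) (Q i)" 1 k l] by (simp add: add.commute)
  finally have "r + s = (\<Sum>i=1..k+l. d (P i) (Q i))"
    unfolding chain1(1) chain2(1) P_def Q_def by simp
  moreover have "P i \<in> Y" "Q i \<in> Y" if "i \<in> {1..k + l}" for i
    using that chain1(3)[of i] chain2(3)[of "i - k"]
    by (cases "i \<le> k"; force simp: P_def Q_def)+
  moreover have "P 1 = x" "Q (k + l) = z"
    using chain1 chain2 by (auto simp: P_def Q_def)
  moreover have "(P (Suc i), Q i) \<in> R" if i: "i \<in> {1..<k + l}" for i
  proof -
    consider "i < k" | "i = k" | "i > k" by linarith
    then show ?thesis
    proof cases
      case 1
      then show ?thesis
        using i chain1(6)[of i] by (auto simp: P_def Q_def)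
    next
      case 2
      then show ?thesis
        using chain1(5) chain2(4) R by (auto simp: P_def Q_def)
    next
      case 3
      with i have "i - k \<in> {1..<l}"
        by auto
      then have "(p' (Suc (i - k)), q' (i - k)) \<in> R"
        by (rule chain2(6))
      then show ?thesis
        using 3 by (auto simp: P_def Q_def Suc_diff_le)
    qed
  qed
  ultimately show ?thesis
    using chain1(2) by (intro chain_costsI[where k = "k + l" and p = P and q = Q]) auto
qed

lemma chain_costs_reverse:
  assumes r: "r \<in> chain_costs Y d R x y"
    and sym: "\<And>x y. \<lbrakk>x \<in> Y; y \<in> Y\<rbrakk> \<Longrightarrow> d x y = d y x" and R: "sym R"
  shows "r \<in> chain_costs Y d R y x"
proof -
  obtain k p q where 1: "r = (\<Sum>i=1..k. d (p i) (q i))" "1 \<le> k"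
    "\<And>i. i \<in> {1..k} \<Longrightarrow> p i \<in> Y \<and> q i \<in> Y" "p 1 = x" "q k = y"
    "\<And>i. i \<in> {1..<k} \<Longrightarrow> (p (Suc i), q i) \<in> R"
    using r by (elim chain_costsE) blast
  have "r = (\<Sum>i=1..k. d (q (k + 1 - i)) (p (k + 1 - i)))"
    unfolding 1(1) using 1(3)
    by (subst sum.atLeastAtMost_rev) (auto intro!: sum.cong sym)
  moreover have "(q (k + 1 - Suc i), p (k + 1 - i)) \<in> R" if i: "i \<in> {1..<k}" for i
  proof -
    have "(p (Suc (k - i)), q (k - i)) \<in> R"
      using i 1(6) by auto
    then show ?thesis
      using i symD[OF R] by (auto simp: Suc_diff_le)
  qed
  moreover have "p (k + 1 - i) \<in> Y" "q (k + 1 - i) \<in> Y" if "i \<in> {1..k}" for i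
  proof -
    have "k + 1 - i \<in> {1..k}"
      using that by auto
    then show "p (k + 1 - i) \<in> Y" "q (k + 1 - i) \<in> Y"
      using 1(3) by blast+
  qed
  ultimately show ?thesis
    using 1 by (intro chain_costsI[where k = k and p = "\<lambda>i. q (k + 1 - i)" and q = "\<lambda>i. p (k + 1 - i)"]) auto
qed

lemma quotient_dist_zero:
  assumes "\<And>x y. \<lbrakk>x \<in> Y; y \<in> Y\<rbrakk> \<Longrightarrow> 0 \<le> d x y" and "\<And>x. x \<in> Y \<Longrightarrow> d x x = 0"
    and "sym R" and "x \<in> Y" "y \<in> Y" "(x, y) \<in> R"
  shows "quotient_dist Y d R x y = 0"
proof -
  have "d x x + d y y \<in> chain_costs Y d R x y"
  proof (rule chain_costs_append)
    show "d x x \<in> chain_costs Y d R x x" "d y y \<in> chain_costs Y d R y y"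
      using assms(4,5) by (auto intro: chain_costs_single)
    show "(y, x) \<in> R"
      using assms(3,6) by (rule symD)
  qed
  with assms(1) have "quotient_dist Y d R x y \<le> d x x + d y y"
    by (rule quotient_dist_lower)
  moreover have "0 \<le> quotient_dist Y d R x y"
    using assms(1,4,5) by (rule quotient_dist_nonneg)
  ultimately show ?thesis
    using assms(2,4,5) by auto
qed

lemma pseudometric_on_quotient_dist:
  assumes nn: "\<And>x y. \<lbrakk>x \<in> Y; y \<in> Y\<rbrakk> \<Longrightarrow> 0 \<le> d x y" and zero: "\<And>x. x \<in> Y \<Longrightarrow> d x x = 0"
    and sym: "\<And>x y. \<lbrakk>x \<in> Y; y \<in> Y\<rbrakk> \<Longrightarrow> d x y = d y x"
    and R: "sym R" "refl_on Y R"
  shows "pseudometric_on Y (quotient_dist Y d R)"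
  unfolding pseudometric_on_def
proof (intro conjI ballI)
  fix x assume "x \<in> Y"
  then show "quotient_dist Y d R x x = 0"
    by (intro quotient_dist_zero nn zero R) (use R in \<open>auto simp: refl_on_def\<close>)
next
  fix x y assume xy: "x \<in> Y" "y \<in> Y"
  show "0 \<le> quotient_dist Y d R x y"
    using quotient_dist_nonneg[OF nn xy] .
  have "chain_costs Y d R x y = chain_costs Y d R y x"
    by (intro Set.set_eqI iffI; erule chain_costs_reverse) (simp_all add: sym R)
  then show "quotient_dist Y d R x y = quotient_dist Y d R y x"
    unfolding quotient_dist_eq_Inf by simp
next
  fix x y z assume xyz: "x \<in> Y" "y \<in> Y" "z \<in> Y"
  let ?q = "quotient_dist Y d R"
  have "?q x z - s \<le> ?q x y" if s: "s \<in> chain_costs Y d R y z" for s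
    unfolding quotient_dist_eq_Inf[of _ _ _ x y]
  proof (rule cInf_greatest)
    show "chain_costs Y d R x y \<noteq> {}"
      using chain_costs_single[OF xyz(1,2), of d R] by blast
    fix r assume "r \<in> chain_costs Y d R x y"
    moreover have "(y, y) \<in> R"
      using R(2) xyz by (auto simp: refl_on_def)
    ultimately have "r + s \<in> chain_costs Y d R x z"
      using s by (intro chain_costs_append)
    with nn have "?q x z \<le> r + s"
      by (rule quotient_dist_lower)
    then show "?q x z - s \<le> r"
      by simp
  qed
  note * = this
  have "?q x z - ?q x y \<le> ?q y z"
    unfolding quotient_dist_eq_Inf[of _ _ _ y z]
  proof (rule cInf_greatest)
    show "chain_costs Y d R y z \<noteq> {}"
      using chain_costs_single[OF xyz(2,3), of d R] by blast
    fix s assume "s \<in> chain_costs Y d R y z"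
    then show "?q x z - ?q x y \<le> s"
      using *[of s] by linarith
  qed
  then show "?q x z \<le> ?q x y + ?q y z"
    by simp
qed

text \<open>Universal property of the quotient pseudometric: along a chain, \<open>\<sigma>\<close> is at most \<open>d\<close> on each
  pair \<open>(p\<^sub>i, q\<^sub>i)\<close>, and the jumps from \<open>q\<^sub>i\<close> to the next \<open>p\<close> are free for \<open>\<sigma>\<close> too.\<close>

lemma le_quotient_dist:
  assumes \<sigma>: "pseudometric_on Y \<sigma>"
    and le: "\<And>x y. \<lbrakk>x \<in> Y; y \<in> Y\<rbrakk> \<Longrightarrow> \<sigma> x y \<le> d x y"
    and R: "\<And>x y. \<lbrakk>x \<in> Y; y \<in> Y; (x, y) \<in> R\<rbrakk> \<Longrightarrow> \<sigma> x y = 0"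
    and xy: "x \<in> Y" "y \<in> Y"
  shows "\<sigma> x y \<le> quotient_dist Y d R x y"
  unfolding quotient_dist_eq_Inf
proof (rule cInf_greatest)
  show "chain_costs Y d R x y \<noteq> {}"
    using chain_costs_single[OF xy, of d R] by blast
  fix r assume "r \<in> chain_costs Y d R x y"
  then obtain k p q where 1: "r = (\<Sum>i=1..k. d (p i) (q i))" "1 \<le> k"
    "\<And>i. i \<in> {1..k} \<Longrightarrow> p i \<in> Y \<and> q i \<in> Y" "p 1 = x" "q k = y"
    "\<And>i. i \<in> {1..<k} \<Longrightarrow> (p (Suc i), q i) \<in> R"
    by (elim chain_costsE) blast
  have "\<sigma> x (q j) \<le> (\<Sum>i=1..j. d (p i) (q i))" if "1 \<le> j" "j \<le> k" for j
    using that
  proof (induction j rule: dec_induct)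
    case base
    then show ?case
      using le[of x "q 1"] 1 by auto
  next
    case (step j)
    have mem: "q j \<in> Y" "p (Suc j) \<in> Y" "q (Suc j) \<in> Y" and "(p (Suc j), q j) \<in> R"
      using 1 step by auto
    then have "\<sigma> (q j) (p (Suc j)) = 0"
      using R[of "p (Suc j)" "q j"] pseudometric_onD(3)[OF \<sigma>, of "q j" "p (Suc j)"] by simp
    then have "\<sigma> x (q (Suc j)) \<le> \<sigma> x (q j) + \<sigma> (p (Suc j)) (q (Suc j))"
      using pseudometric_onD(4)[OF \<sigma>, of x "q j" "q (Suc j)"]
        pseudometric_onD(4)[OF \<sigma>, of "q j" "p (Suc j)" "q (Suc j)"] mem xy by simp
    then show ?case
      using step le[OF mem(2,3)] by simp
  qed
  then show "\<sigma> x y \<le> r"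
    using 1 by auto
qed

text \<open>Chains of leaves are chains of pairs whose jumps are trivial.  The one discrepancy is the chain
  consisting of a single leaf: it has no pair at all, and corresponds to the pair \<open>(L, L)\<close>, which
  costs nothing by assumption.\<close>

lemma leaf_rho_eq_quotient_dist:
  assumes zero: "\<And>L. L \<in> \<L> \<Longrightarrow> leaf_dist d L L = 0" and "L \<in> \<L>" "L' \<in> \<L>"
  shows "leaf_rho d \<L> L L' = quotient_dist \<L> (leaf_dist d) (Id_on \<L>) L L'"
proof -
  have "{\<Sum>i=1..<n. leaf_dist d (l i) (l (Suc i)) |(n::nat) l.
            1 \<le> n \<and> (\<forall>i\<in>{1..n}. l i \<in> \<L>) \<and> l 1 = L \<and> l n = L'} =
        chain_costs \<L> (leaf_dist d) (Id_on \<L>) L L'" (is "?A = ?B")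
  proof (intro subset_antisym subsetI)
    fix r assume "r \<in> ?A"
    then obtain n l where 1: "r = (\<Sum>i=1..<n. leaf_dist d (l i) (l (Suc i)))" "1 \<le> n"
      "\<forall>i\<in>{1..n}. l i \<in> \<L>" "l 1 = L" "l n = L'"
      by blast
    show "r \<in> ?B"
    proof (cases "n = 1")
      case True
      then show ?thesis
        using 1 zero[of L] chain_costs_single[of L \<L> L "leaf_dist d" "Id_on \<L>"] assms by auto
    next
      case False
      then obtain k where k: "n = Suc k" "1 \<le> k"
        using 1(2) by (metis One_nat_def Suc_le_mono not0_implies_Suc not_one_le_zero less_one linorder_not_less)
      then have "r = (\<Sum>i=1..k. leaf_dist d (l i) (l (Suc i)))"
        using 1 by (simp add: atLeastLessThanSuc_atLeastAtMost)
      then show ?thesis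
        using 1 k by (intro chain_costsI[where k = k and p = l and q = "\<lambda>i. l (Suc i)"]) auto
    qed
  next
    fix r assume "r \<in> ?B"
    then obtain k p q where 1: "r = (\<Sum>i=1..k. leaf_dist d (p i) (q i))" "1 \<le> k"
      "\<And>i. i \<in> {1..k} \<Longrightarrow> p i \<in> \<L> \<and> q i \<in> \<L>" "p 1 = L" "q k = L'"
      "\<And>i. i \<in> {1..<k} \<Longrightarrow> (p (Suc i), q i) \<in> Id_on \<L>"
      by (elim chain_costsE) blast
    define l where "l i = (if i \<le> k then p i else q k)" for i
    have "l (Suc i) = q i" if "i \<in> {1..k}" for i
      using that 1(6)[of i] by (cases "i = k") (auto simp: l_def)
    then have "r = (\<Sum>i=1..<Suc k. leaf_dist d (l i) (l (Suc i)))"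
      unfolding 1(1) atLeastLessThanSuc_atLeastAtMost by (auto intro!: sum.cong simp: l_def)
    then show "r \<in> ?A"
      using 1 by (intro CollectI exI[of _ "Suc k"] exI[of _ l]) (auto simp: l_def)
  qed
  then show ?thesis
    unfolding leaf_rho_def quotient_dist_eq_Inf by simp
qed

section \<open>Charts and changes of coordinates\<close>

lemma is_chart_inj: "is_chart X H c \<Longrightarrow> inj_on (coord c) (dom_of c)"
  unfolding is_chart_def homeomorphic_eq_everything_map by (metis openin_subset topspace_subtopology_subset)

lemma is_chart_dom: "is_chart X H c \<Longrightarrow> openin X (dom_of c)"
  by (simp add: is_chart_def)

lemma is_chart_image_subset: "is_chart X H c \<Longrightarrow> coord c ` dom_of c \<subseteq> H"
  unfolding is_chart_def by (metis openin_imp_subset)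

lemma param_coord: "\<lbrakk>is_chart X H c; p \<in> dom_of c\<rbrakk> \<Longrightarrow> param c (coord c p) = p"
  by (simp add: is_chart_inj)

lemma coord_param: "z \<in> coord c ` dom_of c \<Longrightarrow> coord c (param c z) = z"
  by (rule f_inv_into_f)

lemma param_in_dom: "z \<in> coord c ` dom_of c \<Longrightarrow> param c z \<in> dom_of c"
  by (rule inv_into_into)

lemma is_chart_open_image:
  assumes c: "is_chart X H c" and V: "openin X V"
  shows "openin (top_of_set H) (coord c ` (dom_of c \<inter> V))"
proof -
  have "open_map (subtopology X (dom_of c)) (top_of_set (coord c ` dom_of c)) (coord c)"
    using c homeomorphic_imp_open_map unfolding is_chart_def by blast
  moreover have "openin (subtopology X (dom_of c)) (dom_of c \<inter> V)"
    using V openin_subtopology_Int2 by blast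
  ultimately have "openin (top_of_set (coord c ` dom_of c)) (coord c ` (dom_of c \<inter> V))"
    unfolding open_map_def by blast
  then show ?thesis
    using c openin_trans unfolding is_chart_def by blast
qed

lemma is_chart_open_preimage:
  assumes c: "is_chart X H c" and W: "open W"
  shows "openin X {p \<in> dom_of c. coord c p \<in> W}"
proof -
  have "continuous_map (subtopology X (dom_of c)) (top_of_set (coord c ` dom_of c)) (coord c)"
    using c homeomorphic_imp_continuous_map unfolding is_chart_def by blast
  then have "openin (subtopology X (dom_of c))
      {p \<in> topspace (subtopology X (dom_of c)). coord c p \<in> coord c ` dom_of c \<inter> W}"
    by (rule openin_continuous_map_preimage) (use W in auto)
  moreover have "{p \<in> topspace (subtopology X (dom_of c)). coord c p \<in> coord c ` dom_of c \<inter> W} =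
      {p \<in> dom_of c. coord c p \<in> W}"
    using openin_subset[OF is_chart_dom[OF c]] by auto
  ultimately show ?thesis
    using openin_trans_full[OF _ is_chart_dom[OF c]] by simp
qed

lemma continuous_map_param:
  assumes c: "is_chart X H c" and f: "continuous_on T f" and fT: "f ` T \<subseteq> coord c ` dom_of c"
  shows "continuous_map (top_of_set T) X (\<lambda>t. param c (f t))"
  unfolding continuous_map_def
proof (intro conjI allI impI)
  show "(\<lambda>t. param c (f t)) \<in> topspace (top_of_set T) \<rightarrow> topspace X"
    using fT param_in_dom[of _ c] openin_subset[OF is_chart_dom[OF c]] by fastforce
  fix V assume V: "openin X V"
  obtain O' where O': "open O'" "coord c ` (dom_of c \<inter> V) = H \<inter> O'"
    using is_chart_open_image[OF c V] by (auto simp: openin_open)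
  have "param c (f t) \<in> V \<longleftrightarrow> f t \<in> O'" if t: "t \<in> T" for t
  proof -
    have "f t \<in> coord c ` dom_of c" "f t \<in> H"
      using t fT is_chart_image_subset[OF c] by auto
    then obtain q where q: "q \<in> dom_of c" "f t = coord c q"
      by blast
    have "param c (f t) \<in> V \<longleftrightarrow> f t \<in> coord c ` (dom_of c \<inter> V)"
      using q param_coord[OF c q(1)] inj_on_image_mem_iff[OF is_chart_inj[OF c] q(1), of "dom_of c \<inter> V"]
      by auto
    then show ?thesis
      using O'(2) \<open>f t \<in> H\<close> by auto
  qed
  then have "{t \<in> topspace (top_of_set T). param c (f t) \<in> V} = T \<inter> f -` O'"
    by auto
  then show "openin (top_of_set T) {t \<in> topspace (top_of_set T). param c (f t) \<in> V}"
    using continuous_openin_preimage_gen[OF f O'(1)] by simp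
qed

lemma is_chart_ball:
  assumes c: "is_chart X H c" and p: "p \<in> dom_of c" and V: "openin X V" "p \<in> V"
  obtains r where "r > 0" "ball (coord c p) r \<inter> H \<subseteq> coord c ` (dom_of c \<inter> V)"
proof -
  obtain O' where O': "open O'" "coord c ` (dom_of c \<inter> V) = H \<inter> O'"
    using is_chart_open_image[OF c V(1)] by (auto simp: openin_open)
  moreover have "coord c p \<in> O'"
    using O'(2) p V(2) by blast
  ultimately show ?thesis
    using that openE by (metis Int_commute Int_mono order_refl)
qed

lemma smooth_manifold_chart: "\<lbrakk>smooth_manifold X H A; c \<in> A\<rbrakk> \<Longrightarrow> is_chart X H c"
  by (simp add: smooth_manifold_def)

lemma smooth_manifold_cover:
  assumes "smooth_manifold X H A" "p \<in> topspace X"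
  obtains c where "c \<in> A" "p \<in> dom_of c"
  using assms unfolding smooth_manifold_def by blast

text \<open>The derivatives come from a smooth extension near \<open>p\<close>, hence depend continuously on the point
  also at the boundary.\<close>

lemma transition_C1:
  assumes M: "smooth_manifold X H A" and c: "c \<in> A" and c': "c' \<in> A"
    and p: "p \<in> dom_of c" "p \<in> dom_of c'"
  obtains U f' where "open U" "coord c p \<in> U"
    and "\<And>z. z \<in> U \<inter> coord c ` dom_of c \<Longrightarrow>
           param c z \<in> dom_of c' \<and> differential id c c' (param c z) (f' z)"
    and "\<And>v. continuous_on U (\<lambda>z. f' z v)"
proof -
  note ch = smooth_manifold_chart[OF M c] and ch' = smooth_manifold_chart[OF M c']
  let ?B = "coord c ` (dom_of c \<inter> dom_of c')"
  obtain O' where O': "open O'" "?B = H \<inter> O'"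
    using is_chart_open_image[OF ch is_chart_dom[OF ch']] by (auto simp: openin_open)
  have B: "coord c p \<in> ?B"
    using p by blast
  have "smooth_on ?B (coord c' \<circ> param c)"
    using M c c' unfolding smooth_manifold_def compatible_def by blast
  then obtain U h where U: "open U" "coord c p \<in> U" "\<forall>k. C_k k h U"
    "\<forall>y\<in>U \<inter> ?B. h y = (coord c' \<circ> param c) y"
    using B unfolding smooth_on_def by blast
  from U(3) have "C_k (Suc 0) h U"
    by blast
  then obtain f' where f': "\<forall>x\<in>U. (h has_derivative f' x) (at x)"
    "\<forall>v. continuous_on U (\<lambda>x. f' x v)"
    by auto
  show thesis
  proof (rule that[of "U \<inter> O'" f'])
    show "open (U \<inter> O')" "coord c p \<in> U \<inter> O'"
      using U O' B by auto
    show "continuous_on (U \<inter> O') (\<lambda>z. f' z v)" for v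
      using f'(2) continuous_on_subset by blast
    fix z assume z: "z \<in> (U \<inter> O') \<inter> coord c ` dom_of c"
    have sub: "(U \<inter> O') \<inter> coord c ` dom_of c \<subseteq> U \<inter> ?B"
      using is_chart_image_subset[OF ch] O'(2) by blast
    then have "z \<in> ?B"
      using z by blast
    then have "param c z \<in> dom_of c'"
      using param_coord[OF ch] by auto
    moreover have "(h has_derivative f' z) (at z within coord c ` dom_of c)"
      using f'(1) z has_derivative_at_withinI by blast
    then have "((coord c' \<circ> id \<circ> param c) has_derivative f' z) (at z within coord c ` dom_of c)"
    proof (rule has_derivative_transform_eventually)
      have "\<forall>x\<in>(U \<inter> O') \<inter> coord c ` dom_of c. h x = (coord c' \<circ> id \<circ> param c) x"
        using U(4) sub by auto
      then show "\<forall>\<^sub>F x in at z within coord c ` dom_of c. h x = (coord c' \<circ> id \<circ> param c) x"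
        unfolding eventually_at_topological
        by (intro exI[of _ "U \<inter> O'"]) (use U(1) O'(1) z in auto)
      show "h z = (coord c' \<circ> id \<circ> param c) z" "z \<in> coord c ` dom_of c"
        using z U(4) sub by auto
    qed
    ultimately show "param c z \<in> dom_of c' \<and> differential id c c' (param c z) (f' z)"
      using z coord_param[of z c] unfolding differential_def by auto
  qed
qed

lemma differential_exists:
  assumes M: "smooth_manifold X H A" and c: "c \<in> A" and c': "c' \<in> A"
    and p: "p \<in> dom_of c" "p \<in> dom_of c'"
  obtains D where "differential id c c' p D"
proof -
  obtain U f' where U: "coord c p \<in> U" "\<And>z. z \<in> U \<inter> coord c ` dom_of c \<Longrightarrow>
           param c z \<in> dom_of c' \<and> differential id c c' (param c z) (f' z)"
    by (rule transition_C1[OF assms]) blast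
  then have "differential id c c' (param c (coord c p)) (f' (coord c p))"
    using p U(2)[of "coord c p"] by blast
  then show thesis
    using that param_coord[OF smooth_manifold_chart[OF M c] p(1)] by metis
qed

lemma eventually_in_dom:
  assumes c: "is_chart X H c" and \<gamma>: "continuous_map (top_of_set I) X \<gamma>" and s: "s \<in> I" "\<gamma> s \<in> dom_of c"
  shows "eventually (\<lambda>s'. \<gamma> s' \<in> dom_of c) (at s within I)"
proof -
  have "openin (top_of_set I) {s \<in> topspace (top_of_set I). \<gamma> s \<in> dom_of c}"
    using \<gamma> is_chart_dom[OF c] by (rule openin_continuous_map_preimage)
  then obtain T where "open T" "{s \<in> I. \<gamma> s \<in> dom_of c} = I \<inter> T"
    by (auto simp: openin_open)
  then show ?thesis
    using s unfolding eventually_at_topological by (intro exI[of _ T]) auto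
qed

text \<open>Differentiability of \<open>coord c \<circ> \<gamma>\<close> says nothing about \<open>\<gamma>\<close> at times when it is outside the domain of
  \<open>c\<close>, whence the condition that \<open>\<gamma>\<close> stays in this domain near \<open>s\<close>.\<close>

lemma vector_derivative_change_chart:
  assumes c: "is_chart X H c" and s: "\<gamma> s \<in> dom_of c" "s \<in> I"
    and ev: "eventually (\<lambda>s'. \<gamma> s' \<in> dom_of c) (at s within I)"
    and w: "((coord c \<circ> \<gamma>) has_vector_derivative w) (at s within I)"
    and D: "differential id c c' (\<gamma> s) D"
  shows "((coord c' \<circ> \<gamma>) has_vector_derivative D w) (at s within I)"
proof -
  obtain T where T: "open T" "s \<in> T" "\<forall>s'\<in>T \<inter> I. \<gamma> s' \<in> dom_of c"
    using ev s unfolding eventually_at_topological by fast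
  let ?J = "T \<inter> I"
  have J: "at s within ?J = at s within I"
    using T by (intro at_within_nhd[of s T]) auto
  have "(coord c' \<circ> id \<circ> param c has_derivative D) (at (coord c (\<gamma> s)) within (coord c \<circ> \<gamma>) ` ?J)"
    using D T(3) unfolding differential_def by (elim has_derivative_subset) auto
  moreover have "(coord c \<circ> \<gamma> has_derivative (\<lambda>h. h *\<^sub>R w)) (at s within ?J)"
    using w unfolding J has_vector_derivative_def .
  ultimately have "(coord c' \<circ> id \<circ> param c \<circ> (coord c \<circ> \<gamma>) has_derivative D \<circ> (\<lambda>h. h *\<^sub>R w)) (at s within ?J)"
    by (intro diff_chain_within) auto
  then have "((coord c' \<circ> \<gamma>) has_derivative D \<circ> (\<lambda>h. h *\<^sub>R w)) (at s within ?J)"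
    by (rule has_derivative_transform[rotated 2]) (use s T param_coord[OF c] in auto)
  moreover have "D \<circ> (\<lambda>h. h *\<^sub>R w) = (\<lambda>h. h *\<^sub>R D w)"
  proof -
    have "linear D"
      using D unfolding differential_def by (rule has_derivative_linear)
    then show ?thesis
      by (auto simp: linear_cmul)
  qed
  ultimately show ?thesis
    unfolding J has_vector_derivative_def by simp
qed

section \<open>Straight segments in a chart\<close>

definition chart_segment :: "('m, 'e::real_vector) chart \<Rightarrow> 'e \<Rightarrow> 'e \<Rightarrow> real \<Rightarrow> 'm" where
  "chart_segment c a b s = param c (a + s *\<^sub>R (b - a))"

lemma in_closed_segment: "s \<in> {0..1} \<Longrightarrow> a + s *\<^sub>R (b - a) \<in> closed_segment a b"
  unfolding in_segment by (intro exI[of _ s]) (auto simp: algebra_simps)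

context
  fixes X :: "'m topology" and H :: "'e::euclidean_space set" and c a b
  assumes c: "is_chart X H c" and seg: "closed_segment a b \<subseteq> coord c ` dom_of c"
begin

lemma chart_segment_in_dom: "s \<in> {0..1} \<Longrightarrow> chart_segment c a b s \<in> dom_of c"
  unfolding chart_segment_def by (rule param_in_dom[OF subsetD[OF seg in_closed_segment]])

lemma coord_chart_segment: "s \<in> {0..1} \<Longrightarrow> coord c (chart_segment c a b s) = a + s *\<^sub>R (b - a)"
  unfolding chart_segment_def by (rule coord_param[OF subsetD[OF seg in_closed_segment]])

lemma continuous_map_chart_segment: "continuous_map (top_of_set {0..1}) X (chart_segment c a b)"
  unfolding chart_segment_def
proof (rule continuous_map_param[OF c])
  show "continuous_on {0..1} (\<lambda>s. a + s *\<^sub>R (b - a))"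
    by (intro continuous_intros)
  show "(\<lambda>s. a + s *\<^sub>R (b - a)) ` {0..1} \<subseteq> coord c ` dom_of c"
    using subsetD[OF seg in_closed_segment] by auto
qed

lemma chart_segment_derivative:
  assumes "s \<in> {0..1}"
  shows "((coord c \<circ> chart_segment c a b) has_vector_derivative (b - a)) (at s within {0..1})"
proof (rule has_vector_derivative_transform[OF assms])
  show "((\<lambda>s. a + s *\<^sub>R (b - a)) has_vector_derivative (b - a)) (at s within {0..1})"
    unfolding has_vector_derivative_def add.commute[of a]
    by (intro has_derivative_add_const bounded_linear_imp_has_derivative bounded_linear_scaleR_left)
qed (simp add: coord_chart_segment)

end

text \<open>Concatenations of such segments connect any two points of a connected manifold.\<close>

lemma C1_arc_chart_segment:
  assumes M: "smooth_manifold X H A" and c: "c \<in> A"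
    and seg: "closed_segment a b \<subseteq> coord c ` dom_of c"
  shows "C1_arc X A (chart_segment c a b) 0 1"
  unfolding C1_arc_def
proof (intro conjI ballI)
  note ch = smooth_manifold_chart[OF M c]
  let ?\<gamma> = "chart_segment c a b"
  show "continuous_map (top_of_set {0..1}) X ?\<gamma>"
    by (rule continuous_map_chart_segment[OF ch seg])
  fix c' assume c': "c' \<in> A"
  define \<gamma>' where "\<gamma>' s = vector_derivative (coord c' \<circ> ?\<gamma>) (at s within {0..1})" for s
  have *: "((coord c' \<circ> ?\<gamma>) has_vector_derivative D (b - a)) (at s within {0..1})"
    if s: "s \<in> {0..1}" and D: "differential id c c' (?\<gamma> s) D" for s D
    by (rule vector_derivative_change_chart[OF ch chart_segment_in_dom[OF ch seg s] s
          eventually_in_dom[OF ch continuous_map_chart_segment[OF ch seg] s chart_segment_in_dom[OF ch seg s]]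
          chart_segment_derivative[OF ch seg s] D])
  have **: "\<gamma>' s = D (b - a)" if "s \<in> {0..1}" "differential id c c' (?\<gamma> s) D" for s D
    unfolding \<gamma>'_def using *[OF that] that(1)
    by (intro vector_derivative_within_closed_interval) auto
  show "\<exists>\<gamma>'. continuous_on {s \<in> {0..1}. ?\<gamma> s \<in> dom_of c'} \<gamma>' \<and>
        (\<forall>s\<in>{0..1}. ?\<gamma> s \<in> dom_of c' \<longrightarrow>
           ((coord c' \<circ> ?\<gamma>) has_vector_derivative \<gamma>' s) (at s within {0..1}))"
  proof (intro exI[of _ \<gamma>'] conjI ballI impI)
    fix s :: real assume s: "s \<in> {0..1}" "?\<gamma> s \<in> dom_of c'"
    obtain D where "differential id c c' (?\<gamma> s) D"
      using differential_exists[OF M c c' chart_segment_in_dom[OF ch seg s(1)] s(2)] .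
    then show "((coord c' \<circ> ?\<gamma>) has_vector_derivative \<gamma>' s) (at s within {0..1})"
      using *[OF s(1)] **[OF s(1)] by simp
  next
    let ?T = "{s \<in> {0..1}. ?\<gamma> s \<in> dom_of c'}"
    show "continuous_on ?T \<gamma>'"
      unfolding continuous_on_def
    proof
      fix s0 assume s0: "s0 \<in> ?T"
      then have s0': "s0 \<in> {0..1}" "?\<gamma> s0 \<in> dom_of c'"
        by auto
      obtain U f' where U: "open U" "coord c (?\<gamma> s0) \<in> U"
        "\<And>z. z \<in> U \<inter> coord c ` dom_of c \<Longrightarrow>
           param c z \<in> dom_of c' \<and> differential id c c' (param c z) (f' z)"
        "\<And>v. continuous_on U (\<lambda>z. f' z v)"
        by (rule transition_C1[OF M c c' chart_segment_in_dom[OF ch seg s0'(1)] s0'(2)]) blast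
      let ?z = "\<lambda>s. a + s *\<^sub>R (b - a)"
      have z: "coord c (?\<gamma> s) = ?z s" "?z s \<in> coord c ` dom_of c" "?\<gamma> s = param c (?z s)" if "s \<in> {0..1}" for s
        using coord_chart_segment[OF ch seg that] in_closed_segment[OF that, of a b] seg
        by (auto simp: chart_segment_def)
      have eq: "\<gamma>' s = f' (?z s) (b - a)" if "s \<in> {0..1}" "?z s \<in> U" for s
        using that(2) U(3)[of "?z s"] z[OF that(1)] **[OF that(1)] by auto
      have z0: "?z s0 \<in> U"
        using s0 U(2) z(1) by auto
      have cont_z: "isCont ?z s0"
        by (intro continuous_intros)
      have "isCont (\<lambda>z. f' z (b - a)) (?z s0)"
        using U(1,4) z0 by (simp add: continuous_on_eq_continuous_at)
      then have "isCont (\<lambda>s. f' (?z s) (b - a)) s0"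
        by (rule isCont_o2[OF cont_z])
      then have "((\<lambda>s. f' (?z s) (b - a)) \<longlongrightarrow> \<gamma>' s0) (at s0 within ?T)"
        using eq[of s0] s0 z0 by (auto simp: continuous_at intro: tendsto_within_subset)
      moreover have "eventually (\<lambda>s. ?z s \<in> U) (at s0)"
        using cont_z U(1) z0 by (auto simp: continuous_at dest: topological_tendstoD)
      then have "eventually (\<lambda>s. f' (?z s) (b - a) = \<gamma>' s) (at s0 within ?T)"
        unfolding eventually_at_filter by (rule eventually_mono) (auto simp: eq)
      ultimately show "(\<gamma>' \<longlongrightarrow> \<gamma>' s0) (at s0 within ?T)"
        by (rule Lim_transform_eventually)
    qed
  qed
qed

text \<open>The equivalence classes are open, hence also closed.  By this principle, relations that hold
  locally spread over plaques, segments, boundary components and the whole manifold.\<close>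

lemma connected_space_equivalence:
  assumes "connected_space Y"
    and sym: "\<And>x y. \<lbrakk>x \<in> topspace Y; y \<in> topspace Y; E x y\<rbrakk> \<Longrightarrow> E y x"
    and trans: "\<And>x y z. \<lbrakk>x \<in> topspace Y; y \<in> topspace Y; z \<in> topspace Y; E x y; E y z\<rbrakk> \<Longrightarrow> E x z"
    and local: "\<And>x. x \<in> topspace Y \<Longrightarrow> \<exists>V. openin Y V \<and> x \<in> V \<and> (\<forall>y\<in>V. E x y)"
    and x: "x \<in> topspace Y" and y: "y \<in> topspace Y"
  shows "E x y"
proof -
  let ?C = "{y \<in> topspace Y. E x y}"
  have "\<exists>V. openin Y V \<and> y \<in> V \<and> V \<subseteq> ?C" if "y \<in> ?C" for y
  proof -
    obtain V where V: "openin Y V" "y \<in> V" "\<forall>z\<in>V. E y z"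
      using local[of y] \<open>y \<in> ?C\<close> by auto
    then have "V \<subseteq> ?C"
      using openin_subset[OF V(1)] trans[of x y] x \<open>y \<in> ?C\<close> by auto
    then show ?thesis
      using V by auto
  qed
  then have 1: "openin Y ?C"
    by (subst openin_subopen) blast
  have "\<exists>V. openin Y V \<and> y \<in> V \<and> V \<subseteq> topspace Y - ?C" if "y \<in> topspace Y - ?C" for y
  proof -
    obtain V where V: "openin Y V" "y \<in> V" "\<forall>z\<in>V. E y z"
      using local[of y] \<open>y \<in> topspace Y - ?C\<close> by auto
    then have "V \<subseteq> topspace Y - ?C"
      using openin_subset[OF V(1)] trans[OF x _ _ _ sym] \<open>y \<in> topspace Y - ?C\<close> by fast
    then show ?thesis
      using V by auto
  qed
  then have 2: "openin Y (topspace Y - ?C)"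
    by (subst openin_subopen) blast
  have "closedin Y ?C"
    unfolding closedin_def using 2 by auto
  moreover have "x \<in> ?C"
    using local[OF x] x by auto
  ultimately have "?C = topspace Y"
    using assms(1) 1 unfolding connected_space_clopen_in by blast
  then show ?thesis
    using y by blast
qed

section \<open>Piecewise C1 curves\<close>

lemma C1_arc_derivativeE:
  assumes "C1_arc X A \<gamma> a b" "c \<in> A"
  obtains \<gamma>' where "continuous_on {s \<in> {a..b}. \<gamma> s \<in> dom_of c} \<gamma>'"
    "\<And>s. \<lbrakk>s \<in> {a..b}; \<gamma> s \<in> dom_of c\<rbrakk> \<Longrightarrow>
       ((coord c \<circ> \<gamma>) has_vector_derivative \<gamma>' s) (at s within {a..b})"
proof -
  have "\<exists>\<gamma>'. continuous_on {s \<in> {a..b}. \<gamma> s \<in> dom_of c} \<gamma>' \<and>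
        (\<forall>s\<in>{a..b}. \<gamma> s \<in> dom_of c \<longrightarrow>
           ((coord c \<circ> \<gamma>) has_vector_derivative \<gamma>' s) (at s within {a..b}))"
    using assms unfolding C1_arc_def by (elim conjE bspec)
  then show thesis
    using that by (elim exE conjE) simp
qed

lemma C1_arc_cong:
  assumes \<gamma>: "C1_arc X A \<gamma> a b" and eq: "\<And>s. s \<in> {a..b} \<Longrightarrow> \<delta> s = \<gamma> s"
  shows "C1_arc X A \<delta> a b"
  unfolding C1_arc_def
proof (intro conjI ballI)
  show "continuous_map (top_of_set {a..b}) X \<delta>"
    using \<gamma> unfolding C1_arc_def by (elim conjE continuous_map_eq) (simp add: eq)
  fix c assume "c \<in> A"
  then obtain \<gamma>' where \<gamma>': "continuous_on {s \<in> {a..b}. \<gamma> s \<in> dom_of c} \<gamma>'"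
    "\<And>s. \<lbrakk>s \<in> {a..b}; \<gamma> s \<in> dom_of c\<rbrakk> \<Longrightarrow>
       ((coord c \<circ> \<gamma>) has_vector_derivative \<gamma>' s) (at s within {a..b})"
    by (rule C1_arc_derivativeE[OF \<gamma>]) blast
  have "{s \<in> {a..b}. \<delta> s \<in> dom_of c} = {s \<in> {a..b}. \<gamma> s \<in> dom_of c}"
    using eq by auto
  moreover have "((coord c \<circ> \<delta>) has_vector_derivative \<gamma>' s) (at s within {a..b})"
    if "s \<in> {a..b}" "\<delta> s \<in> dom_of c" for s
    by (rule has_vector_derivative_transform[OF that(1) _ \<gamma>'(2)]) (use that eq in auto)
  ultimately show "\<exists>\<gamma>'. continuous_on {s \<in> {a..b}. \<delta> s \<in> dom_of c} \<gamma>' \<and>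
        (\<forall>s\<in>{a..b}. \<delta> s \<in> dom_of c \<longrightarrow>
           ((coord c \<circ> \<delta>) has_vector_derivative \<gamma>' s) (at s within {a..b}))"
    using \<gamma>'(1) by (intro exI[of _ \<gamma>']) auto
qed

lemma C1_arc_affine:
  assumes \<gamma>: "C1_arc X A \<gamma> a b" and sub: "(\<lambda>s. k * s + m) ` {a'..b'} \<subseteq> {a..b}"
  shows "C1_arc X A (\<lambda>s. \<gamma> (k * s + m)) a' b'"
  unfolding C1_arc_def
proof (intro conjI ballI)
  let ?l = "\<lambda>s. k * s + m"
  have l: "?l s \<in> {a..b}" if "s \<in> {a'..b'}" for s
    using sub that by blast
  have "continuous_map (top_of_set {a'..b'}) (top_of_set {a..b}) ?l"
    using sub by (auto simp: Pi_iff image_subset_iff intro!: continuous_intros)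
  then have "continuous_map (top_of_set {a'..b'}) X (\<gamma> \<circ> ?l)"
    using \<gamma> unfolding C1_arc_def by (intro continuous_map_compose) auto
  then show "continuous_map (top_of_set {a'..b'}) X (\<lambda>s. \<gamma> (k * s + m))"
    by (simp add: o_def)
  fix c assume "c \<in> A"
  then obtain \<gamma>' where \<gamma>': "continuous_on {s \<in> {a..b}. \<gamma> s \<in> dom_of c} \<gamma>'"
    "\<And>s. \<lbrakk>s \<in> {a..b}; \<gamma> s \<in> dom_of c\<rbrakk> \<Longrightarrow>
       ((coord c \<circ> \<gamma>) has_vector_derivative \<gamma>' s) (at s within {a..b})"
    by (rule C1_arc_derivativeE[OF \<gamma>]) blast
  let ?T = "{s \<in> {a'..b'}. \<gamma> (?l s) \<in> dom_of c}"
  have "continuous_on ?T (\<lambda>s. k *\<^sub>R \<gamma>' (?l s))"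
    by (intro continuous_intros continuous_on_compose2[OF \<gamma>'(1)]) (use l in auto)
  moreover have "((coord c \<circ> (\<lambda>s. \<gamma> (?l s))) has_vector_derivative k *\<^sub>R \<gamma>' (?l s)) (at s within {a'..b'})"
    if s: "s \<in> {a'..b'}" "\<gamma> (?l s) \<in> dom_of c" for s
  proof -
    have "(?l has_vector_derivative k) (at s within {a'..b'})"
      unfolding has_vector_derivative_def real_scaleR_def mult.commute[of k]
      by (intro has_derivative_add_const bounded_linear_imp_has_derivative bounded_linear_mult_left)
    moreover have "((coord c \<circ> \<gamma>) has_vector_derivative \<gamma>' (?l s)) (at (?l s) within ?l ` {a'..b'})"
      using \<gamma>'(2)[OF l[OF s(1)] s(2)] sub by (rule has_vector_derivative_within_subset)
    ultimately have "((coord c \<circ> \<gamma>) \<circ> ?l has_vector_derivative k *\<^sub>R \<gamma>' (?l s)) (at s within {a'..b'})"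
      by (rule vector_diff_chain_within)
    then show ?thesis
      by (simp add: o_def)
  qed
  ultimately show "\<exists>\<gamma>''. continuous_on ?T \<gamma>'' \<and> (\<forall>s\<in>{a'..b'}. \<gamma> (?l s) \<in> dom_of c \<longrightarrow>
           ((coord c \<circ> (\<lambda>s. \<gamma> (?l s))) has_vector_derivative \<gamma>'' s) (at s within {a'..b'}))"
    by (intro exI[of _ "\<lambda>s. k *\<^sub>R \<gamma>' (?l s)"]) auto
qed

lemma piecewise_C1_curve_single: "C1_arc X A \<gamma> 0 1 \<Longrightarrow> piecewise_C1_curve X A \<gamma>"
  unfolding piecewise_C1_curve_def by (intro exI[of _ real] exI[of _ 1]) auto

lemma piecewise_C1_curve_reverse:
  assumes "piecewise_C1_curve X A \<gamma>"
  shows "piecewise_C1_curve X A (\<lambda>s. \<gamma> (1 - s))"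
proof -
  obtain t n where t: "t 0 = 0" "t n = 1" "\<forall>i<n. t i < t (Suc i) \<and> C1_arc X A \<gamma> (t i) (t (Suc i))"
    using assms unfolding piecewise_C1_curve_def by blast
  have "1 - t (n - i) < 1 - t (n - Suc i) \<and>
      C1_arc X A (\<lambda>s. \<gamma> (1 - s)) (1 - t (n - i)) (1 - t (n - Suc i))" if i: "i < n" for i
  proof -
    obtain j where j: "n - i = Suc j" "n - Suc i = j" "j < n"
      using i that[of "n - Suc i"] by auto
    have "C1_arc X A (\<lambda>s. \<gamma> (-1 * s + 1)) (1 - t (Suc j)) (1 - t j)"
      using t(3) j(3) by (intro C1_arc_affine[of X A \<gamma> "t j" "t (Suc j)"]) auto
    then show ?thesis
      using t(3) j by simp
  qed
  then show ?thesis
    unfolding piecewise_C1_curve_def using t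
    by (intro exI[of _ "\<lambda>i. 1 - t (n - i)"] exI[of _ n]) auto
qed

lemma piecewise_C1_curve_append:
  assumes "piecewise_C1_curve X A \<gamma>" "piecewise_C1_curve X A \<delta>" "\<gamma> 1 = \<delta> 0"
  shows "piecewise_C1_curve X A (\<lambda>s. if s \<le> 1/2 then \<gamma> (2 * s) else \<delta> (2 * s - 1))"
proof -
  let ?\<eta> = "\<lambda>s. if s \<le> 1/2 then \<gamma> (2 * s) else \<delta> (2 * s - 1)"
  obtain t n where t: "t 0 = 0" "t n = 1" "\<And>i. i < n \<Longrightarrow> t i < t (Suc i)"
    "\<And>i. i < n \<Longrightarrow> C1_arc X A \<gamma> (t i) (t (Suc i))"
    using assms(1) unfolding piecewise_C1_curve_def by blast
  obtain u k where u: "u 0 = 0" "u k = 1" "\<And>i. i < k \<Longrightarrow> u i < u (Suc i)"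
    "\<And>i. i < k \<Longrightarrow> C1_arc X A \<delta> (u i) (u (Suc i))"
    using assms(2) unfolding piecewise_C1_curve_def by blast
  have t1: "t (Suc i) \<le> 1" if "i < n" for i
  proof -
    have "t (Suc i) \<le> t n"
      using that t(3) by (intro lift_Suc_mono_le_ivl[of "{..<n}" t "Suc i" n]) (auto simp: less_imp_le)
    then show ?thesis using t by simp
  qed
  have u0: "0 \<le> u i" if "i < k" for i
  proof -
    have "u 0 \<le> u i"
      using that u(3) by (intro lift_Suc_mono_le_ivl[of "{..<k}" u 0 i]) (auto simp: less_imp_le)
    then show ?thesis using u by simp
  qed
  define v where "v i = (if i \<le> n then t i / 2 else 1/2 + u (i - n) / 2)" for i
  have "v i < v (Suc i) \<and> C1_arc X A ?\<eta> (v i) (v (Suc i))" if i: "i < n + k" for i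
  proof (cases "i < n")
    case True
    have "C1_arc X A (\<lambda>s. \<gamma> (2 * s + 0)) (t i / 2) (t (Suc i) / 2)"
      by (rule C1_arc_affine[OF t(4)[OF True]]) auto
    then have "C1_arc X A ?\<eta> (t i / 2) (t (Suc i) / 2)"
      by (rule C1_arc_cong) (use t1[OF True] in auto)
    then show ?thesis
      using True t(3)[OF True] by (simp add: v_def)
  next
    case False
    define j where "j = i - n"
    have j: "j < k" "i = n + j"
      using False i by (auto simp: j_def)
    have v: "v i = 1/2 + u j / 2" "v (Suc i) = 1/2 + u (Suc j) / 2"
      using j t u by (auto simp: v_def)
    have "C1_arc X A (\<lambda>s. \<delta> (2 * s + (- 1))) (v i) (v (Suc i))"
      by (rule C1_arc_affine[OF u(4)[OF j(1)]]) (auto simp: v)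
    then have "C1_arc X A ?\<eta> (v i) (v (Suc i))"
    proof (rule C1_arc_cong)
      fix s assume "s \<in> {v i..v (Suc i)}"
      then have "s \<ge> 1/2"
        using u0[OF j(1)] v by auto
      then show "?\<eta> s = \<delta> (2 * s + (- 1))"
      proof (cases "s = 1/2")
        case True
        show ?thesis
          unfolding True using assms(3) by simp
      qed (use \<open>s \<ge> 1/2\<close> in auto)
    qed
    then show ?thesis
      using u(3)[OF j(1)] v by simp
  qed
  moreover have "k \<noteq> 0"
    using u(1,2) by (cases "k = 0") auto
  then have "v 0 = 0" "v (n + k) = 1"
    using t(1) u(2) by (auto simp: v_def)
  ultimately show ?thesis
    unfolding piecewise_C1_curve_def by (intro exI[of _ v] exI[of _ "n + k"]) auto
qed

section \<open>Length of curves\<close>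

text \<open>The speed does not depend on the chart, by the transformation laws of velocities and of the
  metric.\<close>

lemma speed_eq:
  assumes M: "smooth_manifold X H A" and g: "riemannian_metric A g"
    and c: "c0 \<in> A" and s: "s \<in> {0..1}" "\<gamma> s \<in> dom_of c0"
    and ev: "eventually (\<lambda>s'. \<gamma> s' \<in> dom_of c0) (at s within {0..1})"
    and w: "((coord c0 \<circ> \<gamma>) has_vector_derivative w) (at s within {0..1})"
  shows "speed A g \<gamma> s = sqrt (g c0 (\<gamma> s) w w)"
  unfolding speed_def
proof (rule the_equality)
  show "\<exists>c\<in>A. \<exists>w'. \<gamma> s \<in> dom_of c \<and>
      ((coord c \<circ> \<gamma>) has_vector_derivative w') (at s within {0..1}) \<and>
      sqrt (g c0 (\<gamma> s) w w) = sqrt (g c (\<gamma> s) w' w')"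
    using c s w by (intro bexI[of _ c0] exI[of _ w]) auto
next
  fix r assume "\<exists>c\<in>A. \<exists>w. \<gamma> s \<in> dom_of c \<and>
      ((coord c \<circ> \<gamma>) has_vector_derivative w) (at s within {0..1}) \<and> r = sqrt (g c (\<gamma> s) w w)"
  then obtain c' w' where c': "c' \<in> A" "\<gamma> s \<in> dom_of c'"
    "((coord c' \<circ> \<gamma>) has_vector_derivative w') (at s within {0..1})" "r = sqrt (g c' (\<gamma> s) w' w')"
    by blast
  obtain D where D: "differential id c0 c' (\<gamma> s) D"
    by (rule differential_exists[OF M c c'(1) s(2) c'(2)])
  have "((coord c' \<circ> \<gamma>) has_vector_derivative D w) (at s within {0..1})"
    by (rule vector_derivative_change_chart[OF smooth_manifold_chart[OF M c] s(2,1) ev w D])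
  then have "w' = D w"
    using vector_derivative_unique_within_closed_interval[of 0 1 s "coord c' \<circ> \<gamma>" w' "D w"] c'(3) s(1)
    by simp
  moreover have "g c0 (\<gamma> s) w w = g c' (\<gamma> s) (D w) (D w)"
    using g c c' s D unfolding riemannian_metric_def by blast
  ultimately show "r = sqrt (g c0 (\<gamma> s) w w)"
    using c'(4) by simp
qed


lemma exists_partition_interval:
  fixes t :: "nat \<Rightarrow> real"
  assumes "t 0 \<le> s" "s \<le> t n" "s \<notin> t ` {..n}"
  shows "\<exists>i<n. t i < s \<and> s < t (Suc i)"
  using assms
proof (induction n)
  case 0
  then show ?case by auto
next
  case (Suc n)
  have "s \<noteq> t n" "s \<noteq> t (Suc n)"
    using Suc.prems(3) by auto
  show ?case
  proof (cases "s < t n")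
    case True
    then show ?thesis
      using Suc by (auto simp: image_iff less_Suc_eq)
  next
    case False
    then show ?thesis
      using Suc.prems(2) \<open>s \<noteq> t n\<close> \<open>s \<noteq> t (Suc n)\<close> by (intro exI[of _ n]) auto
  qed
qed

text \<open>At the break points the speed is an arbitrary number, which is negligible for the
  integral; and an integral that does not exist is \<open>0\<close>.\<close>

lemma curve_length_nonneg:
  assumes M: "smooth_manifold X H A" and g: "riemannian_metric A g"
    and \<gamma>: "piecewise_C1_curve X A \<gamma>"
  shows "0 \<le> curve_length A g \<gamma>"
proof -
  obtain t n where t: "t 0 = 0" "t n = 1" "\<And>i. i < n \<Longrightarrow> t i < t (Suc i)"
    "\<And>i. i < n \<Longrightarrow> C1_arc X A \<gamma> (t i) (t (Suc i))"
    using \<gamma> unfolding piecewise_C1_curve_def by blast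
  have nonneg: "0 \<le> speed A g \<gamma> s" if s: "s \<in> {0..1} - t ` {..n}" for s
  proof -
    obtain i where i: "i < n" "t i < s" "s < t (Suc i)"
      using exists_partition_interval[of t s n] s t by auto
    have arc: "C1_arc X A \<gamma> (t i) (t (Suc i))"
      by (rule t(4)[OF i(1)])
    have cont: "continuous_map (top_of_set {t i..t (Suc i)}) X \<gamma>"
      using arc unfolding C1_arc_def by blast
    then have "\<gamma> s \<in> topspace X"
      using i unfolding continuous_map_def by auto
    then obtain c where c: "c \<in> A" "\<gamma> s \<in> dom_of c"
      by (rule smooth_manifold_cover[OF M])
    obtain \<gamma>' where \<gamma>': "\<And>s. \<lbrakk>s \<in> {t i..t (Suc i)}; \<gamma> s \<in> dom_of c\<rbrakk> \<Longrightarrow>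
       ((coord c \<circ> \<gamma>) has_vector_derivative \<gamma>' s) (at s within {t i..t (Suc i)})"
      by (rule C1_arc_derivativeE[OF arc c(1)]) blast
    have at: "at s within {t i..t (Suc i)} = at s"
      using i by (intro at_within_interior) auto
    have "((coord c \<circ> \<gamma>) has_vector_derivative \<gamma>' s) (at s within {0..1})"
      using \<gamma>'[of s] c i at by (auto intro: has_vector_derivative_at_within)
    moreover have "eventually (\<lambda>s'. \<gamma> s' \<in> dom_of c) (at s within {0..1})"
      using eventually_in_dom[OF smooth_manifold_chart[OF M c(1)] cont _ c(2)] i
      unfolding at by (auto elim: eventually_at_leftI eventually_mono simp: eventually_at_filter)
    ultimately have "speed A g \<gamma> s = sqrt (g c (\<gamma> s) (\<gamma>' s) (\<gamma>' s))"
      using s c by (intro speed_eq[OF M g]) auto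
    moreover have "g c (\<gamma> s) (\<gamma>' s) (\<gamma>' s) \<ge> 0"
    proof (cases "\<gamma>' s = 0")
      case True
      have "bilinear (g c (\<gamma> s))"
        using g c unfolding riemannian_metric_def by simp
      then show ?thesis
        using True by (simp add: bilinear_lzero)
    next
      case False
      then show ?thesis
        using g c unfolding riemannian_metric_def by (auto intro: less_imp_le)
    qed
    ultimately show ?thesis
      by simp
  qed
  define f where "f s = (if s \<in> t ` {..n} then 0 else speed A g \<gamma> s)" for s
  have "integral {0..1} (speed A g \<gamma>) = integral {0..1} f"
    by (rule integral_spike[of "t ` {..n}"]) (auto simp: f_def)
  moreover have "0 \<le> integral {0..1} f"
  proof (cases "f integrable_on {0..1}")
    case True
    then show ?thesis
      by (rule integral_nonneg) (use nonneg in \<open>auto simp: f_def\<close>)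
  qed (simp add: not_integrable_integral)
  ultimately show ?thesis
    unfolding curve_length_def by simp
qed

text \<open>The two speeds are the same definite description, as a velocity \<open>w\<close> becomes \<open>- w\<close>; so the
  equation also holds at times at which there is no velocity.\<close>

lemma speed_reverse:
  assumes M: "smooth_manifold X H A" and g: "riemannian_metric A g" and s: "s \<in> {0..1}"
  shows "speed A g (\<lambda>s. \<gamma> (1 - s)) s = speed A g \<gamma> (1 - s)"
proof -
  have *: "((coord c \<circ> (\<lambda>s. \<gamma> (1 - s))) has_vector_derivative - w) (at s within {0..1})"
    if "((coord c \<circ> \<gamma>) has_vector_derivative w) (at (1 - s) within {0..1})"
    for c w s and \<gamma> :: "real \<Rightarrow> 'a"
  proof -
    have "((\<lambda>s. 1 - s) has_vector_derivative - 1) (at s within {0..1})"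
      by (rule has_vector_derivative_eq_rhs, rule has_vector_derivative_diff[OF has_vector_derivative_const has_vector_derivative_id]) simp
    moreover have "(\<lambda>s::real. 1 - s) ` {0..1} = {0..1}"
      by (auto simp: image_def intro!: bexI[of _ "1 - _"])
    ultimately have "((coord c \<circ> \<gamma>) \<circ> (\<lambda>s. 1 - s) has_vector_derivative - 1 *\<^sub>R w) (at s within {0..1})"
      using that by (intro vector_diff_chain_within) simp_all
    then show ?thesis
      by (simp add: o_def)
  qed
  have neg: "g c p (- w) (- w) = g c p w w" if "c \<in> A" "p \<in> dom_of c" for c p w
  proof -
    have "bilinear (g c p)"
      using g that unfolding riemannian_metric_def by simp
    then show ?thesis
      by (simp add: bilinear_lneg bilinear_rneg)
  qed
  have "(\<exists>c\<in>A. \<exists>w. \<gamma> (1 - s) \<in> dom_of c \<and>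
        ((coord c \<circ> (\<lambda>s. \<gamma> (1 - s))) has_vector_derivative w) (at s within {0..1}) \<and>
        r = sqrt (g c (\<gamma> (1 - s)) w w)) \<longleftrightarrow>
     (\<exists>c\<in>A. \<exists>w. \<gamma> (1 - s) \<in> dom_of c \<and>
        ((coord c \<circ> \<gamma>) has_vector_derivative w) (at (1 - s) within {0..1}) \<and>
        r = sqrt (g c (\<gamma> (1 - s)) w w))" (is "?L \<longleftrightarrow> ?R") for r
  proof
    assume ?L
    then obtain c w where 1: "c \<in> A" "\<gamma> (1 - s) \<in> dom_of c" "r = sqrt (g c (\<gamma> (1 - s)) w w)"
      "((coord c \<circ> (\<lambda>s. \<gamma> (1 - s))) has_vector_derivative w) (at s within {0..1})"
      by blast
    have "((coord c \<circ> \<gamma>) has_vector_derivative - w) (at (1 - s) within {0..1})"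
      using *[of c "\<lambda>s. \<gamma> (1 - s)" w "1 - s"] 1(4) by simp
    then show ?R
      using 1 neg[of c "\<gamma> (1 - s)" w] by (intro bexI[of _ c] exI[of _ "- w"]) auto
  next
    assume ?R
    then obtain c w where 1: "c \<in> A" "\<gamma> (1 - s) \<in> dom_of c" "r = sqrt (g c (\<gamma> (1 - s)) w w)"
      "((coord c \<circ> \<gamma>) has_vector_derivative w) (at (1 - s) within {0..1})"
      by blast
    then show ?L
      using neg[of c "\<gamma> (1 - s)" w] *[OF 1(4)] by (intro bexI[of _ c] exI[of _ "- w"]) auto
  qed
  then show ?thesis
    unfolding speed_def by simp
qed

lemma curve_length_reverse:
  assumes M: "smooth_manifold X H A" and g: "riemannian_metric A g"
  shows "curve_length A g (\<lambda>s. \<gamma> (1 - s)) = curve_length A g \<gamma>"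
proof -
  have "integral {0..1} (speed A g (\<lambda>s. \<gamma> (1 - s))) = integral {0..1} (\<lambda>s. speed A g \<gamma> (1 - s))"
    by (rule integral_cong) (rule speed_reverse[OF M g])
  also have "\<dots> = integral {0..1} (speed A g \<gamma>)"
    using integral_shift_real_ivl[of "- 1" "- 1" 0 "\<lambda>s. speed A g \<gamma> (- s)"]
      Henstock_Kurzweil_Integration.integral_reflect_real[of 1 0 "speed A g \<gamma>"] by (simp add: algebra_simps)
  finally show ?thesis
    unfolding curve_length_def .
qed

section \<open>Riemannian distance\<close>

lemma piecewise_C1_curve_exists:
  assumes M: "smooth_manifold X H A" and H: "convex H" and X: "connected_space X"
    and xy: "x \<in> topspace X" "y \<in> topspace X"
  shows "\<exists>\<gamma>. piecewise_C1_curve X A \<gamma> \<and> \<gamma> 0 = x \<and> \<gamma> 1 = y"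
proof -
  define E where "E x y \<longleftrightarrow> (\<exists>\<gamma>. piecewise_C1_curve X A \<gamma> \<and> \<gamma> 0 = x \<and> \<gamma> 1 = y)" for x y
  have sym: "E y x" if xy: "E x y" for x y
  proof -
    obtain \<gamma> where "piecewise_C1_curve X A \<gamma>" "\<gamma> 0 = x" "\<gamma> 1 = y"
      using xy unfolding E_def by blast
    then show ?thesis
      unfolding E_def by (intro exI[of _ "\<lambda>s. \<gamma> (1 - s)"]) (simp add: piecewise_C1_curve_reverse)
  qed
  have trans: "E x z" if xy: "E x y" and yz: "E y z" for x y z
  proof -
    obtain \<gamma> where 1: "piecewise_C1_curve X A \<gamma>" "\<gamma> 0 = x" "\<gamma> 1 = y"
      using xy unfolding E_def by blast
    obtain \<delta> where 2: "piecewise_C1_curve X A \<delta>" "\<delta> 0 = y" "\<delta> 1 = z"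
      using yz unfolding E_def by blast
    show ?thesis
      unfolding E_def
      using piecewise_C1_curve_append[OF 1(1) 2(1)] 1 2
      by (intro exI[of _ "\<lambda>s. if s \<le> 1/2 then \<gamma> (2 * s) else \<delta> (2 * s - 1)"]) simp
  qed
  have local: "\<exists>V. openin X V \<and> x \<in> V \<and> (\<forall>y\<in>V. E x y)" if x: "x \<in> topspace X" for x
  proof -
    obtain c where c: "c \<in> A" "x \<in> dom_of c"
      by (rule smooth_manifold_cover[OF M x])
    note ch = smooth_manifold_chart[OF M c(1)]
    obtain r where r: "r > 0" "ball (coord c x) r \<inter> H \<subseteq> coord c ` (dom_of c \<inter> topspace X)"
      by (rule is_chart_ball[OF ch c(2) openin_topspace x])
    let ?V = "{y \<in> dom_of c. coord c y \<in> ball (coord c x) r}"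
    have "E x y" if y: "y \<in> ?V" for y
    proof -
      have "convex (ball (coord c x) r \<inter> H)"
        using H by (intro convex_Int convex_ball)
      moreover have "coord c x \<in> ball (coord c x) r \<inter> H" "coord c y \<in> ball (coord c x) r \<inter> H"
        using r(1) y c is_chart_image_subset[OF ch] by auto
      ultimately have "closed_segment (coord c x) (coord c y) \<subseteq> coord c ` dom_of c"
        using closed_segment_subset[of "coord c x" "ball (coord c x) r \<inter> H" "coord c y"] r(2) by blast
      then have "piecewise_C1_curve X A (chart_segment c (coord c x) (coord c y))"
        by (intro piecewise_C1_curve_single C1_arc_chart_segment[OF M c(1)])
      then show ?thesis
        unfolding E_def chart_segment_def using param_coord[OF ch] c y
        by (intro exI[of _ "\<lambda>s. param c (coord c x + s *\<^sub>R (coord c y - coord c x))"]) auto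
    qed
    moreover have "openin X ?V"
      by (rule is_chart_open_preimage[OF ch]) simp
    ultimately show ?thesis
      using c r by (intro exI[of _ ?V]) auto
  qed
  have "E x y"
  proof (rule connected_space_equivalence[where E = E, OF X _ _ _ xy])
    show "E y x" if "E x y" for x y
      using that by (rule sym)
    show "E x z" if "E x y" "E y z" for x y z
      using that by (rule trans)
    show "\<exists>V. openin X V \<and> x \<in> V \<and> (\<forall>y\<in>V. E x y)" if "x \<in> topspace X" for x
      using that by (rule local)
  qed
  then show ?thesis
    unfolding E_def .
qed

abbreviation curve_lengths where
  "curve_lengths X A g x y \<equiv>
     {curve_length A g \<gamma> |\<gamma>. piecewise_C1_curve X A \<gamma> \<and> \<gamma> 0 = x \<and> \<gamma> 1 = y}"

text \<open>Connectedness matters here: the infimum of the empty set is an unspecified real number.\<close>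

lemma riemannian_dist_nonneg:
  assumes M: "smooth_manifold X H A" and H: "convex H" and X: "connected_space X"
    and g: "riemannian_metric A g" and xy: "x \<in> topspace X" "y \<in> topspace X"
  shows "0 \<le> riemannian_dist X A g x y"
  unfolding riemannian_dist_def
proof (rule cInf_greatest)
  show "curve_lengths X A g x y \<noteq> {}"
    using piecewise_C1_curve_exists[OF M H X xy] by blast
qed (use curve_length_nonneg[OF M g] in blast)

lemma riemannian_dist_sym:
  assumes M: "smooth_manifold X H A" and g: "riemannian_metric A g"
  shows "riemannian_dist X A g x y = riemannian_dist X A g y x"
proof -
  have "curve_lengths X A g x y \<subseteq> curve_lengths X A g y x" for x y
  proof
    fix l assume "l \<in> curve_lengths X A g x y"
    then obtain \<gamma> where \<gamma>: "l = curve_length A g \<gamma>" "piecewise_C1_curve X A \<gamma>" "\<gamma> 0 = x" "\<gamma> 1 = y"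
      by blast
    then show "l \<in> curve_lengths X A g y x"
      using piecewise_C1_curve_reverse[OF \<gamma>(2)] curve_length_reverse[OF M g, of \<gamma>]
      by (intro CollectI exI[of _ "\<lambda>s. \<gamma> (1 - s)"]) auto
  qed
  then have "curve_lengths X A g x y = curve_lengths X A g y x"
    by (intro subset_antisym)
  then show ?thesis
    unfolding riemannian_dist_def by simp
qed

lemma riemannian_dist_le_curve_length:
  assumes M: "smooth_manifold X H A" and g: "riemannian_metric A g"
    and \<gamma>: "piecewise_C1_curve X A \<gamma>"
  shows "riemannian_dist X A g (\<gamma> 0) (\<gamma> 1) \<le> curve_length A g \<gamma>"
  unfolding riemannian_dist_def
proof (rule cInf_lower)
  show "bdd_below (curve_lengths X A g (\<gamma> 0) (\<gamma> 1))"
    by (rule bdd_belowI[of _ 0]) (use curve_length_nonneg[OF M g] in blast)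
qed (use \<gamma> in blast)

lemma riemannian_metric_locally_bounded:
  assumes M: "smooth_manifold X H A" and g: "riemannian_metric A g"
    and c: "c \<in> A" and p: "p \<in> dom_of c"
  obtains r C where "r > 0" "C \<ge> 0"
    "\<And>z v. z \<in> ball (coord c p) r \<inter> coord c ` dom_of c \<Longrightarrow> g c (param c z) v v \<le> C * (norm v)\<^sup>2"
proof -
  let ?B = "Basis :: 'b set" and ?z0 = "coord c p" and ?I = "coord c ` dom_of c"
  have "eventually (\<lambda>z. z \<in> ?I \<longrightarrow> \<bar>g c (param c z) i j\<bar> \<le> \<bar>g c (param c ?z0) i j\<bar> + 1) (nhds ?z0)" for i j
  proof -
    have "smooth_on ?I (\<lambda>x. g c (param c x) i j)"
      using g c unfolding riemannian_metric_def by blast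
    then obtain U h where U: "open U" "?z0 \<in> U" "\<forall>k. C_k k h U"
      "\<forall>y\<in>U \<inter> ?I. h y = g c (param c y) i j"
      using p unfolding smooth_on_def by blast
    from U(3) have "C_k 0 h U"
      by blast
    then have "isCont h ?z0"
      using U(1,2) by (simp add: continuous_on_eq_continuous_at)
    then have "((\<lambda>z. \<bar>h z\<bar>) \<longlongrightarrow> \<bar>h ?z0\<bar>) (nhds ?z0)"
      by (simp add: isCont_def tendsto_at_iff_tendsto_nhds tendsto_rabs)
    then have "eventually (\<lambda>z. \<bar>h z\<bar> < \<bar>h ?z0\<bar> + 1) (nhds ?z0)"
      by (rule order_tendstoD) simp
    moreover have "eventually (\<lambda>z. z \<in> U) (nhds ?z0)"
      using U by (auto simp: eventually_nhds)
    ultimately show ?thesis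
      by eventually_elim (use U p in auto)
  qed
  then have "eventually (\<lambda>z. \<forall>i\<in>?B. \<forall>j\<in>?B. z \<in> ?I \<longrightarrow>
      \<bar>g c (param c z) i j\<bar> \<le> \<bar>g c (param c ?z0) i j\<bar> + 1) (nhds ?z0)"
    by (intro eventually_ball_finite ballI) auto
  then obtain r where r: "r > 0" "\<And>z i j. \<lbrakk>dist z ?z0 < r; i \<in> ?B; j \<in> ?B; z \<in> ?I\<rbrakk> \<Longrightarrow>
      \<bar>g c (param c z) i j\<bar> \<le> \<bar>g c (param c ?z0) i j\<bar> + 1"
    unfolding eventually_nhds_metric by blast
  define C where "C = (\<Sum>(i,j)\<in>?B \<times> ?B. \<bar>g c (param c ?z0) i j\<bar> + 1)"
  show thesis
  proof (rule that[of r C])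
    show "C \<ge> 0"
      unfolding C_def by (auto intro!: sum_nonneg)
    fix z and v :: 'b assume z: "z \<in> ball ?z0 r \<inter> ?I"
    let ?h = "g c (param c z)"
    have h: "bilinear ?h"
      using g c param_in_dom[of z c] z unfolding riemannian_metric_def by auto
    have "?h v v = ?h (\<Sum>i\<in>?B. (v \<bullet> i) *\<^sub>R i) (\<Sum>i\<in>?B. (v \<bullet> i) *\<^sub>R i)"
      by (simp add: euclidean_representation)
    also have "\<dots> = (\<Sum>(i,j)\<in>?B \<times> ?B. ?h ((v \<bullet> i) *\<^sub>R i) ((v \<bullet> j) *\<^sub>R j))"
      by (rule bilinear_sum[OF h])
    also have "\<dots> = (\<Sum>(i,j)\<in>?B \<times> ?B. (v \<bullet> i) * (v \<bullet> j) * ?h i j)"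
      by (simp add: bilinear_lmul[OF h] bilinear_rmul[OF h] mult.assoc mult.left_commute)
    also have "\<dots> \<le> (\<Sum>(i,j)\<in>?B \<times> ?B. (norm v)\<^sup>2 * (\<bar>g c (param c ?z0) i j\<bar> + 1))"
    proof (intro sum_mono, clarify)
      fix i j :: 'b assume ij: "i \<in> ?B" "j \<in> ?B"
      have "(v \<bullet> i) * (v \<bullet> j) * ?h i j \<le> \<bar>(v \<bullet> i) * (v \<bullet> j) * ?h i j\<bar>"
        by simp
      also have "\<dots> = (\<bar>v \<bullet> i\<bar> * \<bar>v \<bullet> j\<bar>) * \<bar>?h i j\<bar>"
        by (simp add: abs_mult)
      also have "\<dots> \<le> (norm v * norm v) * (\<bar>g c (param c ?z0) i j\<bar> + 1)"
        using ij z r(2)[of z i j] by (intro mult_mono) (auto simp: Basis_le_norm dist_commute)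
      finally show "(v \<bullet> i) * (v \<bullet> j) * ?h i j \<le> (norm v)\<^sup>2 * (\<bar>g c (param c ?z0) i j\<bar> + 1)"
        by (simp add: power2_eq_square)
    qed
    also have "\<dots> = C * (norm v)\<^sup>2"
      unfolding C_def sum_distrib_right by (rule sum.cong) auto
    finally show "?h v v \<le> C * (norm v)\<^sup>2" .
  qed (rule r(1))
qed

text \<open>Two points of a small coordinate ball are joined by a segment, whose length is controlled by a
  local bound on the metric.  It is the bridge between the topology of the manifold and the
  pseudometrics below the Riemannian distance.\<close>

lemma riemannian_dist_locally_small:
  assumes M: "smooth_manifold X H A" and H: "convex H" and g: "riemannian_metric A g"
    and p: "p \<in> topspace X" and e: "e > 0"
  shows "\<exists>V. openin X V \<and> p \<in> V \<and> (\<forall>x\<in>V. \<forall>y\<in>V. riemannian_dist X A g x y < e)"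
proof -
  obtain c where c: "c \<in> A" "p \<in> dom_of c"
    by (rule smooth_manifold_cover[OF M p])
  note ch = smooth_manifold_chart[OF M c(1)]
  let ?z0 = "coord c p" and ?I = "coord c ` dom_of c"
  obtain r0 where r0: "r0 > 0" "ball ?z0 r0 \<inter> H \<subseteq> coord c ` (dom_of c \<inter> topspace X)"
    by (rule is_chart_ball[OF ch c(2) openin_topspace p])
  obtain r1 C where C: "r1 > 0" "C \<ge> 0"
    "\<And>z v. z \<in> ball ?z0 r1 \<inter> ?I \<Longrightarrow> g c (param c z) v v \<le> C * (norm v)\<^sup>2"
    by (rule riemannian_metric_locally_bounded[OF M g c]) blast
  \<comment> \<open>The length of a segment in the ball of radius \<open>r\<close> is at most \<open>sqrt C * (2 * r)\<close>.\<close>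
  define r where "r = min (min r0 r1) (e / (2 * (sqrt C + 1)))"
  have sC: "sqrt C + 1 > 0"
    using C(2) by (simp add: add_nonneg_pos)
  have r: "r > 0" "r \<le> r0" "r \<le> r1" "r \<le> e / (2 * (sqrt C + 1))"
    using r0 C e sC by (auto simp: r_def)
  have re: "(sqrt C + 1) * (2 * r) \<le> e"
    using r(4) sC by (simp add: field_simps)
  let ?V = "{y \<in> dom_of c. coord c y \<in> ball ?z0 r}"
  have "riemannian_dist X A g x y < e" if xy: "x \<in> ?V" "y \<in> ?V" for x y
  proof -
    let ?a = "coord c x" and ?b = "coord c y"
    let ?\<gamma> = "chart_segment c ?a ?b"
    have "convex (ball ?z0 r \<inter> H)"
      using H by (intro convex_Int convex_ball)
    moreover have "?a \<in> ball ?z0 r \<inter> H" "?b \<in> ball ?z0 r \<inter> H"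
      using xy is_chart_image_subset[OF ch] by auto
    ultimately have seg0: "closed_segment ?a ?b \<subseteq> ball ?z0 r \<inter> H"
      by (intro closed_segment_subset)
    then have seg: "closed_segment ?a ?b \<subseteq> ?I" and seg1: "closed_segment ?a ?b \<subseteq> ball ?z0 r1"
      using r0(2) r(2,3) subset_ball[OF r(2), of ?z0] subset_ball[OF r(3), of ?z0] by blast+
    have pw: "piecewise_C1_curve X A ?\<gamma>"
      by (intro piecewise_C1_curve_single C1_arc_chart_segment[OF M c(1) seg])
    have ends: "?\<gamma> 0 = x" "?\<gamma> 1 = y"
      using xy param_coord[OF ch] by (auto simp: chart_segment_def)
    have speed: "speed A g ?\<gamma> s \<le> sqrt C * norm (?b - ?a)" if s: "s \<in> {0..1}" for s
    proof -
      have "speed A g ?\<gamma> s = sqrt (g c (?\<gamma> s) (?b - ?a) (?b - ?a))"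
        by (rule speed_eq[OF M g c(1) s chart_segment_in_dom[OF ch seg s]
              eventually_in_dom[OF ch continuous_map_chart_segment[OF ch seg] s chart_segment_in_dom[OF ch seg s]]
              chart_segment_derivative[OF ch seg s]])
      also have "\<dots> \<le> sqrt (C * (norm (?b - ?a))\<^sup>2)"
        unfolding chart_segment_def
        using subsetD[OF seg in_closed_segment[OF s]] subsetD[OF seg1 in_closed_segment[OF s]]
        by (intro real_sqrt_le_mono C(3)) simp
      finally show ?thesis
        by (simp add: real_sqrt_mult)
    qed
    have "dist ?a ?b < 2 * r"
      using dist_triangle_half_r[of ?z0 ?a "2 * r" ?b] xy by (simp add: dist_commute)
    then have ab: "norm (?b - ?a) < 2 * r"
      by (simp add: dist_norm norm_minus_commute)
    have "curve_length A g ?\<gamma> \<le> sqrt C * norm (?b - ?a)"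
    proof (cases "speed A g ?\<gamma> integrable_on {0..1}")
      case True
      then have "integral {0..1} (speed A g ?\<gamma>) \<le> integral {0..1} (\<lambda>s::real. sqrt C * norm (?b - ?a))"
        by (rule integral_le) (auto intro: speed)
      then show ?thesis
        unfolding curve_length_def by simp
    next
      case False
      then show ?thesis
        unfolding curve_length_def using C(2) by (simp add: not_integrable_integral)
    qed
    also have "\<dots> \<le> (sqrt C + 1) * norm (?b - ?a)"
      by (simp add: algebra_simps)
    also have "\<dots> < (sqrt C + 1) * (2 * r)"
      using ab sC by (rule mult_strict_left_mono)
    finally have "curve_length A g ?\<gamma> < e"
      using re by simp
    then show ?thesis
      using riemannian_dist_le_curve_length[OF M g pw] ends by simp
  qed
  moreover have "openin X ?V"
    by (rule is_chart_open_preimage[OF ch]) simp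
  ultimately show ?thesis
    using c r(1) by (intro exI[of _ ?V]) auto
qed

section \<open>Leaves\<close>

lemma leaf_refl: "p \<in> leaf X A F p"
  by (simp add: leaf_def)

lemma leaf_trans: "\<lbrakk>q \<in> leaf X A F p; r \<in> leaf X A F q\<rbrakk> \<Longrightarrow> r \<in> leaf X A F p"
  unfolding leaf_def by simp

lemma leaf_sym:
  assumes "q \<in> leaf X A F p"
  shows "p \<in> leaf X A F q"
proof -
  have "symp (\<lambda>x y. \<exists>P. plaque X A F P \<and> x \<in> P \<and> y \<in> P)"
    by (auto simp: symp_def)
  then show ?thesis
    using assms unfolding leaf_def by (auto dest: symp_rtranclp sympD)
qed

lemma leaf_eq:
  assumes "q \<in> leaf X A F p"
  shows "leaf X A F q = leaf X A F p"
proof (intro subset_antisym subsetI)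
  show "r \<in> leaf X A F p" if "r \<in> leaf X A F q" for r
    using assms that by (rule leaf_trans)
  show "r \<in> leaf X A F q" if "r \<in> leaf X A F p" for r
    using leaf_sym[OF assms] that by (rule leaf_trans)
qed

lemma leaf_subset_topspace:
  assumes "p \<in> topspace X"
  shows "leaf X A F p \<subseteq> topspace X"
proof
  fix q assume "q \<in> leaf X A F p"
  then have "(\<lambda>x y. \<exists>P. plaque X A F P \<and> x \<in> P \<and> y \<in> P)\<^sup>*\<^sup>* p q"
    by (simp add: leaf_def)
  then show "q \<in> topspace X"
  proof (cases rule: rtranclp.cases)
    case (rtrancl_into_rtrancl r)
    then show ?thesis
      unfolding plaque_def using connected_components_of_subset by fastforce
  qed (use assms in simp)
qed

lemma connected_level_subset_leaf:
  assumes c: "foliated_chart A F c u" and K: "connectedin X K" "K \<subseteq> {q \<in> dom_of c. coord c q \<bullet> u = k}"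
    and xy: "x \<in> K" "y \<in> K"
  shows "y \<in> leaf X A F x"
proof -
  let ?Y = "subtopology X {q \<in> dom_of c. coord c q \<bullet> u = k}"
  have K': "connectedin ?Y K"
    using K by (simp add: connectedin_subtopology)
  then have "x \<in> topspace ?Y"
    using xy connectedin_subset_topspace by blast
  then obtain P where P: "P \<in> connected_components_of ?Y" "x \<in> P"
    using Union_connected_components_of[of ?Y] by blast
  have "K \<subseteq> P"
    by (rule connected_components_of_maximal[OF P(1) K']) (use P(2) xy(1) in \<open>auto simp: disjnt_def\<close>)
  moreover have "plaque X A F P"
    unfolding plaque_def using c P(1) by blast
  ultimately show ?thesis
    using xy unfolding leaf_def by blast
qed

text \<open>A curve whose velocity is tangent to the foliation has constant transverse coordinate in every
  foliated chart, so it stays locally in one plaque.  The tangency is required on a part \<open>[l, u]\<close> of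
  the segment, as segments are followed until they enter a set where the foliation is unknown.\<close>

lemma tangent_segment_subset_leaf:
  assumes M: "smooth_manifold X H A" and F: "foliation X A F" and c: "c \<in> A"
    and seg: "closed_segment a b \<subseteq> coord c ` dom_of c"
    and st: "0 \<le> l" "l \<le> u" "u \<le> 1"
    and tangent: "\<And>s. s \<in> {l..u} \<Longrightarrow> b - a \<in> F c (chart_segment c a b s)"
  shows "chart_segment c a b u \<in> leaf X A F (chart_segment c a b l)"
proof -
  note ch = smooth_manifold_chart[OF M c]
  let ?\<gamma> = "chart_segment c a b"
  define E where "E s s' \<longleftrightarrow> ?\<gamma> s' \<in> leaf X A F (?\<gamma> s)" for s s'
  have cont: "continuous_map (top_of_set {0..1}) X ?\<gamma>"
    by (rule continuous_map_chart_segment[OF ch seg])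
  have local: "\<exists>V. openin (top_of_set {l..u}) V \<and> s0 \<in> V \<and> (\<forall>s\<in>V. E s0 s)" if s0: "s0 \<in> {l..u}" for s0
  proof -
    have s01: "s0 \<in> {0..1}"
      using s0 st by auto
    have "?\<gamma> s0 \<in> topspace X"
      using chart_segment_in_dom[OF ch seg s01] openin_subset[OF is_chart_dom[OF ch]] by blast
    then obtain c' w where c': "?\<gamma> s0 \<in> dom_of c'" "foliated_chart A F c' w"
      using F unfolding foliation_def by blast
    then have c'A: "c' \<in> A"
      unfolding foliated_chart_def by blast
    have "openin (top_of_set {0..1}) {s \<in> topspace (top_of_set {0..1}). ?\<gamma> s \<in> dom_of c'}"
      by (rule openin_continuous_map_preimage[OF cont is_chart_dom[OF smooth_manifold_chart[OF M c'A]]])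
    then obtain T where T: "open T" "{s \<in> {0..1}. ?\<gamma> s \<in> dom_of c'} = {0..1} \<inter> T"
      by (auto simp: openin_open)
    then have "s0 \<in> T"
      using s01 c'(1) by blast
    then obtain e where e: "e > 0" "ball s0 e \<subseteq> T"
      using T(1) openE by blast
    define J where "J = {l..u} \<inter> ball s0 e"
    have J: "s \<in> {0..1}" "s \<in> {l..u}" "?\<gamma> s \<in> dom_of c'" if s: "s \<in> J" for s
    proof -
      show s1: "s \<in> {0..1}" "s \<in> {l..u}"
        using s st unfolding J_def by auto
      then have "s \<in> {0..1} \<inter> T"
        using s e(2) unfolding J_def by auto
      then show "?\<gamma> s \<in> dom_of c'"
        unfolding T(2)[symmetric] by simp
    qed
    have "convex J"
      unfolding J_def by (intro convex_Int convex_ball) simp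
    have "\<exists>k. \<forall>s\<in>J. coord c' (?\<gamma> s) \<bullet> w = k"
    proof (rule has_derivative_zero_constant[OF \<open>convex J\<close>])
      fix s assume s: "s \<in> J"
      note s1 = J[OF s]
      note d = chart_segment_in_dom[OF ch seg s1(1)]
      obtain D where D: "differential id c c' (?\<gamma> s) D"
        by (rule differential_exists[OF M c c'A d s1(3)])
      have "((coord c' \<circ> ?\<gamma>) has_vector_derivative D (b - a)) (at s within {0..1})"
        by (rule vector_derivative_change_chart[OF ch d s1(1) eventually_in_dom[OF ch cont s1(1) d]
              chart_segment_derivative[OF ch seg s1(1)] D])
      then have "((coord c' \<circ> ?\<gamma>) has_vector_derivative D (b - a)) (at s within J)"
        by (rule has_vector_derivative_within_subset) (use J(1) in blast)
      then have "((\<lambda>s. (coord c' \<circ> ?\<gamma>) s \<bullet> w) has_derivative (\<lambda>h. (h *\<^sub>R D (b - a)) \<bullet> w)) (at s within J)"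
        unfolding has_vector_derivative_def by (rule has_derivative_inner_left)
      moreover have "D (b - a) \<bullet> w = 0"
      proof -
        have "F c' (?\<gamma> s) = D ` F c (?\<gamma> s)"
          using F c c'A d s1(3) D unfolding foliation_def plane_field_def by blast
        moreover have "F c' (?\<gamma> s) = {v. v \<bullet> w = 0}"
          using c'(2) s1(3) unfolding foliated_chart_def by blast
        ultimately show ?thesis
          using tangent[OF s1(2)] by blast
      qed
      ultimately show "((\<lambda>s. coord c' (?\<gamma> s) \<bullet> w) has_derivative (\<lambda>h. 0)) (at s within J)"
        by simp
    qed
    then obtain k where k: "\<forall>s\<in>J. coord c' (?\<gamma> s) \<bullet> w = k"
      by blast
    have "connectedin (top_of_set {0..1}) J"
      using convex_connected[OF \<open>convex J\<close>] J(1) by (auto simp: connectedin_subtopology)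
    then have "connectedin X (?\<gamma> ` J)"
      by (rule connectedin_continuous_map_image[OF cont])
    moreover have "?\<gamma> ` J \<subseteq> {q \<in> dom_of c'. coord c' q \<bullet> w = k}"
      using k J(3) by blast
    moreover have "s0 \<in> J"
      using s0 e by (simp add: J_def)
    ultimately have "\<forall>s\<in>J. E s0 s"
      unfolding E_def using connected_level_subset_leaf[OF c'(2)] by blast
    then show ?thesis
      using \<open>s0 \<in> J\<close> unfolding J_def by (intro exI[of _ "{l..u} \<inter> ball s0 e"]) (auto intro: openin_open_Int)
  qed
  have "E l u"
  proof (rule connected_space_equivalence[where E = E and Y = "top_of_set {l..u}"])
    show "connected_space (top_of_set {l..u})"
      by (simp add: connected_space_subtopology connectedin_iff_connected)
    show "E y x" if "E x y" for x y
      using that unfolding E_def by (rule leaf_sym)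
    show "E x z" if "E x y" "E y z" for x y z
      using that unfolding E_def by (rule leaf_trans)
    show "\<exists>V. openin (top_of_set {l..u}) V \<and> x \<in> V \<and> (\<forall>y\<in>V. E x y)"
      if "x \<in> topspace (top_of_set {l..u})" for x
      using local[of x] that by simp
  qed (use st in auto)
  then show ?thesis
    unfolding E_def .
qed

section \<open>Pseudometrics vanishing along leaves\<close>

text \<open>The planes \<open>F\<close> and \<open>F'\<close> agree off \<open>N\<close>, so before the infimum \<open>s0\<close> of the times at which it is in
  \<open>N\<close>, the segment lies in one leaf of \<open>F'\<close>.  The point at time \<open>s0\<close> need not be in \<open>N\<close>, but it is a
  limit of points of \<open>N\<close>, and \<open>\<sigma>\<close> is small on small sets; so it is at distance \<open>0\<close> from \<open>N\<close>.\<close>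

lemma tangent_segment_meeting_open_set:
  assumes M: "smooth_manifold X H A" and F': "foliation X A F'"
    and N: "openin X N"
    and agree: "\<And>c p. \<lbrakk>c \<in> A; p \<in> dom_of c; p \<notin> N\<rbrakk> \<Longrightarrow> F c p = F' c p"
    and \<sigma>: "pseudometric_on (topspace X) \<sigma>"
    and small: "\<And>p e. \<lbrakk>p \<in> topspace X; e > 0\<rbrakk> \<Longrightarrow> \<exists>V. openin X V \<and> p \<in> V \<and> (\<forall>q\<in>V. \<sigma> p q < e)"
    and leaf0: "\<And>p q. \<lbrakk>p \<in> topspace X; q \<in> leaf X A F' p\<rbrakk> \<Longrightarrow> \<sigma> p q = 0"
    and N0: "\<And>p q. \<lbrakk>p \<in> N; q \<in> N\<rbrakk> \<Longrightarrow> \<sigma> p q = 0"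
    and c: "c \<in> A" and seg: "closed_segment a b \<subseteq> coord c ` dom_of c"
    and tangent: "\<And>s. s \<in> {0..1} \<Longrightarrow> b - a \<in> F c (chart_segment c a b s)"
    and hit: "s \<in> {0..1}" "chart_segment c a b s \<in> N" and n: "n \<in> N"
  shows "\<sigma> (param c a) n = 0"
proof -
  note ch = smooth_manifold_chart[OF M c]
  let ?\<gamma> = "chart_segment c a b"
  note pm = pseudometric_onD[OF \<sigma>]
  have cont: "continuous_map (top_of_set {0..1}) X ?\<gamma>"
    by (rule continuous_map_chart_segment[OF ch seg])
  have top: "?\<gamma> s \<in> topspace X" if "s \<in> {0..1}" for s
    using chart_segment_in_dom[OF ch seg that] openin_subset[OF is_chart_dom[OF ch]] by blast
  have nX: "n \<in> topspace X"
    using n openin_subset[OF N] by blast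
  \<comment> \<open>Before time \<open>s0\<close> the segment is outside \<open>N\<close>, and at times arbitrarily close to \<open>s0\<close> it is in \<open>N\<close>.\<close>
  define Q where "Q = {s \<in> {0..1}. ?\<gamma> s \<in> N}"
  define s0 where "s0 = Inf Q"
  have Q: "Q \<noteq> {}" "bdd_below Q"
    using hit by (auto simp: Q_def intro: bdd_belowI[of _ 0])
  have s0: "0 \<le> s0" "s0 \<le> 1"
    using cInf_greatest[OF Q(1), of 0] cInf_lower[OF _ Q(2), of s] hit
    by (auto simp: s0_def Q_def)
  have before: "?\<gamma> s \<notin> N" if "0 \<le> s" "s < s0" for s
    using cInf_lower[OF _ Q(2), of s] that s0 by (auto simp: s0_def Q_def)
  have start: "\<sigma> (?\<gamma> 0) (?\<gamma> s) = 0" if s: "0 \<le> s" "s = 0 \<or> s < s0" for s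
  proof (cases "s = 0")
    case True
    then show ?thesis
      using pm(1)[OF top[of 0]] by simp
  next
    case False
    have "?\<gamma> s \<in> leaf X A F' (?\<gamma> 0)"
    proof (rule tangent_segment_subset_leaf[OF M F' c seg])
      show "b - a \<in> F' c (?\<gamma> t)" if t: "t \<in> {0..s}" for t
      proof -
        have t1: "t \<in> {0..1}" and "?\<gamma> t \<notin> N"
          using t False s s0 before[of t] by auto
        then show ?thesis
          using tangent[OF t1] agree[OF c chart_segment_in_dom[OF ch seg t1]] by simp
      qed
    qed (use s s0 False in auto)
    then show ?thesis
      by (intro leaf0 top) auto
  qed
  have "\<sigma> (?\<gamma> 0) n \<le> e" if e: "e > 0" for e
  proof -
    obtain V where V: "openin X V" "?\<gamma> s0 \<in> V" "\<forall>q\<in>V. \<sigma> (?\<gamma> s0) q < e / 2"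
      using small[of "?\<gamma> s0" "e / 2"] top s0 e by auto
    have "openin (top_of_set {0..1}) {s \<in> topspace (top_of_set {0..1}). ?\<gamma> s \<in> V}"
      by (rule openin_continuous_map_preimage[OF cont V(1)])
    then obtain T where T: "open T" "{s \<in> {0..1}. ?\<gamma> s \<in> V} = {0..1} \<inter> T"
      by (auto simp: openin_open)
    then have "s0 \<in> T"
      using s0 V(2) by auto
    then obtain d where d: "d > 0" "ball s0 d \<subseteq> T"
      using T(1) openE by blast
    have near: "\<sigma> (?\<gamma> s0) (?\<gamma> s) < e / 2" if "s \<in> {0..1}" "\<bar>s - s0\<bar> < d" for s
    proof -
      have "s \<in> {0..1} \<inter> T"
        using that d(2) by (auto simp: dist_real_def abs_minus_commute)
      then show ?thesis
        using T(2) V(3) by blast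
    qed
    \<comment> \<open>A time \<open>s'\<close> just before \<open>s0\<close>, reached inside one leaf of \<open>F'\<close>, and a time \<open>s''\<close> at or just after it,
      in \<open>N\<close>; if \<open>s0 = 0\<close> then \<open>s'\<close> is the start itself.\<close>
    define s' where "s' = max 0 (s0 - d / 2)"
    have s': "s' \<in> {0..1}" "\<bar>s' - s0\<bar> < d" "s' = 0 \<or> s' < s0"
      using s0 d(1) by (auto simp: s'_def)
    obtain s'' where s'': "s'' \<in> Q" "s'' < s0 + d"
      using cInf_lessD[OF Q(1), of "s0 + d"] d(1) by (auto simp: s0_def)
    have "s0 \<le> s''"
      unfolding s0_def by (rule cInf_lower[OF s''(1) Q(2)])
    then have s''2: "s'' \<in> {0..1}" "\<bar>s'' - s0\<bar> < d" "?\<gamma> s'' \<in> N"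
      using s'' by (auto simp: Q_def)
    have t: "?\<gamma> 0 \<in> topspace X" "?\<gamma> s' \<in> topspace X" "?\<gamma> s0 \<in> topspace X" "?\<gamma> s'' \<in> topspace X"
      using top s' s0 s''2 by auto
    have "\<sigma> (?\<gamma> 0) n \<le> \<sigma> (?\<gamma> 0) (?\<gamma> s') + \<sigma> (?\<gamma> s') n"
      by (rule pm(4)) (use t nX in auto)
    also have "\<sigma> (?\<gamma> s') n \<le> \<sigma> (?\<gamma> s') (?\<gamma> s0) + \<sigma> (?\<gamma> s0) n"
      by (rule pm(4)) (use t nX in auto)
    also have "\<sigma> (?\<gamma> s0) n \<le> \<sigma> (?\<gamma> s0) (?\<gamma> s'') + \<sigma> (?\<gamma> s'') n"
      by (rule pm(4)) (use t nX in auto)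
    also have "\<sigma> (?\<gamma> s'') n = 0"
      by (rule N0[OF s''2(3) n])
    also have "\<sigma> (?\<gamma> s') (?\<gamma> s0) = \<sigma> (?\<gamma> s0) (?\<gamma> s')"
      by (rule pm(3)) (use t in auto)
    finally show ?thesis
      using start[of s'] s' near[OF s'(1,2)] near[OF s''2(1,2)] by simp
  qed
  then have "\<sigma> (?\<gamma> 0) n \<le> 0"
    by (rule field_le_epsilon[of _ 0, simplified])
  moreover have "?\<gamma> 0 = param c a"
    by (simp add: chart_segment_def)
  ultimately show ?thesis
    using pm(2)[OF top[of 0] nX] by simp
qed

text \<open>Vanishing along the leaves of \<open>F'\<close> and on \<open>N\<close> implies vanishing along the leaves of \<open>F\<close>.  On a
  plaque of \<open>F\<close>, being at distance \<open>0\<close> is a locally constant relation: nearby points of the plaque are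
  joined by a coordinate segment tangent to \<open>F\<close>, which either avoids \<open>N\<close> or connects both of its end
  points to \<open>N\<close>.  The lemma is applied twice, with the roles of the two foliations exchanged.\<close>

lemma pseudometric_zero_on_leaves:
  assumes M: "smooth_manifold X H A" and H: "convex H" and F': "foliation X A F'"
    and N: "openin X N"
    and agree: "\<And>c p. \<lbrakk>c \<in> A; p \<in> dom_of c; p \<notin> N\<rbrakk> \<Longrightarrow> F c p = F' c p"
    and \<sigma>: "pseudometric_on (topspace X) \<sigma>"
    and small: "\<And>p e. \<lbrakk>p \<in> topspace X; e > 0\<rbrakk> \<Longrightarrow> \<exists>V. openin X V \<and> p \<in> V \<and> (\<forall>q\<in>V. \<sigma> p q < e)"
    and leaf0: "\<And>p q. \<lbrakk>p \<in> topspace X; q \<in> leaf X A F' p\<rbrakk> \<Longrightarrow> \<sigma> p q = 0"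
    and N0: "\<And>p q. \<lbrakk>p \<in> N; q \<in> N\<rbrakk> \<Longrightarrow> \<sigma> p q = 0"
    and p: "p \<in> topspace X" and q: "q \<in> leaf X A F p"
  shows "\<sigma> p q = 0"
proof -
  note pm = pseudometric_onD[OF \<sigma>]
  have segment: "\<sigma> (param c a) (param c b) = 0"
    if c: "c \<in> A" and seg: "closed_segment a b \<subseteq> coord c ` dom_of c"
      and level: "\<And>q. q \<in> dom_of c \<Longrightarrow> F c q = {v. v \<bullet> w = 0}" and ab: "(b - a) \<bullet> w = 0"
    for c a b w
  proof -
    note ch = smooth_manifold_chart[OF M c]
    have seg': "closed_segment b a \<subseteq> coord c ` dom_of c"
      using seg by (simp add: closed_segment_commute)
    have tangent: "b - a \<in> F c (chart_segment c a b s)" if "s \<in> {0..1}" for s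
      using level[OF chart_segment_in_dom[OF ch seg that]] ab by simp
    have tangent': "a - b \<in> F c (chart_segment c b a s)" if "s \<in> {0..1}" for s
      using level[OF chart_segment_in_dom[OF ch seg' that]] ab by (simp add: inner_diff_left)
    have ends: "chart_segment c a b 0 = param c a" "chart_segment c a b 1 = param c b"
      by (simp_all add: chart_segment_def)
    have "a \<in> coord c ` dom_of c" "b \<in> coord c ` dom_of c"
      using seg by auto
    then have ab_top: "param c a \<in> topspace X" "param c b \<in> topspace X"
      using param_in_dom[of a c] param_in_dom[of b c] openin_subset[OF is_chart_dom[OF ch]] by blast+
    show ?thesis
    proof (cases "\<exists>s\<in>{0..1}. chart_segment c a b s \<in> N")
      case False
      have "chart_segment c a b 1 \<in> leaf X A F' (chart_segment c a b 0)"
        by (rule tangent_segment_subset_leaf[OF M F' c seg])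
          (use tangent agree[OF c chart_segment_in_dom[OF ch seg]] False in auto)
      then show ?thesis
        unfolding ends by (intro leaf0 ab_top)
    next
      case True
      then obtain s where s: "s \<in> {0..1}" "chart_segment c a b s \<in> N"
        by blast
      then have s': "1 - s \<in> {0..1}" "chart_segment c b a (1 - s) \<in> N"
        by (simp_all add: chart_segment_def algebra_simps)
      have "\<sigma> (param c a) (chart_segment c a b s) = 0"
        by (rule tangent_segment_meeting_open_set[OF M F' N agree \<sigma> small leaf0 N0 c seg tangent s s(2)])
      moreover have "\<sigma> (param c b) (chart_segment c a b s) = 0"
        by (rule tangent_segment_meeting_open_set[OF M F' N agree \<sigma> small leaf0 N0 c seg' tangent' s' s(2)])
      moreover have "chart_segment c a b s \<in> topspace X"
        using s(2) openin_subset[OF N] by blast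
      ultimately show ?thesis
        using pseudometric_on_zero_trans[OF \<sigma> ab_top(1) _ ab_top(2)] pm(3) ab_top by simp
    qed
  qed
  have plaque: "\<sigma> x y = 0" if P: "plaque X A F P" and xy: "x \<in> P" "y \<in> P" for P x y
  proof -
    obtain c w k where c: "foliated_chart A F c w"
      and PK: "P \<in> connected_components_of (subtopology X {q \<in> dom_of c. coord c q \<bullet> w = k})"
      using P unfolding plaque_def by blast
    have cA: "c \<in> A" and level: "\<And>q. q \<in> dom_of c \<Longrightarrow> F c q = {v. v \<bullet> w = 0}"
      using c unfolding foliated_chart_def by auto
    note ch = smooth_manifold_chart[OF M cA]
    have "connectedin X P"
      using connectedin_connected_components_of[OF PK] by (simp add: connectedin_subtopology)
    then have conn: "connected_space (subtopology X P)" and PX: "P \<subseteq> topspace X"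
      by (auto simp: connectedin_def)
    have Pk: "P \<subseteq> {q \<in> dom_of c. coord c q \<bullet> w = k}"
      using connected_components_of_subset[OF PK] by auto
    have tP: "topspace (subtopology X P) = P"
      using PX by auto
    show ?thesis
    proof (rule connected_space_equivalence[where E = "\<lambda>x y. \<sigma> x y = 0", OF conn])
      show "\<sigma> y x = 0" if "x \<in> topspace (subtopology X P)" "y \<in> topspace (subtopology X P)" "\<sigma> x y = 0" for x y
        using that pm(3)[of x y] PX tP by auto
      show "\<sigma> x z = 0" if "x \<in> topspace (subtopology X P)" "y \<in> topspace (subtopology X P)"
        "z \<in> topspace (subtopology X P)" "\<sigma> x y = 0" "\<sigma> y z = 0" for x y z
        using pseudometric_on_zero_trans[OF \<sigma> _ _ _ that(4,5)] that(1-3) PX tP by blast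
      show "\<exists>V. openin (subtopology X P) V \<and> x \<in> V \<and> (\<forall>y\<in>V. \<sigma> x y = 0)"
        if "x \<in> topspace (subtopology X P)" for x
      proof -
        have xP: "x \<in> P" "x \<in> dom_of c" "x \<in> topspace X"
          using that tP Pk PX by auto
        obtain r where r: "r > 0" "ball (coord c x) r \<inter> H \<subseteq> coord c ` (dom_of c \<inter> topspace X)"
          by (rule is_chart_ball[OF ch xP(2) openin_topspace xP(3)])
        let ?V = "{y \<in> dom_of c. coord c y \<in> ball (coord c x) r}"
        have "openin X ?V"
          by (rule is_chart_open_preimage[OF ch]) simp
        then have "openin (subtopology X P) (P \<inter> ?V)"
          by (rule openin_subtopology_Int2)
        moreover have "\<sigma> x y = 0" if y: "y \<in> P \<inter> ?V" for y
        proof -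
          have "convex (ball (coord c x) r \<inter> H)"
            using H by (intro convex_Int convex_ball)
          moreover have "coord c x \<in> ball (coord c x) r \<inter> H" "coord c y \<in> ball (coord c x) r \<inter> H"
            using r(1) y xP is_chart_image_subset[OF ch] by auto
          ultimately have "closed_segment (coord c x) (coord c y) \<subseteq> ball (coord c x) r \<inter> H"
            by (intro closed_segment_subset)
          then have seg: "closed_segment (coord c x) (coord c y) \<subseteq> coord c ` dom_of c"
            using r(2) by blast
          have "coord c x \<bullet> w = k" "coord c y \<bullet> w = k"
            using xP(1) y Pk by auto
          then have "(coord c y - coord c x) \<bullet> w = 0"
            by (simp add: inner_diff_left)
          then have "\<sigma> (param c (coord c x)) (param c (coord c y)) = 0"
            by (intro segment[OF cA seg, of w] level)
          then show ?thesis
            using param_coord[OF ch xP(2)] param_coord[OF ch, of y] y by simp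
        qed
        ultimately show ?thesis
          using xP r(1) by (intro exI[of _ "P \<inter> ?V"]) auto
      qed
    qed (use xy tP in auto)
  qed
  have "(\<lambda>x y. \<exists>P. plaque X A F P \<and> x \<in> P \<and> y \<in> P)\<^sup>*\<^sup>* p q"
    using q by (simp add: leaf_def)
  then show ?thesis
  proof (induction rule: rtranclp_induct)
    case base
    then show ?case
      using pm(1)[OF p] .
  next
    case (step y z)
    then have "\<sigma> y z = 0"
      using plaque by blast
    moreover have "y \<in> leaf X A F p" "z \<in> leaf X A F p"
      using step.hyps rtranclp.rtrancl_into_rtrancl[OF step.hyps] by (simp_all add: leaf_def)
    then have "y \<in> topspace X" "z \<in> topspace X"
      using leaf_subset_topspace[OF p] by blast+
    ultimately show ?case
      using pseudometric_on_zero_trans[OF \<sigma> p] step.IH by blast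
  qed
qed

section \<open>Compactness of the boundary component\<close>

lemma continuous_on_transition:
  assumes c: "is_chart X H c" and c': "is_chart X H' c'"
    and W: "\<And>z. z \<in> W \<Longrightarrow> z \<in> coord c ` dom_of c \<and> param c z \<in> dom_of c'"
  shows "continuous_on W (\<lambda>z. coord c' (param c z))"
proof -
  have "continuous_map (top_of_set W) X (\<lambda>z. param c (id z))"
    by (rule continuous_map_param[OF c]) (use W in \<open>auto intro: continuous_on_id\<close>)
  then have "continuous_map (top_of_set W) (subtopology X (dom_of c')) (\<lambda>z. param c z)"
    using W by (auto simp: continuous_map_in_subtopology)
  moreover have "continuous_map (subtopology X (dom_of c')) (top_of_set (coord c' ` dom_of c')) (coord c')"
    using c' homeomorphic_imp_continuous_map unfolding is_chart_def by blast
  ultimately have "continuous_map (top_of_set W) (top_of_set (coord c' ` dom_of c')) (coord c' \<circ> param c)"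
    by (rule continuous_map_compose)
  then show ?thesis
    by (simp add: continuous_map_in_subtopology o_def)
qed

text \<open>The change of coordinates maps an open neighbourhood of \<open>coord c p\<close> injectively into the half
  space; by invariance of domain the image is open in the full space, so it contains no boundary
  point of the half space.\<close>

lemma interior_point_chart_invariant:
  fixes A :: "('m, 'e::euclidean_space \<times> real) chart set"
  assumes M: "smooth_manifold X half_space A" and c: "c \<in> A" "p \<in> dom_of c" and c': "c' \<in> A" "p \<in> dom_of c'"
    and pos: "snd (coord c p) > 0"
  shows "snd (coord c' p) > 0"
proof -
  note ch = smooth_manifold_chart[OF M c(1)] and ch' = smooth_manifold_chart[OF M c'(1)]
  let ?f = "\<lambda>z. coord c' (param c z)"
  obtain O' where O': "open O'" "coord c ` (dom_of c \<inter> dom_of c') = half_space \<inter> O'"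
    using is_chart_open_image[OF ch is_chart_dom[OF ch']] by (auto simp: openin_open)
  \<comment> \<open>The intersection with the open upper half space is open in the full space.\<close>
  define W where "W = O' \<inter> {z. 0 < snd z}"
  have "open {z :: 'e \<times> real. 0 < snd z}"
    by (intro open_Collect_less continuous_intros)
  then have "open W"
    unfolding W_def using O'(1) by (rule open_Int[rotated])
  have "W \<subseteq> half_space \<inter> O'"
    by (auto simp: W_def half_space_def)
  then have WB: "W \<subseteq> coord c ` (dom_of c \<inter> dom_of c')"
    using O'(2) by simp
  have W: "z \<in> coord c ` dom_of c \<and> param c z \<in> dom_of c'" if "z \<in> W" for z
    using subsetD[OF WB that] param_coord[OF ch] by auto
  have "open (?f ` W)"
  proof (rule invariance_of_domain)
    show "continuous_on W ?f"
      by (rule continuous_on_transition[OF ch ch' W])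
    show "inj_on ?f W"
    proof (rule inj_onI)
      fix z z' assume z: "z \<in> W" "z' \<in> W" "?f z = ?f z'"
      then have "param c z = param c z'"
        using inj_onD[OF is_chart_inj[OF ch'] z(3)] W by blast
      then show "z = z'"
        using coord_param[of z c] coord_param[of z' c] W z(1,2) by metis
    qed
  qed (rule \<open>open W\<close>)
  moreover have "coord c p \<in> coord c ` (dom_of c \<inter> dom_of c')"
    using c c' by blast
  then have "coord c p \<in> W"
    using O'(2) pos by (auto simp: W_def)
  then have "coord c' p \<in> ?f ` W"
    using param_coord[OF ch c(2)] by (intro image_eqI[of _ _ "coord c p"]) auto
  ultimately obtain e where e: "e > 0" "ball (coord c' p) e \<subseteq> ?f ` W"
    using openE by blast
  have "coord c' p - (0, e / 2) \<in> ball (coord c' p) e"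
    using e(1) by (simp add: dist_norm norm_Pair)
  then obtain z where z: "z \<in> W" "coord c' p - (0, e / 2) = ?f z"
    using subsetD[OF e(2)] by blast
  have "?f z \<in> coord c' ` dom_of c'"
    using W[OF z(1)] by blast
  then have "coord c' p - (0, e / 2) \<in> half_space"
    unfolding z(2) using is_chart_image_subset[OF ch'] by (rule subsetD[rotated])
  then show ?thesis
    using e(1) by (simp add: half_space_def)
qed

lemma closedin_manifold_boundary:
  fixes A :: "('m, 'e::euclidean_space \<times> real) chart set"
  assumes M: "smooth_manifold X half_space A"
  shows "closedin X (manifold_boundary A)"
  unfolding closedin_def
proof
  show "manifold_boundary A \<subseteq> topspace X"
    using openin_subset[OF is_chart_dom[OF smooth_manifold_chart[OF M]]]
    by (auto simp: manifold_boundary_def)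
  have "\<exists>V. openin X V \<and> p \<in> V \<and> V \<subseteq> topspace X - manifold_boundary A"
    if p: "p \<in> topspace X - manifold_boundary A" for p
  proof -
    obtain c where c: "c \<in> A" "p \<in> dom_of c"
      using smooth_manifold_cover[OF M, of p] p by blast
    note ch = smooth_manifold_chart[OF M c(1)]
    let ?V = "{q \<in> dom_of c. coord c q \<in> {z. 0 < snd z}}"
    have "open {z :: 'e \<times> real. 0 < snd z}"
      by (intro open_Collect_less continuous_intros)
    then have V: "openin X ?V"
      by (rule is_chart_open_preimage[OF ch])
    have "coord c p \<in> half_space" "snd (coord c p) \<noteq> 0"
      using c p is_chart_image_subset[OF ch] by (auto simp: manifold_boundary_def)
    then have "p \<in> ?V"
      using c by (auto simp: half_space_def)
    moreover have "q \<notin> manifold_boundary A" if q: "q \<in> ?V" for q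
    proof
      assume "q \<in> manifold_boundary A"
      then obtain c' where c': "c' \<in> A" "q \<in> dom_of c'" "snd (coord c' q) = 0"
        unfolding manifold_boundary_def by blast
      have "snd (coord c' q) > 0"
        by (rule interior_point_chart_invariant[OF M c(1) _ c'(1,2)]) (use q in auto)
      then show False
        using c'(3) by simp
    qed
    ultimately show ?thesis
      using V openin_subset[OF V] by (intro exI[of _ ?V]) auto
  qed
  then show "openin X (topspace X - manifold_boundary A)"
    by (subst openin_subopen) blast
qed

text \<open>The boundary is closed since the interior is open, and components are closed in the boundary.\<close>

lemma compactin_boundary_component:
  fixes A :: "('m, 'e::euclidean_space \<times> real) chart set"
  assumes M: "smooth_manifold X half_space A" and X: "compact_space X"
    and S: "S \<in> connected_components_of (subtopology X (manifold_boundary A))"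
  shows "compactin X S"
proof -
  have "closedin (subtopology X (manifold_boundary A)) S"
    by (rule closedin_connected_components_of[OF S])
  then have "closedin X S"
    using closedin_manifold_boundary[OF M] closedin_trans_full by blast
  then show ?thesis
    by (rule closedin_compact_space[OF X])
qed

lemma compact_space_uniform:
  fixes P :: "'m \<Rightarrow> real \<Rightarrow> bool"
  assumes Y: "compact_space Y"
    and loc: "\<And>x. x \<in> topspace Y \<Longrightarrow>
      \<exists>V \<eta>. openin Y V \<and> x \<in> V \<and> \<eta> > 0 \<and> (\<forall>x'\<in>V. \<forall>t. \<bar>t - t0\<bar> < \<eta> \<longrightarrow> P x' t)"
  shows "\<exists>\<eta>>0. \<forall>x\<in>topspace Y. \<forall>t. \<bar>t - t0\<bar> < \<eta> \<longrightarrow> P x t"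
proof -
  obtain V \<eta> where V: "\<And>x. x \<in> topspace Y \<Longrightarrow> openin Y (V x) \<and> x \<in> V x \<and> \<eta> x > 0 \<and>
      (\<forall>x'\<in>V x. \<forall>t. \<bar>t - t0\<bar> < \<eta> x \<longrightarrow> P x' t)"
    using loc by metis
  have "(\<forall>U\<in>V ` topspace Y. openin Y U) \<and> topspace Y \<subseteq> \<Union>(V ` topspace Y)"
    using V by fast
  then obtain \<F> where "finite \<F>" "\<F> \<subseteq> V ` topspace Y" "topspace Y \<subseteq> \<Union>\<F>"
    using Y[unfolded compact_space_alt, rule_format, of "V ` topspace Y"] by auto
  then obtain I where I: "finite I" "I \<subseteq> topspace Y" "topspace Y \<subseteq> (\<Union>x\<in>I. V x)"
    by (metis finite_subset_image)
  define e where "e = Min (insert 1 (\<eta> ` I))"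
  have "e > 0"
    unfolding e_def using I V by (subst Min_gr_iff) auto
  moreover have "P x t" if x: "x \<in> topspace Y" and t: "\<bar>t - t0\<bar> < e" for x t
  proof -
    obtain y where y: "y \<in> I" "x \<in> V y"
      using I(3) x by blast
    have "e \<le> \<eta> y"
      unfolding e_def using I(1) y(1) by (intro Min_le) auto
    then show ?thesis
      using V[of y] I(2) y t by auto
  qed
  ultimately show ?thesis
    by blast
qed

section \<open>Levels of a function near a point\<close>

text \<open>The derivative of \<open>f\<close> at \<open>z0\<close> in the direction \<open>(v, 0)\<close> is not \<open>0\<close>, so \<open>f\<close> takes values on both sides
  of \<open>f z0\<close> at the height \<open>snd z0\<close>, and by continuity also at a slightly smaller height.  The
  intermediate value theorem at that smaller height yields all values near \<open>f z0\<close>.\<close>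

lemma level_point_below:
  fixes f :: "'e::euclidean_space \<times> real \<Rightarrow> real"
  assumes \<delta>: "\<delta> > 0" and cont: "continuous_on (ball z0 \<delta>) f"
    and deriv: "((\<lambda>s. f (z0 + s *\<^sub>R (v, 0))) has_real_derivative k) (at 0)" and k: "k \<noteq> 0"
  shows "\<exists>\<eta>>0. \<forall>y\<in>ball z0 \<eta>. \<exists>y'\<in>ball z0 \<delta>. f y' = f y \<and> snd y' < snd z0"
proof -
  let ?\<psi> = "\<lambda>s. f (z0 + s *\<^sub>R (v, 0))"
  \<comment> \<open>The parameters in \<open>(-b, b)\<close> keep the line within half of the ball; the summand 1 allows \<open>v = 0\<close>.\<close>
  define b where "b = \<delta> / (2 * (norm v + 1))"
  have nv: "norm v + 1 > 0"
    by (simp add: add_nonneg_pos)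
  have b: "b > 0"
    unfolding b_def using \<delta> nv by simp
  have bv: "\<bar>s\<bar> * norm v < \<delta> / 2" if "\<bar>s\<bar> < b" for s
  proof -
    have "\<bar>s\<bar> * norm v \<le> \<bar>s\<bar> * (norm v + 1)"
      by (simp add: algebra_simps)
    also have "\<dots> < b * (norm v + 1)"
      using that nv by (rule mult_strict_right_mono)
    also have "\<dots> = \<delta> / 2"
      unfolding b_def using nv by (simp add: field_simps)
    finally show ?thesis .
  qed
  have "\<exists>s1 s2. \<bar>s1\<bar> < b \<and> \<bar>s2\<bar> < b \<and> ?\<psi> s1 < ?\<psi> 0 \<and> ?\<psi> 0 < ?\<psi> s2"
  proof (cases "k > 0")
    case True
    obtain d1 where d1: "d1 > 0" "\<And>h. \<lbrakk>0 < h; h < d1\<rbrakk> \<Longrightarrow> ?\<psi> 0 < ?\<psi> (0 + h)"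
      using DERIV_pos_inc_right[OF deriv True] by blast
    obtain d2 where d2: "d2 > 0" "\<And>h. \<lbrakk>0 < h; h < d2\<rbrakk> \<Longrightarrow> ?\<psi> (0 - h) < ?\<psi> 0"
      using DERIV_pos_inc_left[OF deriv True] by blast
    define h where "h = Min {d1, d2, b} / 2"
    have "0 < h" "h < d1" "h < d2" "h < b"
      using d1(1) d2(1) b by (auto simp: h_def min_def)
    then show ?thesis
      using d1(2)[of h] d2(2)[of h] by (intro exI[of _ "- h"] exI[of _ h]) auto
  next
    case False
    then have neg: "k < 0"
      using k by simp
    obtain d1 where d1: "d1 > 0" "\<And>h. \<lbrakk>0 < h; h < d1\<rbrakk> \<Longrightarrow> ?\<psi> (0 + h) < ?\<psi> 0"
      using DERIV_neg_dec_right[OF deriv neg] by blast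
    obtain d2 where d2: "d2 > 0" "\<And>h. \<lbrakk>0 < h; h < d2\<rbrakk> \<Longrightarrow> ?\<psi> 0 < ?\<psi> (0 - h)"
      using DERIV_neg_dec_left[OF deriv neg] by blast
    define h where "h = Min {d1, d2, b} / 2"
    have "0 < h" "h < d1" "h < d2" "h < b"
      using d1(1) d2(1) b by (auto simp: h_def min_def)
    then show ?thesis
      using d1(2)[of h] d2(2)[of h] by (intro exI[of _ h] exI[of _ "- h"]) auto
  qed
  moreover have \<psi>0: "?\<psi> 0 = f z0"
    by (simp add: zero_prod_def[symmetric])
  ultimately obtain s1 s2 where s: "\<bar>s1\<bar> < b" "\<bar>s2\<bar> < b" "?\<psi> s1 < f z0" "f z0 < ?\<psi> s2"
    unfolding \<psi>0 by blast
  \<comment> \<open>The points at parameter \<open>s\<close> on the line through \<open>z0\<close>, lowered by \<open>\<epsilon>\<close>.\<close>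
  define q where "q s \<epsilon> = z0 + s *\<^sub>R (v, 0) - (0, \<epsilon>)" for s \<epsilon> :: real
  have q: "q s \<epsilon> \<in> ball z0 \<delta>" if "\<bar>s\<bar> < b" "0 \<le> \<epsilon>" "\<epsilon> < \<delta> / 2" for s \<epsilon>
  proof -
    have "dist z0 (q s \<epsilon>) = norm (s *\<^sub>R v, - \<epsilon>)"
      unfolding q_def dist_norm norm_minus_commute[of z0] by (simp add: norm_Pair)
    also have "\<dots> \<le> norm (s *\<^sub>R v) + norm (- \<epsilon>)"
      by (rule norm_Pair_le)
    also have "\<dots> < \<delta>"
      using bv[OF that(1)] that(2,3) by simp
    finally show ?thesis
      by simp
  qed
  have tendsto: "((\<lambda>\<epsilon>. f (q s \<epsilon>)) \<longlongrightarrow> f (q s 0)) (at_right 0)" if "\<bar>s\<bar> < b" for s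
  proof -
    have "isCont f (q s 0)"
      using cont q[OF that, of 0] \<delta> by (simp add: continuous_on_eq_continuous_at)
    moreover have "((\<lambda>\<epsilon>. q s \<epsilon>) \<longlongrightarrow> q s 0) (at_right 0)"
      unfolding q_def by (intro tendsto_intros)
    ultimately show ?thesis
      by (rule isCont_tendsto_compose)
  qed
  have "eventually (\<lambda>\<epsilon>. f (q s1 \<epsilon>) < f z0) (at_right 0)"
    by (rule order_tendstoD(2)[OF tendsto[OF s(1)]]) (use s(3) in \<open>simp add: q_def zero_prod_def[symmetric]\<close>)
  moreover have "eventually (\<lambda>\<epsilon>. f z0 < f (q s2 \<epsilon>)) (at_right 0)"
    by (rule order_tendstoD(1)[OF tendsto[OF s(2)]]) (use s(4) in \<open>simp add: q_def zero_prod_def[symmetric]\<close>)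
  moreover have "eventually (\<lambda>\<epsilon>::real. 0 < \<epsilon> \<and> \<epsilon> < \<delta> / 2) (at_right 0)"
    unfolding eventually_at_right_field using \<delta> by (intro exI[of _ "\<delta> / 2"]) auto
  ultimately have "eventually (\<lambda>\<epsilon>. f (q s1 \<epsilon>) < f z0 \<and> f z0 < f (q s2 \<epsilon>) \<and> 0 < \<epsilon> \<and> \<epsilon> < \<delta> / 2) (at_right 0)"
    by eventually_elim auto
  then obtain \<epsilon> where \<epsilon>: "f (q s1 \<epsilon>) < f z0" "f z0 < f (q s2 \<epsilon>)" "0 < \<epsilon>" "\<epsilon> < \<delta> / 2"
    using eventually_happens'[OF trivial_limit_at_right_real] by blast
  let ?K = "ball z0 \<delta> \<inter> {z. snd z = snd z0 - \<epsilon>}"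
  have "{z :: 'e \<times> real. snd z = snd z0 - \<epsilon>} = UNIV \<times> {snd z0 - \<epsilon>}"
    by auto
  then have "convex {z :: 'e \<times> real. snd z = snd z0 - \<epsilon>}"
    by (simp add: convex_Times)
  then have "connected ?K"
    by (intro convex_connected convex_Int convex_ball)
  then have conn: "connected (f ` ?K)"
    by (rule connected_continuous_image[rotated]) (rule continuous_on_subset[OF cont], blast)
  have qK: "q s1 \<epsilon> \<in> ?K" "q s2 \<epsilon> \<in> ?K"
    using q s(1,2) \<epsilon>(3,4) by (auto simp: q_def)
  have "isCont f z0"
    using cont \<delta> by (simp add: continuous_on_eq_continuous_at)
  then have "(f \<longlongrightarrow> f z0) (nhds z0)"
    by (simp add: isCont_def tendsto_at_iff_tendsto_nhds)
  then have "eventually (\<lambda>y. f (q s1 \<epsilon>) < f y \<and> f y < f (q s2 \<epsilon>)) (nhds z0)"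
    using \<epsilon>(1,2) by (intro eventually_conj order_tendstoD)
  then obtain \<eta> where \<eta>: "\<eta> > 0" "\<And>y. dist y z0 < \<eta> \<Longrightarrow> f (q s1 \<epsilon>) < f y \<and> f y < f (q s2 \<epsilon>)"
    unfolding eventually_nhds_metric by blast
  have "\<exists>y'\<in>ball z0 \<delta>. f y' = f y \<and> snd y' < snd z0" if y: "y \<in> ball z0 \<eta>" for y
  proof -
    have "f (q s1 \<epsilon>) \<le> f y" "f y \<le> f (q s2 \<epsilon>)"
      using \<eta>(2)[of y] y by (auto simp: dist_commute)
    then have "f y \<in> f ` ?K"
      by (rule connectedD_interval[OF conn imageI[OF qK(1)] imageI[OF qK(2)]])
    then obtain y' where "y' \<in> ?K" "f y' = f y"
      by auto
    then show ?thesis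
      using \<epsilon>(3) by auto
  qed
  then show ?thesis
    using \<eta>(1) by blast
qed

text \<open>The straight line in the direction \<open>v\<close> is followed from \<open>c\<close> to \<open>c'\<close> and back; uniqueness of its
  velocity shows that the two differentials are inverse to each other.\<close>

lemma line_derivative:
  assumes M: "smooth_manifold X H A" and c: "c \<in> A" and c': "c' \<in> A"
    and p: "p \<in> dom_of c" "p \<in> dom_of c'"
    and e: "e > 0" "ball (coord c p) e \<subseteq> coord c ` dom_of c"
    and D: "differential id c c' p D"
  shows "((\<lambda>s. coord c' (param c (coord c p + s *\<^sub>R v))) has_vector_derivative D v) (at 0)"
    and "differential id c' c p D' \<Longrightarrow> D' (D v) = v"
proof -
  note ch = smooth_manifold_chart[OF M c] and ch' = smooth_manifold_chart[OF M c']
  let ?z = "coord c p"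
  define \<gamma> where "\<gamma> s = param c (?z + s *\<^sub>R v)" for s
  define I where "I = ball (0::real) (e / (norm v + 1))"
  have nv: "norm v + 1 > 0"
    by (simp add: add_nonneg_pos)
  have I: "open I" "0 \<in> I"
    using e(1) nv by (auto simp: I_def)
  have at: "at 0 within I = at 0"
    by (rule at_within_open[OF I(2,1)])
  have inI: "?z + s *\<^sub>R v \<in> ball ?z e" if "s \<in> I" for s
  proof -
    have "\<bar>s\<bar> * norm v \<le> \<bar>s\<bar> * (norm v + 1)"
      by (simp add: algebra_simps)
    also have "\<dots> < e"
      using that nv by (simp add: I_def field_simps)
    finally show ?thesis
      by (simp add: dist_norm)
  qed
  have \<gamma>0: "\<gamma> 0 = p"
    by (simp add: \<gamma>_def param_coord[OF ch p(1)])
  have cont: "continuous_map (top_of_set I) X \<gamma>"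
    unfolding \<gamma>_def
  proof (rule continuous_map_param[OF ch])
    show "continuous_on I (\<lambda>s. ?z + s *\<^sub>R v)"
      by (intro continuous_intros)
    show "(\<lambda>s. ?z + s *\<^sub>R v) ` I \<subseteq> coord c ` dom_of c"
      using subsetD[OF e(2) inI] by auto
  qed
  have "((\<lambda>s. ?z + s *\<^sub>R v) has_vector_derivative v) (at 0 within I)"
    unfolding has_vector_derivative_def add.commute[of ?z]
    by (intro has_derivative_add_const bounded_linear_imp_has_derivative bounded_linear_scaleR_left)
  then have 1: "((coord c \<circ> \<gamma>) has_vector_derivative v) (at 0 within I)"
    by (rule has_vector_derivative_transform[OF I(2), rotated])
      (use coord_param[OF subsetD[OF e(2) inI]] in \<open>auto simp: \<gamma>_def\<close>)
  have ev: "eventually (\<lambda>s. \<gamma> s \<in> dom_of c) (at 0 within I)" "eventually (\<lambda>s. \<gamma> s \<in> dom_of c') (at 0 within I)"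
    by (rule eventually_in_dom[OF ch cont I(2)], use \<gamma>0 p in simp,
        rule eventually_in_dom[OF ch' cont I(2)], use \<gamma>0 p in simp)
  have 2: "((coord c' \<circ> \<gamma>) has_vector_derivative D v) (at 0 within I)"
    by (rule vector_derivative_change_chart[OF ch _ I(2) ev(1) 1]) (use \<gamma>0 p D in simp_all)
  then show "((\<lambda>s. coord c' (param c (coord c p + s *\<^sub>R v))) has_vector_derivative D v) (at 0)"
    unfolding at by (simp add: o_def \<gamma>_def)
  assume D': "differential id c' c p D'"
  have "((coord c \<circ> \<gamma>) has_vector_derivative D' (D v)) (at 0 within I)"
    by (rule vector_derivative_change_chart[OF ch' _ I(2) ev(2) 2]) (use \<gamma>0 p D' in simp_all)
  then show "D' (D v) = v"
    using 1 unfolding at by (rule vector_derivative_unique_at)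
qed

lemma convex_half_space: "convex (half_space :: ('e::euclidean_space \<times> real) set)"
proof -
  have eq: "(half_space :: ('e \<times> real) set) = UNIV \<times> {0..}"
    by (auto simp: half_space_def)
  show ?thesis
    unfolding eq by (intro convex_Times convex_UNIV convex_real_interval)
qed

section \<open>Collars\<close>

text \<open>The conditions on a collar that do not involve a foliation.\<close>

locale collar =
  fixes X :: "'m topology"
    and A :: "('m, 'e::euclidean_space \<times> real) chart set"
    and S :: "'m set"
    and \<kappa> :: "'m \<times> real \<Rightarrow> 'm"
  assumes M: "smooth_manifold X half_space A"
    and MS: "smooth_manifold (subtopology X S) UNIV (boundary_atlas X A S)"
    and inj: "inj_on \<kappa> (S \<times> {0..<1})"
    and \<kappa>0: "\<And>x. x \<in> S \<Longrightarrow> \<kappa> (x, 0) = x"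
    and product_chart: "\<And>c. c \<in> boundary_atlas X A S \<Longrightarrow> collar_chart \<kappa> c \<in> A"
    and S_comp: "compactin X S"
begin

abbreviation (input) B where "B \<equiv> boundary_atlas X A S"

definition N :: "'m set" where "N = \<kappa> ` (S \<times> {0..<1})"

lemma topspace_S: "topspace (subtopology X S) = S"
  using compactin_subset_topspace[OF S_comp] by auto

lemma chart_S: "c \<in> B \<Longrightarrow> is_chart (subtopology X S) UNIV c"
  by (rule smooth_manifold_chart[OF MS])

lemma dom_S: "c \<in> B \<Longrightarrow> dom_of c \<subseteq> S"
  using openin_subset[OF is_chart_dom[OF chart_S]] topspace_S by blast

lemma S_cover:
  assumes "x \<in> S"
  obtains c where "c \<in> B" "x \<in> dom_of c"
  using smooth_manifold_cover[OF MS] assms topspace_S by blast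

lemma product_is_chart: "c \<in> B \<Longrightarrow> is_chart X half_space (collar_chart \<kappa> c)"
  by (rule smooth_manifold_chart[OF M product_chart])

lemma dom_product: "dom_of (collar_chart \<kappa> c) = \<kappa> ` (dom_of c \<times> {0..<1})"
  by (simp add: collar_chart_def)

lemma coord_product:
  assumes "c \<in> B" "x \<in> dom_of c" "t \<in> {0..<1}"
  shows "coord (collar_chart \<kappa> c) (\<kappa> (x, t)) = (coord c x, t)"
proof -
  have "inj_on \<kappa> (dom_of c \<times> {0..<1})"
    by (rule inj_on_subset[OF inj]) (use dom_S[OF assms(1)] in auto)
  then have "inv_into (dom_of c \<times> {0..<1}) \<kappa> (\<kappa> (x, t)) = (x, t)"
    using assms by (intro inv_into_f_f) auto
  then show ?thesis
    by (simp add: collar_chart_def)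
qed

lemma param_product:
  assumes "c \<in> B" "x \<in> dom_of c" "t \<in> {0..<1}"
  shows "param (collar_chart \<kappa> c) (coord c x, t) = \<kappa> (x, t)"
proof -
  have "\<kappa> (x, t) \<in> dom_of (collar_chart \<kappa> c)"
    using assms by (auto simp: dom_product)
  then show ?thesis
    using param_coord[OF product_is_chart[OF assms(1)]] coord_product[OF assms] by metis
qed

lemma image_product:
  assumes "c \<in> B"
  shows "coord (collar_chart \<kappa> c) ` dom_of (collar_chart \<kappa> c) = coord c ` dom_of c \<times> {0..<1}"
proof -
  have "coord (collar_chart \<kappa> c) ` dom_of (collar_chart \<kappa> c) =
      (\<lambda>(x, t). (coord c x, t)) ` (dom_of c \<times> {0..<1})"
    unfolding dom_product image_image using coord_product[OF assms] by (intro image_cong) auto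
  then show ?thesis
    by auto
qed

lemma S_subset_N: "S \<subseteq> N"
  unfolding N_def using \<kappa>0 by (auto intro!: image_eqI[where x = "(_, 0)"])

lemma openin_N: "openin X N"
proof -
  have "N = (\<Union>c\<in>B. dom_of (collar_chart \<kappa> c))"
  proof (intro subset_antisym subsetI)
    fix p assume "p \<in> N"
    then obtain x t where x: "x \<in> S" "t \<in> {0..<1}" "p = \<kappa> (x, t)"
      by (auto simp: N_def)
    obtain c where c: "c \<in> B" "x \<in> dom_of c"
      by (rule S_cover[OF x(1)])
    then have "p \<in> dom_of (collar_chart \<kappa> c)"
      using x by (auto simp: dom_product)
    then show "p \<in> (\<Union>c\<in>B. dom_of (collar_chart \<kappa> c))"
      using c(1) by blast
  next
    fix p assume "p \<in> (\<Union>c\<in>B. dom_of (collar_chart \<kappa> c))"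
    then obtain c x t where "c \<in> B" "x \<in> dom_of c" "t \<in> {0..<1}" "p = \<kappa> (x, t)"
      by (auto simp: dom_product)
    then show "p \<in> N"
      unfolding N_def using dom_S[of c] by blast
  qed
  moreover have "openin X (\<Union>c\<in>B. dom_of (collar_chart \<kappa> c))"
    by (intro openin_Union) (use is_chart_dom[OF product_is_chart] in auto)
  ultimately show ?thesis
    by simp
qed

lemma product_neighbourhood:
  fixes t0 :: real
  assumes c: "c \<in> B" "x \<in> dom_of c" and \<delta>: "\<delta> > 0"
  obtains V \<eta> where "openin (subtopology X S) V" "x \<in> V" "\<eta> > 0" "V \<subseteq> dom_of c"
    "\<forall>x'\<in>V. \<forall>t. \<bar>t - t0\<bar> < \<eta> \<longrightarrow> (coord c x', t) \<in> ball (coord c x, t0) \<delta>"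
proof -
  let ?V = "{x' \<in> dom_of c. coord c x' \<in> ball (coord c x) (\<delta> / 2)}"
  have "(coord c x', t) \<in> ball (coord c x, t0) \<delta>" if "x' \<in> ?V" "\<bar>t - t0\<bar> < \<delta> / 2" for x' t
  proof -
    have "dist (coord c x, t0) (coord c x', t) = norm (coord c x - coord c x', t0 - t)"
      by (simp add: dist_norm)
    also have "\<dots> \<le> norm (coord c x - coord c x') + norm (t0 - t)"
      by (rule norm_Pair_le)
    also have "norm (t0 - t) = \<bar>t - t0\<bar>"
      by simp
    also have "norm (coord c x - coord c x') + \<bar>t - t0\<bar> < \<delta>"
      using that by (simp add: dist_norm)
    finally show ?thesis
      by simp
  qed
  moreover have "openin (subtopology X S) ?V"
    by (rule is_chart_open_preimage[OF chart_S[OF c(1)]]) simp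
  ultimately show ?thesis
    using c \<delta> by (intro that[of ?V "\<delta> / 2"]) auto
qed

text \<open>A pseudometric that is small on small sets is small on the fibres of the collar over \<open>S\<close>, uniformly
  in the base point.  The centre \<open>0\<close> is written out to match the uniformity lemma.\<close>

lemma small_collar:
  assumes small: "\<And>p e. \<lbrakk>p \<in> topspace X; e > 0\<rbrakk> \<Longrightarrow>
      \<exists>V. openin X V \<and> p \<in> V \<and> (\<forall>x\<in>V. \<forall>y\<in>V. \<sigma> x y < (e::real))" and e: "e > 0"
  shows "\<exists>\<eta>>0. \<forall>x\<in>S. \<forall>t. \<bar>t - 0\<bar> < \<eta> \<longrightarrow> (t \<in> {0..<1} \<longrightarrow> \<sigma> (\<kappa> (x, t)) x < e)"
proof -
  have "\<exists>\<eta>>0. \<forall>x\<in>topspace (subtopology X S). \<forall>t. \<bar>t - 0\<bar> < \<eta> \<longrightarrow> (t \<in> {0..<1} \<longrightarrow> \<sigma> (\<kappa> (x, t)) x < e)"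
  proof (rule compact_space_uniform)
    show "compact_space (subtopology X S)"
      using S_comp by (simp add: compactin_subspace)
    fix x assume "x \<in> topspace (subtopology X S)"
    then have x: "x \<in> S" "x \<in> topspace X"
      by auto
    obtain c where c: "c \<in> B" "x \<in> dom_of c"
      by (rule S_cover[OF x(1)])
    let ?C = "collar_chart \<kappa> c"
    obtain W where W: "openin X W" "x \<in> W" "\<forall>x\<in>W. \<forall>y\<in>W. \<sigma> x y < e"
      using small[OF x(2) e] by blast
    have xC: "x \<in> dom_of ?C" "coord ?C x = (coord c x, 0)"
      using \<kappa>0[OF x(1)] coord_product[OF c, of 0] c by (auto simp: dom_product intro!: image_eqI[where x = "(x, 0)"])
    obtain r where r: "r > 0" "ball (coord ?C x) r \<inter> half_space \<subseteq> coord ?C ` (dom_of ?C \<inter> W)"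
      by (rule is_chart_ball[OF product_is_chart[OF c(1)] xC(1) W(1,2)])
    have inW: "\<kappa> (y, t) \<in> W" if y: "y \<in> dom_of c" "t \<in> {0..<1}" "(coord c y, t) \<in> ball (coord c x, 0) r" for y t
    proof -
      have "(coord c y, t) \<in> coord ?C ` (dom_of ?C \<inter> W)"
        using r(2) y(2,3) xC(2) by (auto simp: half_space_def)
      then obtain q where q: "q \<in> dom_of ?C" "q \<in> W" "coord ?C q = (coord c y, t)"
        by auto
      then have "q = \<kappa> (y, t)"
        using param_coord[OF product_is_chart[OF c(1)] q(1)] param_product[OF c(1) y(1,2)] by simp
      then show ?thesis
        using q(2) by simp
    qed
    obtain V \<eta> where V: "openin (subtopology X S) V" "x \<in> V" "\<eta> > 0" "V \<subseteq> dom_of c"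
      "\<forall>x'\<in>V. \<forall>t::real. \<bar>t - 0\<bar> < \<eta> \<longrightarrow> (coord c x', t) \<in> ball (coord c x, 0) r"
      by (rule product_neighbourhood[OF c r(1), of 0])
    have "\<sigma> (\<kappa> (x', t)) x' < e" if "x' \<in> V" "\<bar>t - 0\<bar> < \<eta>" "t \<in> {0..<1}" for x' t
    proof -
      have "x' \<in> dom_of c" "x' \<in> S"
        using that V(4) dom_S[OF c(1)] by blast+
      moreover have "\<kappa> (x', t) \<in> W"
        by (rule inW) (use that V(4,5) in auto)
      moreover have "\<kappa> (x', 0) \<in> W"
        by (rule inW) (use that V(3,4,5) in auto)
      ultimately show ?thesis
        using W(3) \<kappa>0[of x'] by auto
    qed
    then show "\<exists>V \<eta>. openin (subtopology X S) V \<and> x \<in> V \<and> \<eta> > 0 \<and>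
        (\<forall>x'\<in>V. \<forall>t. \<bar>t - 0\<bar> < \<eta> \<longrightarrow> (t \<in> {0..<1} \<longrightarrow> \<sigma> (\<kappa> (x', t)) x' < e))"
      using V(1-3) by (intro exI[of _ V] exI[of _ \<eta>]) auto
  qed
  then show ?thesis
    unfolding topspace_S .
qed

end

section \<open>Leaves of the spun foliation in the collar\<close>

locale spun_collar = collar X A S \<kappa>
  for X :: "'m topology" and A :: "('m, 'e::euclidean_space \<times> real) chart set" and S \<kappa> +
  fixes F\<^sub>S :: "('m, 'e \<times> real) plane_field"
    and \<omega> :: "('m, 'e) chart \<Rightarrow> 'm \<Rightarrow> 'e \<Rightarrow> real"
    and h :: "real \<Rightarrow> real"
  assumes F\<^sub>S: "foliation X A F\<^sub>S"
    and h: "spin_function h"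
    and nonsing: "nonsingular_form (boundary_atlas X A S) \<omega>"
    and spin: "\<And>c x t. \<lbrakk>c \<in> boundary_atlas X A S; x \<in> dom_of c; t \<in> {0..<1}\<rbrakk> \<Longrightarrow>
      F\<^sub>S (collar_chart \<kappa> c) (\<kappa> (x, t)) = {w. spin_form \<omega> h c (x, t) w = 0}"
    and conn: "connectedin X S"
begin

text \<open>At height \<open>0\<close> the spinning form is \<open>dt\<close>, so the segments inside \<open>S\<close> are tangent to \<open>F\<^sub>S\<close>; and \<open>S\<close> is
  connected.\<close>

lemma S_subset_leaf:
  assumes "x \<in> S" "y \<in> S"
  shows "y \<in> leaf X A F\<^sub>S x"
proof -
  define E where "E x y \<longleftrightarrow> y \<in> leaf X A F\<^sub>S x" for x y
  have "E x y"
  proof (rule connected_space_equivalence[where E = E and Y = "subtopology X S"])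
    show "connected_space (subtopology X S)"
      using conn by (simp add: connectedin_def)
    show "E y x" if "E x y" for x y
      using that unfolding E_def by (rule leaf_sym)
    show "E x z" if "E x y" "E y z" for x y z
      using that unfolding E_def by (rule leaf_trans)
    fix x assume "x \<in> topspace (subtopology X S)"
    then have x: "x \<in> S"
      by simp
    obtain c where c: "c \<in> B" "x \<in> dom_of c"
      by (rule S_cover[OF x])
    let ?C = "collar_chart \<kappa> c"
    note ch = chart_S[OF c(1)]
    obtain r where r: "r > 0" "ball (coord c x) r \<inter> UNIV \<subseteq> coord c ` (dom_of c \<inter> topspace (subtopology X S))"
      by (rule is_chart_ball[OF ch c(2) openin_topspace]) (use x topspace_S in auto)
    let ?V = "{y \<in> dom_of c. coord c y \<in> ball (coord c x) r}"
    have "E x y" if y: "y \<in> ?V" for y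
    proof -
      let ?a = "(coord c x, 0::real)" and ?b = "(coord c y, 0::real)"
      have zs: "coord c x + s *\<^sub>R (coord c y - coord c x) \<in> coord c ` dom_of c" if "s \<in> {0..1}" for s
      proof -
        have "closed_segment (coord c x) (coord c y) \<subseteq> ball (coord c x) r"
          using y r(1) by (intro closed_segment_subset convex_ball) auto
        then show ?thesis
          using r(2) in_closed_segment[OF that, of "coord c x" "coord c y"] by blast
      qed
      have seg: "closed_segment ?a ?b \<subseteq> coord ?C ` dom_of ?C"
      proof
        fix z assume "z \<in> closed_segment ?a ?b"
        then obtain s where s: "s \<in> {0..1}" "z = (1 - s) *\<^sub>R ?a + s *\<^sub>R ?b"
          by (auto simp: in_segment)
        have "z = (coord c x + s *\<^sub>R (coord c y - coord c x), 0)"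
          unfolding s(2) by (simp add: algebra_simps)
        then show "z \<in> coord ?C ` dom_of ?C"
          unfolding image_product[OF c(1)] using zs[OF s(1)] by simp
      qed
      have "chart_segment ?C ?a ?b 1 \<in> leaf X A F\<^sub>S (chart_segment ?C ?a ?b 0)"
      proof (rule tangent_segment_subset_leaf[OF M F\<^sub>S product_chart[OF c(1)] seg])
        fix s :: real assume s: "s \<in> {0..1}"
        obtain x' where x': "x' \<in> dom_of c" "coord c x + s *\<^sub>R (coord c y - coord c x) = coord c x'"
          using zs[OF s] by auto
        have "chart_segment ?C ?a ?b s = \<kappa> (x', 0)"
          unfolding chart_segment_def using x'(2) param_product[OF c(1) x'(1), of 0] by simp
        then have "F\<^sub>S ?C (chart_segment ?C ?a ?b s) = {w. spin_form \<omega> h c (x', 0) w = 0}"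
          using spin[OF c(1) x'(1), of 0] by simp
        moreover have "h 0 = 1"
          using h by (simp add: spin_function_def)
        ultimately show "?b - ?a \<in> F\<^sub>S ?C (chart_segment ?C ?a ?b s)"
          by (simp add: spin_form_def)
      qed auto
      moreover have "chart_segment ?C ?a ?b 0 = x" "chart_segment ?C ?a ?b 1 = y"
        using param_product[OF c, of 0] param_product[OF c(1), of y 0] y \<kappa>0 dom_S[OF c(1)] x
        by (auto simp: chart_segment_def)
      ultimately show ?thesis
        unfolding E_def by simp
    qed
    moreover have "openin (subtopology X S) ?V"
      by (rule is_chart_open_preimage[OF ch]) simp
    ultimately show "\<exists>V. openin (subtopology X S) V \<and> x \<in> V \<and> (\<forall>y\<in>V. E x y)"
      using c r(1) by (intro exI[of _ ?V]) auto
  qed (use assms topspace_S in auto)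
  then show ?thesis
    unfolding E_def .
qed

lemma h_less_1:
  assumes "0 < t" "t < 1"
  shows "h t < 1"
proof (cases "t \<le> 1/2")
  case True
  show ?thesis
  proof -
    have "\<forall>s\<in>{0..1/2}. \<forall>t\<in>{0..1/2}. s < t \<longrightarrow> h t < h s" "h 0 = 1"
      using h unfolding spin_function_def by blast+
    then show ?thesis
      using True assms(1) by force
  qed
next
  case False
  then show ?thesis
    using h assms unfolding spin_function_def by auto
qed

text \<open>Let \<open>f\<close> be the transverse coordinate of a foliated chart of \<open>F\<^sub>S\<close> near \<open>\<kappa> (x, t0)\<close>, read in the product
  chart.  As \<open>0 < t0\<close> we have \<open>h t0 < 1\<close>, so a vector \<open>(v, 0)\<close> with \<open>\<omega> v \<noteq> 0\<close> is not tangent to \<open>F\<^sub>S\<close>, i.e.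
  the derivative of \<open>f\<close> in this direction is not \<open>0\<close>; so the levels of \<open>f\<close> descend below \<open>t0\<close>.  Two
  points of a level are in the same leaf because the levels are convex in the coordinates of the
  foliated chart, restricted to a ball.\<close>

lemma leaf_descends_locally:
  assumes x: "x \<in> S" and t0: "0 < t0" "t0 < 1"
  shows "\<exists>V \<eta>. openin (subtopology X S) V \<and> x \<in> V \<and> \<eta> > 0 \<and>
    (\<forall>x'\<in>V. \<forall>t. \<bar>t - t0\<bar> < \<eta> \<longrightarrow>
       (t \<in> {0..<1} \<longrightarrow> (\<exists>y\<in>S. \<exists>t'. 0 \<le> t' \<and> t' < t0 \<and> \<kappa> (y, t') \<in> leaf X A F\<^sub>S (\<kappa> (x', t)))))"
proof -
  have t0': "t0 \<in> {0..<1}"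
    using t0 by simp
  obtain c where c: "c \<in> B" "x \<in> dom_of c"
    by (rule S_cover[OF x])
  let ?C = "collar_chart \<kappa> c" and ?p = "\<kappa> (x, t0)" and ?z0 = "(coord c x, t0)"
  note C = product_chart[OF c(1)] and chC = product_is_chart[OF c(1)]
  have p: "?p \<in> dom_of ?C" "coord ?C ?p = ?z0"
    using c t0' coord_product[OF c t0'] by (auto simp: dom_product)
  then have pX: "?p \<in> topspace X"
    using openin_subset[OF is_chart_dom[OF chC]] by blast
  obtain c' w where c': "?p \<in> dom_of c'" "foliated_chart A F\<^sub>S c' w"
    using F\<^sub>S pX unfolding foliation_def by blast
  have c'A: "c' \<in> A" and level: "F\<^sub>S c' ?p = {v. v \<bullet> w = 0}"
    using c' unfolding foliated_chart_def by auto
  note ch' = smooth_manifold_chart[OF M c'A]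
  obtain r' where r': "r' > 0" "ball (coord c' ?p) r' \<inter> half_space \<subseteq> coord c' ` (dom_of c' \<inter> topspace X)"
    by (rule is_chart_ball[OF ch' c'(1) openin_topspace pX])
  define W where "W = {q \<in> dom_of c'. coord c' q \<in> ball (coord c' ?p) r'}"
  have W: "openin X W" "?p \<in> W"
    unfolding W_def using c'(1) r'(1) is_chart_open_preimage[OF ch', of "ball (coord c' ?p) r'"] by simp_all
  obtain r where r: "r > 0" "ball (coord ?C ?p) r \<inter> half_space \<subseteq> coord ?C ` (dom_of ?C \<inter> W)"
    by (rule is_chart_ball[OF chC p(1) W])
  define \<delta> where "\<delta> = min r t0"
  have \<delta>: "\<delta> > 0" "\<delta> \<le> r" "\<delta> \<le> t0"
    using r(1) t0 by (auto simp: \<delta>_def)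
  have ballW: "z \<in> coord ?C ` (dom_of ?C \<inter> W)" if z: "z \<in> ball ?z0 \<delta>" for z
  proof -
    have "dist t0 (snd z) \<le> dist ?z0 z"
      using dist_snd_le[of ?z0 z] by simp
    then have "snd z > 0"
      using z \<delta>(3) by (auto simp: dist_real_def)
    then have "z \<in> ball (coord ?C ?p) r \<inter> half_space"
      using z \<delta>(2) p(2) by (auto simp: half_space_def)
    then show ?thesis
      using r(2) by blast
  qed
  have ballC: "z \<in> coord ?C ` dom_of ?C" "param ?C z \<in> dom_of ?C" "param ?C z \<in> W" if z: "z \<in> ball ?z0 \<delta>" for z
  proof -
    obtain q where q: "q \<in> dom_of ?C" "q \<in> W" "z = coord ?C q"
      using ballW[OF z] by blast
    then show "z \<in> coord ?C ` dom_of ?C" "param ?C z \<in> dom_of ?C" "param ?C z \<in> W"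
      using param_coord[OF chC q(1)] by auto
  qed
  define f where "f z = coord c' (param ?C z) \<bullet> w" for z
  have cont: "continuous_on (ball ?z0 \<delta>) f"
    unfolding f_def
    by (intro continuous_on_inner continuous_on_const continuous_on_transition[OF chC ch'])
      (use ballC in \<open>auto simp: W_def\<close>)
  obtain v where v: "\<omega> c x v \<noteq> 0"
    using nonsing c unfolding nonsingular_form_def by blast
  obtain D where D: "differential id ?C c' ?p D"
    by (rule differential_exists[OF M C c'A p(1) c'(1)])
  obtain D' where D': "differential id c' ?C ?p D'"
    by (rule differential_exists[OF M c'A C c'(1) p(1)])
  have ball: "ball (coord ?C ?p) \<delta> \<subseteq> coord ?C ` dom_of ?C"
    using ballC(1) p(2) by auto
  note ld = line_derivative[OF M C c'A p(1) c'(1) \<delta>(1) ball D]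
  have "((\<lambda>s. coord c' (param ?C (?z0 + s *\<^sub>R (v, 0))) \<bullet> w) has_derivative (\<lambda>s. (s *\<^sub>R D (v, 0)) \<bullet> w)) (at 0)"
    using ld(1)[of "(v, 0)"] unfolding p(2) has_vector_derivative_def by (rule has_derivative_inner_left)
  then have deriv: "((\<lambda>s. f (?z0 + s *\<^sub>R (v, 0))) has_real_derivative D (v, 0) \<bullet> w) (at 0)"
    unfolding f_def has_field_derivative_def by (simp add: mult_commute_abs)
  \<comment> \<open>The direction \<open>(v, 0)\<close> is transverse to \<open>F\<^sub>S\<close>, as \<open>(1 - h t0) * \<omega> v \<noteq> 0\<close>.\<close>
  have k: "D (v, 0) \<bullet> w \<noteq> 0"
  proof
    assume "D (v, 0) \<bullet> w = 0"
    then have "D (v, 0) \<in> F\<^sub>S c' ?p"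
      using level by simp
    moreover have "F\<^sub>S ?C ?p = D' ` F\<^sub>S c' ?p"
      using F\<^sub>S C c'A p(1) c'(1) D' unfolding foliation_def plane_field_def by blast
    ultimately have "D' (D (v, 0)) \<in> F\<^sub>S ?C ?p"
      by blast
    then have "(v, 0) \<in> F\<^sub>S ?C ?p"
      using ld(2)[OF D'] by simp
    then have "(1 - h t0) * \<omega> c x v = 0"
      using spin[OF c t0'] by (simp add: spin_form_def collar_form_def)
    then show False
      using v h_less_1[OF t0] by simp
  qed
  obtain \<eta>0 where \<eta>0: "\<eta>0 > 0" "\<And>y. y \<in> ball ?z0 \<eta>0 \<Longrightarrow> \<exists>y'\<in>ball ?z0 \<delta>. f y' = f y \<and> snd y' < snd ?z0"
    using level_point_below[OF \<delta>(1) cont deriv k] by blast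
  define \<eta>1 where "\<eta>1 = min \<eta>0 \<delta>"
  have \<eta>1: "\<eta>1 > 0" "\<eta>1 \<le> \<eta>0" "\<eta>1 \<le> \<delta>"
    using \<eta>0(1) \<delta>(1) by (auto simp: \<eta>1_def)
  obtain V \<eta> where V: "openin (subtopology X S) V" "x \<in> V" "\<eta> > 0" "V \<subseteq> dom_of c"
    "\<forall>x'\<in>V. \<forall>t. \<bar>t - t0\<bar> < \<eta> \<longrightarrow> (coord c x', t) \<in> ball ?z0 \<eta>1"
    by (rule product_neighbourhood[OF c \<eta>1(1), of t0])
  have "\<exists>y\<in>S. \<exists>t'. 0 \<le> t' \<and> t' < t0 \<and> \<kappa> (y, t') \<in> leaf X A F\<^sub>S (\<kappa> (x', t))"
    if x': "x' \<in> V" "\<bar>t - t0\<bar> < \<eta>" "t \<in> {0..<1}" for x' t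
  proof -
    let ?y = "(coord c x', t)"
    have y: "?y \<in> ball ?z0 \<eta>1"
      using V(5) x'(1,2) by blast
    have yd: "?y \<in> ball ?z0 \<delta>" and ye: "?y \<in> ball ?z0 \<eta>0"
      using y subset_ball[OF \<eta>1(3), of ?z0] subset_ball[OF \<eta>1(2), of ?z0] by blast+
    obtain y' where y': "y' \<in> ball ?z0 \<delta>" "f y' = f ?y" "snd y' < t0"
      using \<eta>0(2)[OF ye] by auto
    let ?q = "param ?C ?y" and ?q' = "param ?C y'"
    have q: "?q \<in> dom_of c'" "?q' \<in> dom_of c'" "coord c' ?q \<in> ball (coord c' ?p) r'"
      "coord c' ?q' \<in> ball (coord c' ?p) r'"
      using ballC(3)[OF yd] ballC(3)[OF y'(1)] by (auto simp: W_def)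
    let ?K = "ball (coord c' ?p) r' \<inter> half_space \<inter> {z. z \<bullet> w = f ?y}"
    have qK: "coord c' ?q \<in> ?K" "coord c' ?q' \<in> ?K"
      using q is_chart_image_subset[OF ch'] y'(2) by (auto simp: f_def)
    have K: "?K \<subseteq> coord c' ` dom_of c'"
      using r'(2) by blast
    have "convex {z :: 'e \<times> real. z \<bullet> w = f ?y}"
      using convex_hyperplane[of w "f ?y"] by (simp add: inner_commute)
    moreover have "convex (half_space :: ('e \<times> real) set)"
      by (rule convex_half_space)
    ultimately have "connected ?K"
      by (intro convex_connected convex_Int convex_ball)
    moreover have "continuous_map (top_of_set ?K) X (\<lambda>z. param c' (id z))"
      by (rule continuous_map_param[OF ch']) (use K in \<open>auto intro: continuous_on_id\<close>)
    ultimately have "connectedin X (param c' ` ?K)"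
      using connectedin_continuous_map_image[of "top_of_set ?K" X "param c'" ?K]
      by (simp add: connectedin_subtopology)
    moreover have "param c' ` ?K \<subseteq> {q \<in> dom_of c'. coord c' q \<bullet> w = f ?y}"
    proof
      fix q assume "q \<in> param c' ` ?K"
      then obtain z where z: "z \<in> ?K" "q = param c' z"
        by blast
      then have "z \<in> coord c' ` dom_of c'"
        using K by blast
      then show "q \<in> {q \<in> dom_of c'. coord c' q \<bullet> w = f ?y}"
        using z param_in_dom[of z c'] coord_param[of z c'] by auto
    qed
    moreover have "?q \<in> param c' ` ?K" "?q' \<in> param c' ` ?K"
      using imageI[OF qK(1), of "param c'"] imageI[OF qK(2), of "param c'"]
        param_coord[OF ch' q(1)] param_coord[OF ch' q(2)] by simp_all
    ultimately have leaf: "?q' \<in> leaf X A F\<^sub>S ?q"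
      by (rule connected_level_subset_leaf[OF c'(2)])
    have "y' \<in> coord c ` dom_of c \<times> {0..<1}"
      using ballC(1)[OF y'(1)] image_product[OF c(1)] by simp
    then obtain x'' t'' where x'': "x'' \<in> dom_of c" "t'' \<in> {0..<1}" "y' = (coord c x'', t'')"
      by auto
    have "?q' = \<kappa> (x'', t'')"
      unfolding x''(3) by (rule param_product[OF c(1) x''(1,2)])
    moreover have "?q = \<kappa> (x', t)"
      by (rule param_product[OF c(1) _ x'(3)]) (use x'(1) V(4) in blast)
    ultimately have "\<kappa> (x'', t'') \<in> leaf X A F\<^sub>S (\<kappa> (x', t))"
      using leaf by simp
    moreover have "x'' \<in> S" "t'' < t0" "0 \<le> t''"
      using x'' dom_S[OF c(1)] y'(3) by auto
    ultimately show ?thesis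
      by blast
  qed
  then show ?thesis
    using V(1-3) by (intro exI[of _ V] exI[of _ \<eta>]) auto
qed

text \<open>If the infimum \<open>t0\<close> of the heights of the leaf were positive, the leaf would contain a point of
  height close to \<open>t0\<close>, and then one of height below \<open>t0\<close> by the local descent, which is uniform over
  the compact \<open>S\<close>.\<close>

lemma leaf_approaches_S:
  assumes x: "x \<in> S" and t: "t \<in> {0..<1}" and e: "e > 0"
  shows "\<exists>y\<in>S. \<exists>t'\<in>{0..<1}. t' < e \<and> \<kappa> (y, t') \<in> leaf X A F\<^sub>S (\<kappa> (x, t))"
proof -
  define T where "T = {t' \<in> {0..<1}. \<exists>y\<in>S. \<kappa> (y, t') \<in> leaf X A F\<^sub>S (\<kappa> (x, t))}"
  define t0 where "t0 = Inf T"
  have tT: "t \<in> T"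
  proof -
    have "\<kappa> (x, t) \<in> leaf X A F\<^sub>S (\<kappa> (x, t))"
      by (rule leaf_refl)
    then show ?thesis
      unfolding T_def using t x by blast
  qed
  have T: "bdd_below T"
    by (rule bdd_belowI[of _ 0]) (auto simp: T_def)
  have ne: "T \<noteq> {}"
    using tT by blast
  have "t0 \<le> t"
    unfolding t0_def by (rule cInf_lower[OF tT T])
  moreover have "0 \<le> t0"
    unfolding t0_def by (rule cInf_greatest[OF ne]) (simp add: T_def)
  ultimately have t0: "t0 \<le> t" "0 \<le> t0"
    by auto
  have "t0 = 0"
  proof (rule ccontr)
    assume "t0 \<noteq> 0"
    then have t01: "0 < t0" "t0 < 1"
      using t0 t by auto
    have "\<exists>\<eta>>0. \<forall>x\<in>topspace (subtopology X S). \<forall>t. \<bar>t - t0\<bar> < \<eta> \<longrightarrow>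
       (t \<in> {0..<1} \<longrightarrow> (\<exists>y\<in>S. \<exists>t'. 0 \<le> t' \<and> t' < t0 \<and> \<kappa> (y, t') \<in> leaf X A F\<^sub>S (\<kappa> (x, t))))"
    proof (rule compact_space_uniform)
      show "compact_space (subtopology X S)"
        using S_comp by (simp add: compactin_subspace)
    qed (rule leaf_descends_locally[OF _ t01], simp)
    then obtain \<eta> where \<eta>: "\<eta> > 0" "\<And>x t. \<lbrakk>x \<in> S; \<bar>t - t0\<bar> < \<eta>; t \<in> {0..<1}\<rbrakk> \<Longrightarrow>
        \<exists>y\<in>S. \<exists>t'. 0 \<le> t' \<and> t' < t0 \<and> \<kappa> (y, t') \<in> leaf X A F\<^sub>S (\<kappa> (x, t))"
      unfolding topspace_S by blast
    have "Inf T < t0 + \<eta>"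
      using \<eta>(1) by (simp add: t0_def)
    then obtain t1 where t1: "t1 \<in> T" "t1 < t0 + \<eta>"
      using cInf_lessD[OF ne, of "t0 + \<eta>"] by blast
    have "t0 \<le> t1"
      unfolding t0_def by (rule cInf_lower[OF t1(1) T])
    then have "\<bar>t1 - t0\<bar> < \<eta>"
      using t1(2) by simp
    obtain y where y: "y \<in> S" "\<kappa> (y, t1) \<in> leaf X A F\<^sub>S (\<kappa> (x, t))" "t1 \<in> {0..<1}"
      using t1(1) by (auto simp: T_def)
    obtain y' t' where y': "y' \<in> S" "0 \<le> t'" "t' < t0" "\<kappa> (y', t') \<in> leaf X A F\<^sub>S (\<kappa> (y, t1))"
      using \<eta>(2)[OF y(1) \<open>\<bar>t1 - t0\<bar> < \<eta>\<close> y(3)] by blast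
    have "\<kappa> (y', t') \<in> leaf X A F\<^sub>S (\<kappa> (x, t))"
      by (rule leaf_trans[OF y(2) y'(4)])
    then have "t' \<in> T"
      using y' t01 by (auto simp: T_def)
    then have "t0 \<le> t'"
      unfolding t0_def by (rule cInf_lower[OF _ T])
    then show False
      using y'(3) by simp
  qed
  then have "Inf T < e"
    using e by (simp add: t0_def)
  then obtain t1 where "t1 \<in> T" "t1 < e"
    using cInf_lessD[OF ne, of e] by blast
  then show ?thesis
    unfolding T_def by blast
qed

text \<open>Every leaf in the collar comes arbitrarily close to \<open>S\<close>, which lies in a single leaf.\<close>

lemma pseudometric_zero_on_collar:
  assumes \<sigma>: "pseudometric_on (topspace X) \<sigma>"
    and small: "\<And>p e. \<lbrakk>p \<in> topspace X; e > 0\<rbrakk> \<Longrightarrow>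
      \<exists>V. openin X V \<and> p \<in> V \<and> (\<forall>x\<in>V. \<forall>y\<in>V. \<sigma> x y < e)"
    and leaf0: "\<And>p q. \<lbrakk>p \<in> topspace X; q \<in> leaf X A F\<^sub>S p\<rbrakk> \<Longrightarrow> \<sigma> p q = 0"
    and pq: "p \<in> N" "q \<in> N"
  shows "\<sigma> p q = 0"
proof -
  note pm = pseudometric_onD[OF \<sigma>]
  have NX: "N \<subseteq> topspace X"
    by (rule openin_subset[OF openin_N])
  have near: "\<exists>y\<in>S. \<sigma> p y < e" if p: "p \<in> N" and e: "e > 0" for p e
  proof -
    obtain x t where x: "x \<in> S" "t \<in> {0..<1}" "p = \<kappa> (x, t)"
      using p by (auto simp: N_def)
    obtain \<eta> where \<eta>: "\<eta> > 0" "\<And>x t. \<lbrakk>x \<in> S; \<bar>t - 0\<bar> < \<eta>; t \<in> {0..<1}\<rbrakk> \<Longrightarrow> \<sigma> (\<kappa> (x, t)) x < e"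
      using small_collar[OF small e] by blast
    obtain y t' where y: "y \<in> S" "t' \<in> {0..<1}" "t' < \<eta>" "\<kappa> (y, t') \<in> leaf X A F\<^sub>S p"
      using leaf_approaches_S[OF x(1,2) \<eta>(1)] x(3) by blast
    have "\<kappa> (y, t') \<in> topspace X" "y \<in> topspace X" "p \<in> topspace X"
      using y p NX S_subset_N by (auto simp: N_def)
    then have "\<sigma> p y \<le> \<sigma> p (\<kappa> (y, t')) + \<sigma> (\<kappa> (y, t')) y"
      by (intro pm(4))
    also have "\<sigma> p (\<kappa> (y, t')) = 0"
      by (rule leaf0[OF \<open>p \<in> topspace X\<close> y(4)])
    also have "\<sigma> (\<kappa> (y, t')) y < e"
      by (rule \<eta>(2)) (use y in auto)
    finally show ?thesis
      using y(1) by auto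
  qed
  have pqX: "p \<in> topspace X" "q \<in> topspace X"
    using pq NX by auto
  have "\<sigma> p q \<le> e" if e: "e > 0" for e
  proof -
    obtain y where y: "y \<in> S" "\<sigma> p y < e / 2"
      using near[OF pq(1), of "e / 2"] e by auto
    obtain z where z: "z \<in> S" "\<sigma> q z < e / 2"
      using near[OF pq(2), of "e / 2"] e by auto
    have yz: "y \<in> topspace X" "z \<in> topspace X"
      using y z S_subset_N NX by auto
    have "\<sigma> p q \<le> \<sigma> p y + \<sigma> y q" "\<sigma> y q \<le> \<sigma> y z + \<sigma> z q"
      using pm(4) pqX yz by auto
    moreover have "\<sigma> y z = 0"
      by (rule leaf0[OF yz(1) S_subset_leaf[OF y(1) z(1)]])
    moreover have "\<sigma> z q = \<sigma> q z"
      by (rule pm(3)[OF yz(2) pqX(2)])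
    ultimately show ?thesis
      using y z by simp
  qed
  then have "\<sigma> p q \<le> 0"
    by (rule field_le_epsilon[of _ 0, simplified])
  then show ?thesis
    using pm(2)[OF pqX] by simp
qed

end

section \<open>The leaf pseudometric\<close>

lemma pseudometric_on_cong:
  assumes "pseudometric_on Y \<delta>" and "\<And>x y. \<lbrakk>x \<in> Y; y \<in> Y\<rbrakk> \<Longrightarrow> \<delta>' x y = \<delta> x y"
  shows "pseudometric_on Y \<delta>'"
  using assms(1) unfolding pseudometric_on_def by (simp add: assms(2))

lemma pseudometric_on_pullback:
  assumes "pseudometric_on Y \<delta>" and "\<And>x. x \<in> P \<Longrightarrow> f x \<in> Y"
  shows "pseudometric_on P (\<lambda>x y. \<delta> (f x) (f y))"
  using pseudometric_onD[OF assms(1)] assms(2) unfolding pseudometric_on_def by simp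

locale leaf_space =
  fixes X :: "'m topology" and A :: "('m, 'e::euclidean_space) chart set"
    and F :: "('m, 'e) plane_field" and d :: "'m \<Rightarrow> 'm \<Rightarrow> real"
  assumes d_nonneg: "\<And>x y. \<lbrakk>x \<in> topspace X; y \<in> topspace X\<rbrakk> \<Longrightarrow> 0 \<le> d x y"
    and d_zero: "\<And>x. x \<in> topspace X \<Longrightarrow> d x x = 0"
    and d_sym: "\<And>x y. d x y = d y x"
begin

abbreviation (input) "\<L> \<equiv> leaves X A F"
abbreviation (input) "\<rho> \<equiv> leaf_rho d \<L>"

lemma leaf_in_leaves: "x \<in> topspace X \<Longrightarrow> leaf X A F x \<in> \<L>"
  by (simp add: leaves_def)

lemma leavesE:
  assumes "L \<in> \<L>"
  obtains x where "x \<in> topspace X" "L = leaf X A F x"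
  using assms by (auto simp: leaves_def)

lemma leaves_subset:
  assumes "L \<in> \<L>"
  shows "L \<subseteq> topspace X"
  by (rule leavesE[OF assms]) (simp add: leaf_subset_topspace)

lemma leaf_dist_lower:
  assumes "L \<in> \<L>" "L' \<in> \<L>" "x \<in> L" "y \<in> L'"
  shows "leaf_dist d L L' \<le> d x y"
  unfolding leaf_dist_def
proof (rule cInf_lower)
  show "bdd_below {d x y |x y. x \<in> L \<and> y \<in> L'}"
    using leaves_subset[OF assms(1)] leaves_subset[OF assms(2)] d_nonneg
    by (intro bdd_belowI[of _ 0]) auto
qed (use assms in blast)

lemma le_leaf_dist:
  assumes "L \<in> \<L>" "L' \<in> \<L>" "\<And>x y. \<lbrakk>x \<in> L; y \<in> L'\<rbrakk> \<Longrightarrow> r \<le> d x y"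
  shows "r \<le> leaf_dist d L L'"
  unfolding leaf_dist_def
proof (rule cInf_greatest)
  obtain x y where "L = leaf X A F x" "L' = leaf X A F y"
    using leavesE[OF assms(1)] leavesE[OF assms(2)] by metis
  then have "x \<in> L" "y \<in> L'"
    by (simp_all add: leaf_refl)
  then show "{d x y |x y. x \<in> L \<and> y \<in> L'} \<noteq> {}"
    by blast
qed (use assms(3) in blast)

lemma leaf_dist_nonneg: "\<lbrakk>L \<in> \<L>; L' \<in> \<L>\<rbrakk> \<Longrightarrow> 0 \<le> leaf_dist d L L'"
  using leaves_subset d_nonneg by (intro le_leaf_dist) blast+

lemma leaf_dist_zero:
  assumes "L \<in> \<L>"
  shows "leaf_dist d L L = 0"
proof -
  obtain x where "x \<in> topspace X" "L = leaf X A F x"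
    by (rule leavesE[OF assms])
  then have "leaf_dist d L L \<le> 0"
    using leaf_dist_lower[OF assms assms, of x x] d_zero[of x] by (simp add: leaf_refl)
  then show ?thesis
    using leaf_dist_nonneg[OF assms assms] by simp
qed

lemma leaf_dist_sym: "leaf_dist d L L' = leaf_dist d L' L"
proof -
  have "{d x y |x y. x \<in> L \<and> y \<in> L'} = {d x y |x y. x \<in> L' \<and> y \<in> L}"
    using d_sym by blast
  then show ?thesis
    by (simp add: leaf_dist_def)
qed

lemma leaf_rho_eq: "\<lbrakk>L \<in> \<L>; L' \<in> \<L>\<rbrakk> \<Longrightarrow> \<rho> L L' = quotient_dist \<L> (leaf_dist d) (Id_on \<L>) L L'"
  by (rule leaf_rho_eq_quotient_dist[OF leaf_dist_zero])

lemma pseudometric_on_leaf_rho: "pseudometric_on \<L> \<rho>"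
proof (rule pseudometric_on_cong)
  show "pseudometric_on \<L> (quotient_dist \<L> (leaf_dist d) (Id_on \<L>))"
    by (intro pseudometric_on_quotient_dist leaf_dist_nonneg leaf_dist_zero leaf_dist_sym)
      (auto simp: sym_def refl_on_def)
qed (rule leaf_rho_eq)

lemma leaf_rho_le:
  assumes "x \<in> topspace X" "y \<in> topspace X"
  shows "\<rho> (leaf X A F x) (leaf X A F y) \<le> d x y"
proof -
  note L = leaf_in_leaves[OF assms(1)] leaf_in_leaves[OF assms(2)]
  have "\<rho> (leaf X A F x) (leaf X A F y) \<le> leaf_dist d (leaf X A F x) (leaf X A F y)"
    unfolding leaf_rho_eq[OF L] by (intro quotient_dist_le leaf_dist_nonneg L)
  also have "\<dots> \<le> d x y"
    by (intro leaf_dist_lower L leaf_refl)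
  finally show ?thesis .
qed

text \<open>Universal property of the leaf pseudometric: \<open>\<sigma>\<close> descends to the leaves, via representatives \<open>r L\<close>,
  and stays below \<open>leaf_dist d\<close> there.\<close>

lemma le_leaf_rho:
  assumes \<sigma>: "pseudometric_on (topspace X) \<sigma>"
    and le: "\<And>x y. \<lbrakk>x \<in> topspace X; y \<in> topspace X\<rbrakk> \<Longrightarrow> \<sigma> x y \<le> d x y"
    and leaf0: "\<And>p q. \<lbrakk>p \<in> topspace X; q \<in> leaf X A F p\<rbrakk> \<Longrightarrow> \<sigma> p q = 0"
    and x: "x \<in> topspace X" and y: "y \<in> topspace X"
  shows "\<sigma> x y \<le> \<rho> (leaf X A F x) (leaf X A F y)"
proof -
  note pm = pseudometric_onD[OF \<sigma>]
  define r where "r L = (SOME u. u \<in> L)" for L :: "'m set"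
  have rL: "r L \<in> L" if L: "L \<in> \<L>" for L
  proof -
    obtain u where "L = leaf X A F u"
      by (rule leavesE[OF L])
    then have "u \<in> L"
      by (simp add: leaf_refl)
    then show ?thesis
      unfolding r_def by (rule someI)
  qed
  have rX: "r L \<in> topspace X" if "L \<in> \<L>" for L
    using rL[OF that] leaves_subset[OF that] by blast
  have same: "\<sigma> u v = 0" if L: "L \<in> \<L>" and uv: "u \<in> L" "v \<in> L" for L u v
  proof -
    obtain z where z: "z \<in> topspace X" "L = leaf X A F z"
      by (rule leavesE[OF L])
    have "u \<in> topspace X"
      using leaves_subset[OF L] uv by blast
    moreover have "v \<in> leaf X A F u"
      using leaf_trans[OF leaf_sym, of u X A F z v] uv z by simp
    ultimately show ?thesis
      by (rule leaf0)
  qed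
  let ?\<tau> = "\<lambda>L L'. \<sigma> (r L) (r L')"
  have "?\<tau> L L' \<le> leaf_dist d L L'" if L: "L \<in> \<L>" "L' \<in> \<L>" for L L'
  proof (rule le_leaf_dist[OF L])
    fix u v assume uv: "u \<in> L" "v \<in> L'"
    have X: "u \<in> topspace X" "v \<in> topspace X" "r L \<in> topspace X" "r L' \<in> topspace X"
      using leaves_subset L uv rX by blast+
    have "\<sigma> (r L) (r L') \<le> \<sigma> (r L) u + \<sigma> u (r L')" "\<sigma> u (r L') \<le> \<sigma> u v + \<sigma> v (r L')"
      using X by (auto intro: pm(4))
    moreover have "\<sigma> (r L) u = 0" "\<sigma> v (r L') = 0"
      using same[OF L(1) rL[OF L(1)] uv(1)] same[OF L(2) uv(2) rL[OF L(2)]] by auto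
    ultimately show "\<sigma> (r L) (r L') \<le> d u v"
      using le[OF X(1,2)] by simp
  qed
  moreover have \<tau>: "pseudometric_on \<L> ?\<tau>"
    using \<sigma> rX by (rule pseudometric_on_pullback)
  moreover have "?\<tau> L L' = 0" if "L \<in> \<L>" "L' \<in> \<L>" "(L, L') \<in> Id_on \<L>" for L L'
    using that pseudometric_onD(1)[OF \<tau>] by auto
  ultimately have "?\<tau> (leaf X A F x) (leaf X A F y) \<le>
      quotient_dist \<L> (leaf_dist d) (Id_on \<L>) (leaf X A F x) (leaf X A F y)"
    by (intro le_quotient_dist leaf_in_leaves x y)
  moreover have "\<sigma> x y \<le> ?\<tau> (leaf X A F x) (leaf X A F y)"
  proof -
    let ?x = "r (leaf X A F x)" and ?y = "r (leaf X A F y)"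
    note L = leaf_in_leaves[OF x] leaf_in_leaves[OF y]
    have "\<sigma> x y \<le> \<sigma> x ?x + \<sigma> ?x y" "\<sigma> ?x y \<le> \<sigma> ?x ?y + \<sigma> ?y y"
      using x y rX[OF L(1)] rX[OF L(2)] by (auto intro: pm(4))
    moreover have "\<sigma> x ?x = 0" "\<sigma> ?y y = 0"
      using same[OF L(1) leaf_refl rL[OF L(1)]] same[OF L(2) rL[OF L(2)] leaf_refl] by auto
    ultimately show ?thesis
      by simp
  qed
  ultimately show ?thesis
    using leaf_rho_eq[OF leaf_in_leaves[OF x] leaf_in_leaves[OF y]] by simp
qed

end

section \<open>Leaves of the original foliation in the collar\<close>

text \<open>The leaf of \<open>p\<close> in the collar is a product \<open>L \<times> [0, 1)\<close>, which contains \<open>L \<times> {0}\<close>; and plaques inside the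
  collar are plaques of the manifold.\<close>

lemma collar_leaf_meets_S:
  assumes col: "foliated_collar X A F S \<kappa>" and S: "S \<subseteq> topspace X"
    and N: "\<kappa> ` (S \<times> {0..<1}) \<subseteq> topspace X" and p: "p \<in> \<kappa> ` (S \<times> {0..<1})"
  shows "\<exists>y\<in>S. y \<in> leaf X A F p"
proof -
  let ?N = "\<kappa> ` (S \<times> {0..<1})"
  let ?Y = "subtopology X ?N" and ?A = "{c \<in> A. dom_of c \<subseteq> ?N}"
  let ?LS = "leaves (subtopology X S) (boundary_atlas X A S) (induced_plane_field A F)"
  have eq: "leaves ?Y ?A F = {\<kappa> ` (L \<times> {0..<1}) |L. L \<in> ?LS}" and \<kappa>0: "\<forall>x\<in>S. \<kappa> (x, 0) = x"
    using col unfolding foliated_collar_def Let_def by blast+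
  have "leaf ?Y ?A F p \<in> leaves ?Y ?A F"
    unfolding leaves_def using p N by (intro imageI) auto
  then obtain L where L: "L \<in> ?LS" "leaf ?Y ?A F p = \<kappa> ` (L \<times> {0..<1})"
    unfolding eq by blast
  have LS: "L \<subseteq> S"
  proof -
    obtain x where "x \<in> topspace (subtopology X S)"
      "L = leaf (subtopology X S) (boundary_atlas X A S) (induced_plane_field A F) x"
      using L(1) unfolding leaves_def by blast
    then have "L \<subseteq> topspace (subtopology X S)"
      using leaf_subset_topspace by metis
    then show ?thesis
      by auto
  qed
  have "p \<in> \<kappa> ` (L \<times> {0..<1})"
    unfolding L(2)[symmetric] by (rule leaf_refl)
  then obtain y t where y: "y \<in> L" "t \<in> {0..<1::real}" "p = \<kappa> (y, t)"
    by auto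
  then have "\<kappa> (y, 0) \<in> leaf ?Y ?A F p"
    unfolding L(2) by (intro imageI) auto
  moreover have "\<kappa> (y, 0) = y" "y \<in> S"
    using \<kappa>0 LS y(1) by auto
  ultimately have y': "y \<in> leaf ?Y ?A F p" "y \<in> S"
    by auto
  have "plaque X A F P" if P: "plaque ?Y ?A F P" for P
  proof -
    obtain c u k where c: "foliated_chart ?A F c u"
      "P \<in> connected_components_of (subtopology ?Y {q \<in> dom_of c. coord c q \<bullet> u = k})"
      using P unfolding plaque_def by blast
    have cA: "foliated_chart A F c u" "dom_of c \<subseteq> ?N"
      using c(1) unfolding foliated_chart_def by auto
    have "?N \<inter> {q \<in> dom_of c. coord c q \<bullet> u = k} = {q \<in> dom_of c. coord c q \<bullet> u = k}"
      using cA(2) by blast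
    then have "P \<in> connected_components_of (subtopology X {q \<in> dom_of c. coord c q \<bullet> u = k})"
      using c(2) by (simp add: subtopology_subtopology)
    then show ?thesis
      unfolding plaque_def using cA(1) by blast
  qed
  then have "(\<lambda>x y. \<exists>P. plaque ?Y ?A F P \<and> x \<in> P \<and> y \<in> P) \<le> (\<lambda>x y. \<exists>P. plaque X A F P \<and> x \<in> P \<and> y \<in> P)"
    by blast
  then have "(\<lambda>x y. \<exists>P. plaque ?Y ?A F P \<and> x \<in> P \<and> y \<in> P)\<^sup>*\<^sup>* \<le> (\<lambda>x y. \<exists>P. plaque X A F P \<and> x \<in> P \<and> y \<in> P)\<^sup>*\<^sup>*"
    by (rule rtranclp_mono)
  then have "y \<in> leaf X A F p"
    using y'(1) unfolding leaf_def by (auto simp: le_fun_def)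
  then show ?thesis
    using y'(2) by blast
qed

section \<open>Collapsing a subset\<close>

lemma pseudometric_on_collapse:
  assumes "Metric_space Y dY"
  shows "pseudometric_on Y (quotient_dist Y dY (collapse_rel Y B))"
    and "\<lbrakk>x \<in> Y; y \<in> Y\<rbrakk> \<Longrightarrow> quotient_dist Y dY (collapse_rel Y B) x y \<le> dY x y"
    and "\<lbrakk>x \<in> Y \<inter> B; y \<in> Y \<inter> B\<rbrakk> \<Longrightarrow> quotient_dist Y dY (collapse_rel Y B) x y = 0"
proof -
  interpret Metric_space Y dY
    by (rule assms)
  have R: "sym (collapse_rel Y B)" "refl_on Y (collapse_rel Y B)"
    by (auto simp: sym_def refl_on_def collapse_rel_def)
  show "pseudometric_on Y (quotient_dist Y dY (collapse_rel Y B))"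
    by (intro pseudometric_on_quotient_dist R) (simp_all add: commute)
  show "quotient_dist Y dY (collapse_rel Y B) x y \<le> dY x y" if "x \<in> Y" "y \<in> Y"
    using that by (intro quotient_dist_le) simp_all
  show "quotient_dist Y dY (collapse_rel Y B) x y = 0" if "x \<in> Y \<inter> B" "y \<in> Y \<inter> B"
    using that by (intro quotient_dist_zero R) (simp_all add: collapse_rel_def)
qed

section \<open>The Hausdorff leaf space of the spun foliation\<close>

theorem theorem4p4:
  fixes X :: "'m topology"
    and A :: "('m, 'e::euclidean_space \<times> real) chart set"
    and g :: "('m, 'e \<times> real) chart \<Rightarrow> 'm \<Rightarrow> 'e \<times> real \<Rightarrow> 'e \<times> real \<Rightarrow> real"
    and F F\<^sub>S :: "('m, 'e \<times> real) plane_field"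
    and S :: "'m set"
    and \<omega> :: "('m, 'e) chart \<Rightarrow> 'm \<Rightarrow> 'e \<Rightarrow> real"
  assumes "smooth_manifold X half_space A"
    and "compact_space X" and "connected_space X"
    and "riemannian_metric A g"
    and "foliation X A F"
    and "manifold_boundary A \<noteq> {}"
    and "\<forall>p\<in>manifold_boundary A. transverse_to_boundary_at A F p"
    and "S \<in> connected_components_of (subtopology X (manifold_boundary A))"
    and "smooth_manifold (subtopology X S) UNIV (boundary_atlas X A S)"
    and "one_form (boundary_atlas X A S) \<omega>"
    and "closed_form (boundary_atlas X A S) \<omega>"
    and "nonsingular_form (boundary_atlas X A S) \<omega>"
    and "defined_by_form (boundary_atlas X A S) (induced_plane_field A F) \<omega>"
    and "spinning X A F S \<omega> F\<^sub>S"
  shows "isometric (HLS X A g F\<^sub>S) (HLS_dist X A g F\<^sub>S)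
           (collapse (HLS X A g F) (HLS_dist X A g F) (HLS_proj X A g F ` S))
           (collapse_dist (HLS X A g F) (HLS_dist X A g F) (HLS_proj X A g F ` S))"
proof -
  note M = assms(1) and X = assms(2,3) and g = assms(4) and F = assms(5) and S = assms(8)
  have F\<^sub>S: "foliation X A F\<^sub>S"
    using assms(14) unfolding spinning_def by blast
  obtain \<kappa> h where \<kappa>: "foliated_collar X A F S \<kappa>" and h: "spin_function h"
    and spin: "\<forall>c\<in>boundary_atlas X A S. \<forall>x\<in>dom_of c. \<forall>t\<in>{0..<1}.
           F\<^sub>S (collar_chart \<kappa> c) (\<kappa> (x, t)) = {w. spin_form \<omega> h c (x, t) w = 0}"
    and off: "\<forall>c\<in>A. \<forall>p\<in>dom_of c - \<kappa> ` (S \<times> {0..<1}). F\<^sub>S c p = F c p"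
    using assms(14) unfolding spinning_def by blast
  have inj: "inj_on \<kappa> (S \<times> {0..<1})" and \<kappa>0: "\<forall>x\<in>S. \<kappa> (x, 0) = x"
    and prod: "\<forall>c\<in>boundary_atlas X A S. collar_chart \<kappa> c \<in> A"
    using \<kappa> unfolding foliated_collar_def by blast+
  have connS: "connectedin X S"
    using connectedin_connected_components_of[OF S] by (simp add: connectedin_subtopology)
  interpret spun_collar X A S \<kappa> F\<^sub>S \<omega> h
  proof
    show "compactin X S"
      by (rule compactin_boundary_component[OF M X(1) S])
  qed (use M assms(9,12) inj \<kappa>0 prod F\<^sub>S h spin connS in simp_all)
  note H = convex_half_space
  let ?d = "riemannian_dist X A g"
  have d_small: "\<exists>V. openin X V \<and> p \<in> V \<and> (\<forall>x\<in>V. \<forall>y\<in>V. ?d x y < e)"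
    if "p \<in> topspace X" "e > 0" for p e
    by (rule riemannian_dist_locally_small[OF M H g that])
  have d_nonneg: "0 \<le> ?d x y" if "x \<in> topspace X" "y \<in> topspace X" for x y
    by (rule riemannian_dist_nonneg[OF M H X(2) g that])
  have d_zero: "?d x x = 0" if x: "x \<in> topspace X" for x
  proof -
    have "?d x x \<le> e" if "e > 0" for e
      using d_small[OF x that] by force
    then have "?d x x \<le> 0"
      by (rule field_le_epsilon[of _ 0, simplified])
    then show ?thesis
      using d_nonneg[OF x x] by simp
  qed
  interpret L: leaf_space X A F ?d
    by unfold_locales (rule d_nonneg d_zero riemannian_dist_sym[OF M g]; assumption?)+
  interpret LS: leaf_space X A F\<^sub>S ?d
    by unfold_locales (rule d_nonneg d_zero riemannian_dist_sym[OF M g]; assumption?)+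
  let ?\<L> = "leaves X A F" and ?\<rho> = "leaf_rho ?d (leaves X A F)"
  let ?Y = "HLS X A g F" and ?dY = "HLS_dist X A g F" and ?\<pi> = "HLS_proj X A g F"
  let ?q = "quotient_dist ?Y ?dY (collapse_rel ?Y (?\<pi> ` S))"
  have NX: "N \<subseteq> topspace X"
    by (rule openin_subset[OF openin_N])
  then have SX: "S \<subseteq> topspace X"
    using S_subset_N by blast

  have Y: "Metric_space ?Y ?dY"
    unfolding HLS_def HLS_dist_def by (rule Metric_space_class_dist[OF L.pseudometric_on_leaf_rho])
  have \<pi>Y: "?\<pi> x \<in> ?Y" if "x \<in> topspace X" for x
    unfolding HLS_def HLS_proj_def by (intro quotientI L.leaf_in_leaves that)
  have \<pi>_image: "?\<pi> ` topspace X = ?Y"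
    unfolding HLS_def HLS_proj_def quotient_def leaves_def by auto
  have dY: "?dY (?\<pi> x) (?\<pi> y) = ?\<rho> (leaf X A F x) (leaf X A F y)"
    if "x \<in> topspace X" "y \<in> topspace X" for x y
    unfolding HLS_dist_def HLS_proj_def
    by (intro class_dist_classes L.pseudometric_on_leaf_rho L.leaf_in_leaves that)
  note q = pseudometric_on_collapse[OF Y, where B = "?\<pi> ` S"]

  define \<sigma>\<^sub>S where "\<sigma>\<^sub>S x y = leaf_rho ?d (leaves X A F\<^sub>S) (leaf X A F\<^sub>S x) (leaf X A F\<^sub>S y)" for x y
  define \<sigma> where "\<sigma> x y = ?q (?\<pi> x) (?\<pi> y)" for x y
  have pm\<^sub>S: "pseudometric_on (topspace X) \<sigma>\<^sub>S"
    unfolding \<sigma>\<^sub>S_def by (rule pseudometric_on_pullback[OF LS.pseudometric_on_leaf_rho LS.leaf_in_leaves])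
  have pm: "pseudometric_on (topspace X) \<sigma>"
    unfolding \<sigma>_def by (rule pseudometric_on_pullback[OF q(1) \<pi>Y])
  have le\<^sub>S: "\<sigma>\<^sub>S x y \<le> ?d x y" if "x \<in> topspace X" "y \<in> topspace X" for x y
    unfolding \<sigma>\<^sub>S_def by (rule LS.leaf_rho_le[OF that])
  have le: "\<sigma> x y \<le> ?d x y" if xy: "x \<in> topspace X" "y \<in> topspace X" for x y
  proof -
    have "\<sigma> x y \<le> ?dY (?\<pi> x) (?\<pi> y)"
      unfolding \<sigma>_def by (rule q(2)[OF \<pi>Y[OF xy(1)] \<pi>Y[OF xy(2)]])
    also have "\<dots> \<le> ?d x y"
      unfolding dY[OF xy] by (rule L.leaf_rho_le[OF xy])
    finally show ?thesis .
  qed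
  have small: "\<exists>V. openin X V \<and> p \<in> V \<and> (\<forall>x\<in>V. \<forall>y\<in>V. \<tau> x y < e)"
    if \<tau>: "\<And>x y. \<lbrakk>x \<in> topspace X; y \<in> topspace X\<rbrakk> \<Longrightarrow> \<tau> x y \<le> ?d x y"
      and p: "p \<in> topspace X" and e: "e > 0" for \<tau> p e
  proof -
    obtain V where V: "openin X V" "p \<in> V" "\<forall>x\<in>V. \<forall>y\<in>V. ?d x y < e"
      using d_small[OF p e] by blast
    have "\<tau> x y < e" if "x \<in> V" "y \<in> V" for x y
      using \<tau>[of x y] V(3) openin_subset[OF V(1)] that by fastforce
    then show ?thesis
      using V(1,2) by blast
  qed
  note small\<^sub>S = small[OF le\<^sub>S] and small\<^sub>F = small[OF le]
  have small1\<^sub>S: "\<exists>V. openin X V \<and> p \<in> V \<and> (\<forall>q\<in>V. \<sigma>\<^sub>S p q < e)" if "p \<in> topspace X" "e > 0" for p e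
    using small\<^sub>S[OF _ _ that] by meson
  have small1: "\<exists>V. openin X V \<and> p \<in> V \<and> (\<forall>q\<in>V. \<sigma> p q < e)" if "p \<in> topspace X" "e > 0" for p e
    using small\<^sub>F[OF _ _ that] by meson
  have leaf0\<^sub>S: "\<sigma>\<^sub>S p q = 0" if p: "p \<in> topspace X" and q: "q \<in> leaf X A F\<^sub>S p" for p q
    unfolding \<sigma>\<^sub>S_def leaf_eq[OF q]
    by (rule pseudometric_onD(1)[OF LS.pseudometric_on_leaf_rho LS.leaf_in_leaves[OF p]])
  have leaf0: "\<sigma> x y = 0" if x: "x \<in> topspace X" and y: "y \<in> leaf X A F x" for x y
  proof -
    have "?\<pi> y = ?\<pi> x"
      unfolding HLS_proj_def leaf_eq[OF y] ..
    then show ?thesis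
      unfolding \<sigma>_def using pseudometric_onD(1)[OF q(1) \<pi>Y[OF x]] by simp
  qed
  have N0\<^sub>S: "\<sigma>\<^sub>S x y = 0" if "x \<in> N" "y \<in> N" for x y
    by (rule pseudometric_zero_on_collar[OF pm\<^sub>S small\<^sub>S leaf0\<^sub>S that])
  have \<pi>N: "?\<pi> x \<in> ?Y \<inter> ?\<pi> ` S" if x: "x \<in> N" for x
  proof -
    obtain y where y: "y \<in> S" "y \<in> leaf X A F x"
      using collar_leaf_meets_S[OF \<kappa> SX, of x] NX x unfolding N_def by blast
    have "?\<pi> y = ?\<pi> x"
      unfolding HLS_proj_def leaf_eq[OF y(2)] ..
    then show ?thesis
      using \<pi>Y[of x] NX x y(1) by (metis IntI imageI subsetD)
  qed
  have N0: "\<sigma> x y = 0" if "x \<in> N" "y \<in> N" for x y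
    unfolding \<sigma>_def by (rule q(3)[OF \<pi>N[OF that(1)] \<pi>N[OF that(2)]])
  have agree: "F c p = F\<^sub>S c p" "F\<^sub>S c p = F c p" if "c \<in> A" "p \<in> dom_of c" "p \<notin> N" for c p
    using off that unfolding N_def by auto

  \<comment> \<open>The two foliations agree off \<open>N\<close>, and both pseudometrics vanish on \<open>N\<close>; so each of them also
    vanishes along the leaves of the other foliation.\<close>
  have F0\<^sub>S: "\<sigma>\<^sub>S x y = 0" if "x \<in> topspace X" "y \<in> leaf X A F x" for x y
    by (rule pseudometric_zero_on_leaves[OF M H F\<^sub>S openin_N agree(1) pm\<^sub>S small1\<^sub>S leaf0\<^sub>S N0\<^sub>S that])
  have FS0: "\<sigma> x y = 0" if "x \<in> topspace X" "y \<in> leaf X A F\<^sub>S x" for x y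
    by (rule pseudometric_zero_on_leaves[OF M H F openin_N agree(2) pm small1 leaf0 N0 that])

  have eq: "\<sigma> x y = \<sigma>\<^sub>S x y" if xy: "x \<in> topspace X" "y \<in> topspace X" for x y
  proof (rule antisym)
    show "\<sigma> x y \<le> \<sigma>\<^sub>S x y"
      unfolding \<sigma>\<^sub>S_def by (rule LS.le_leaf_rho[OF pm le FS0 xy])
    have \<sigma>\<^sub>S_le: "\<sigma>\<^sub>S x y \<le> ?dY (?\<pi> x) (?\<pi> y)" if xy: "x \<in> topspace X" "y \<in> topspace X" for x y
      unfolding dY[OF xy] by (rule L.le_leaf_rho[OF pm\<^sub>S le\<^sub>S F0\<^sub>S xy])
    \<comment> \<open>To use the universal property on the leaf space, \<open>\<sigma>\<^sub>S\<close> is transported there by representatives.\<close>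
    define r where "r a = (SOME x. x \<in> topspace X \<and> ?\<pi> x = a)" for a
    have r: "r a \<in> topspace X" "?\<pi> (r a) = a" if "a \<in> ?Y" for a
    proof -
      have "\<exists>x. x \<in> topspace X \<and> ?\<pi> x = a"
        using that unfolding \<pi>_image[symmetric] by blast
      then show "r a \<in> topspace X" "?\<pi> (r a) = a"
        using someI_ex[of "\<lambda>x. x \<in> topspace X \<and> ?\<pi> x = a"] unfolding r_def by blast+
    qed
    have fibre: "\<sigma>\<^sub>S x y = 0" if xy: "x \<in> topspace X" "y \<in> topspace X" and eq: "?\<pi> x = ?\<pi> y" for x y
    proof -
      have "\<sigma>\<^sub>S x y \<le> ?dY (?\<pi> x) (?\<pi> y)"
        by (rule \<sigma>\<^sub>S_le[OF xy])
      also have "\<dots> = 0"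
        using Metric_space.zero[OF Y \<pi>Y[OF xy(1)] \<pi>Y[OF xy(2)]] eq by simp
      finally show ?thesis
        using pseudometric_onD(2)[OF pm\<^sub>S xy] by simp
    qed
    let ?\<tau> = "\<lambda>a b. \<sigma>\<^sub>S (r a) (r b)"
    have "?\<tau> (?\<pi> x) (?\<pi> y) \<le> ?q (?\<pi> x) (?\<pi> y)"
    proof (rule le_quotient_dist)
      show \<tau>: "pseudometric_on ?Y ?\<tau>"
        using pm\<^sub>S r(1) by (rule pseudometric_on_pullback)
      show "?\<tau> a b \<le> ?dY a b" if "a \<in> ?Y" "b \<in> ?Y" for a b
        using \<sigma>\<^sub>S_le[OF r(1)[OF that(1)] r(1)[OF that(2)]] r(2)[OF that(1)] r(2)[OF that(2)] by simp
      show "?\<tau> a b = 0" if ab: "a \<in> ?Y" "b \<in> ?Y" "(a, b) \<in> collapse_rel ?Y (?\<pi> ` S)" for a b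
      proof (cases "a = b")
        case True
        then show ?thesis
          using pseudometric_onD(1)[OF \<tau> ab(2)] by simp
      next
        case False
        then obtain s t where st: "s \<in> S" "t \<in> S" "a = ?\<pi> s" "b = ?\<pi> t"
          using ab(3) unfolding collapse_rel_def by blast
        have stX: "s \<in> topspace X" "t \<in> topspace X"
          using st SX by auto
        have "\<sigma>\<^sub>S (r a) s = 0" "\<sigma>\<^sub>S t (r b) = 0"
          using fibre[OF r(1)[OF ab(1)] stX(1)] fibre[OF stX(2) r(1)[OF ab(2)]]
            r(2)[OF ab(1)] r(2)[OF ab(2)] st by simp_all
        moreover have "\<sigma>\<^sub>S s t = 0"
          using N0\<^sub>S st(1,2) S_subset_N by blast
        ultimately show ?thesis
          using pseudometric_on_zero_trans[OF pm\<^sub>S r(1)[OF ab(1)] stX(1) stX(2)]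
            pseudometric_on_zero_trans[OF pm\<^sub>S r(1)[OF ab(1)] stX(2) r(1)[OF ab(2)]] by simp
      qed
    qed (intro \<pi>Y xy)+
    moreover have "\<sigma>\<^sub>S x y \<le> ?\<tau> (?\<pi> x) (?\<pi> y)"
    proof -
      let ?x = "r (?\<pi> x)" and ?y = "r (?\<pi> y)"
      note rx = r[OF \<pi>Y[OF xy(1)]] and ry = r[OF \<pi>Y[OF xy(2)]]
      have "\<sigma>\<^sub>S x y \<le> \<sigma>\<^sub>S x ?x + \<sigma>\<^sub>S ?x y" "\<sigma>\<^sub>S ?x y \<le> \<sigma>\<^sub>S ?x ?y + \<sigma>\<^sub>S ?y y"
        by (rule pseudometric_onD(4)[OF pm\<^sub>S xy(1) rx(1) xy(2)],
            rule pseudometric_onD(4)[OF pm\<^sub>S rx(1) ry(1) xy(2)])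
      moreover have "\<sigma>\<^sub>S x ?x = 0" "\<sigma>\<^sub>S ?y y = 0"
        using fibre[OF xy(1) rx(1)] fibre[OF ry(1) xy(2)] rx(2) ry(2) by simp_all
      ultimately show ?thesis
        by simp
    qed
    ultimately show "\<sigma>\<^sub>S x y \<le> \<sigma> x y"
      unfolding \<sigma>_def by simp
  qed
  have "isometric (leaves X A F\<^sub>S // zero_dist_rel (leaves X A F\<^sub>S) (leaf_rho ?d (leaves X A F\<^sub>S)))
      (class_dist (leaves X A F\<^sub>S) (leaf_rho ?d (leaves X A F\<^sub>S)))
      (?Y // zero_dist_rel ?Y ?q) (class_dist ?Y ?q)"
    by (rule isometric_class_dist[OF LS.pseudometric_on_leaf_rho q(1) leaves_def[symmetric] \<pi>_image])
      (use eq in \<open>simp add: \<sigma>_def \<sigma>\<^sub>S_def\<close>)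
  then show ?thesis
    unfolding HLS_def[of X A g F\<^sub>S] HLS_dist_def[of X A g F\<^sub>S] collapse_def collapse_dist_def .
qed

end
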